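(* In the setting of the context, let $\mathscr L(z)$ be the Lax matrix and $\varphi(z)$ the twist function of the dihedral affine Gaudin model with levels $\bm\ell$. Set $$\mathcal R^0(z,z')=\frac{\sum_{k=0}^{T-1}z^k z'^{\,T-1-k}\,C^{(-k)}}{z'^{\,T}-z^T},\qquad \mathcal R(z,z')=\mathcal R^0(z,z')\,\varphi(z')^{-1}.$$ Then the Poisson bracket of the Lax matrix takes the form $$\{\mathscr L_{1}(z),\mathscr L_{2}(z')\}=\big[\mathcal R_{12}(z,z'),\mathscr L_{1}(z)\big]\delta_{\theta\theta'}-\big[\mathcal R_{21}(z',z),\mathscr L_{2}(z')\big]\delta_{\theta\theta'}-\big(\mathcal R_{12}(z,z')+\mathcal R_{21}(z',z)\big)\delta'_{\theta\theta'},$$ where $\mathscr L_1(z)$ is evaluated at $\theta$ and $\mathscr L_2(z')$ at $\theta'$.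
   Context: **Algebra.** Fix $T\in\mathbb Z_{\ge1}$, a primitive $T$-th root of unity $\omega$, and $\Pi=D_{2T}=\langle\mathsf s,\mathsf t\mid\mathsf s^T=\mathsf t^2=(\mathsf s\mathsf t)^2=1\rangle$. $\mathfrak g$ is a finite-dimensional complex Lie algebra, $\sigma$ a linear automorphism with $\sigma^T=\mathrm{id}$, $\tau$ an anti-linear involutive automorphism preserving each eigenspace $\mathfrak g_{(j),\mathbb C}=\{x\mid\sigma x=\omega^jx\}$, $j\in\mathbb Z_T$; $\mathfrak g_0=\mathfrak g^\tau$, $\mathfrak g_{(j)}=\mathfrak g_{(j),\mathbb C}\cap\mathfrak g_0$. $\langle\cdot,\cdot\rangle$ is a $\sigma$-invariant non-degenerate invariant symmetric bilinear form on $\mathfrak g$ which is the complex-bilinear extension of a real-valued one on $\mathfrak g_0$. $I^a$ is a basis of $\mathfrak g_0$ with dual basis $I_a$; $I^{(j,\alpha)}$ is a basis of $\mathfrak g_{(j)}$ and $I_{(-j,\alpha)}$ the dual basis of $\mathfrak g_{(-j)}$. Repeated Lie algebra indices are summed. $C^{(j)}=I_{(-j,\alpha)}\otimes I^{(j,\alpha)}$. $\widehat{\mathfrak g}=\mathfrak g\otimes\mathbb C[u,u^{-1}]\oplus\mathbb C\mathsf K$, $x_n=x\otimes u^n$, $[x_m,y_n]=[x,y]_{m+n}+m\,\delta_{m+n,0}\langle x,y\rangle\mathsf K$, $\mathsf K$ central; $\sigma(x_n)=(\sigma x)_n$, $\sigma\mathsf K=\mathsf K$, $\tau(x_n)=(\tau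 x)_{-n}$, $\tau\mathsf K=-\mathsf K$ ($\tau$ anti-linear). **Points.** $\Pi$ acts on $\mathbb P^1$ by $\mathsf s:z\mapsto\omega z$, $\mathsf t:z\mapsto\bar z$; $\Pi_x$ is the stabiliser of $x$. $\bm z=\{z_1,\dots,z_N,\infty\}$ is finite with pairwise disjoint $\Pi$-orbits. $\bm z_{\rm f}=\bm z\cap\{0,\infty\}$; $\bm z_{\rm r}^k$ = points of $\bm z\setminus\{0,\infty\}$ with $\Pi_x=\langle\mathsf s^k\mathsf t\rangle$; $\bm z'_{\rm r}=\bigcup_k\bm z_{\rm r}^k$; $\bm z_{\rm c}$ = points with trivial stabiliser; $\bar{\bm z}_{\rm c}$ the set of their conjugates; $\bm{\mathcal Z}'=\bm z_{\rm c}\cup\bar{\bm z}_{\rm c}\cup\bm z'_{\rm r}$. $\mathcal D=\sum_{x\in\bm z}n_x x$ with $n_x\ge1$, and $n_\infty\ge2$ or $|\bm z|\ge2$; $n_{\bar x}:=n_x$. **Takiff algebras.** For finite $x\in\bm z$ let $\mathcal T_x=\widehat{\mathfrak g}\otimes\mathbb C[\varepsilon_x]/(\varepsilon_x^{n_x})$, and $\mathcal T_\infty=\widehat{\mathfrak g}\otimes\varepsilon_\infty\mathbb C[\varepsilon_\infty]/\varepsilon_\infty^{n_\infty}\mathbb C[\varepsilon_\infty]$. $\Pi$ acts by $\hat{\mathsf s}(X\otimes\varepsilon_x^p)=\omega^{-p}\sigma X\otimes\varepsilon_x^p$ ($\omega^{p}$ instead of $\omega^{-p}$ if $x=\infty$),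 and anti-linearly by $\hat{\mathsf t}(X\otimes\varepsilon_x^p)=\tau X\otimes\varepsilon_x^p$. $\widehat{\mathfrak g}^{\mathcal D}=\bigoplus_{x\in\bm z}\mathcal T_x^{\Pi_x}$ (a real Lie algebra), $\widehat{\mathfrak g}^{\mathcal D}_{\mathbb C}=\widehat{\mathfrak g}^{\mathcal D}\otimes_{\mathbb R}\mathbb C$, and $c$ is complex conjugation in the second factor. Elements of $\widehat{\mathfrak g}^{\mathcal D}_{\mathbb C}$: for $x\in\bm z_{\rm c}$, $X^{(x)}_{[p]}=\tfrac12\big((X\otimes\varepsilon_x^p)\otimes1-(iX\otimes\varepsilon_x^p)\otimes i\big)$ and $X^{(\bar x)}_{[p]}=\tfrac12\big((X\otimes\varepsilon_x^p)\otimes1+(iX\otimes\varepsilon_x^p)\otimes i\big)$; for $x\in\bm z_{\rm r}^k$, with $\chi=\omega^{-kp}\sigma^k\tau$, $X^{(x)}_{[p]}=\tfrac12\big((X+\chi X)\otimes\varepsilon_x^p\big)\otimes1-\tfrac12\big(i(X-\chi X)\otimes\varepsilon_x^p\big)\otimes i$; for $x\in\bm z_{\rm f}$ the same formula with $\chi=\tau$, where $\sigma X=\omega^{p}X$ if $x=0$ and $\sigma X=\omega^{-p}X$ if $x=\infty$. Here $0\le p\le n_x-1$ ($1\le p\le n_\infty-1$ at $\infty$). **Levels.** $\bm\ell$ is a tuple of complex numbers $\ell^x_p$ ($x\in\bm{\mathcal Z}'$, $0\le p\le n_x-1$), $\ell^0_p$ ($0\le p\le n_0-1$, if $0\in\bm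 z$), $\ell^\infty_p$ ($1\le p\le n_\infty-1$), with $\ell^0_p=\ell^\infty_p=0$ if $T\nmid p$, $\ell^x_{n_x-1}\ne0$ for all these $x$ (at $\infty$ when $n_\infty\ge2$), $\ell^x_p:=0$ for $p\ge n_x$; and $\overline{\ell^x_p}=\ell^{\bar x}_p$ for $x\in\bm z_{\rm c}\cup\bar{\bm z}_{\rm c}$, $\overline{\ell^x_p}=\omega^{-kp}\ell^x_p$ for $x\in\bm z_{\rm r}^k$, $\ell^x_p\in\mathbb R$ for $x\in\bm z_{\rm f}$. $S_{\bm\ell}$ is the quotient of the symmetric algebra $S(\widehat{\mathfrak g}^{\mathcal D}_{\mathbb C})$ (with the Poisson bracket extending the Lie bracket) by the Poisson ideal generated by $\mathsf K^{(x)}_{[p]}-i\ell^x_p$ for $x\in\bm z_{\rm c}\cup\bm z'_{\rm r}\cup\bm z_{\rm f}$ and $\mathsf K^{(y)}_{[p]}+i\ell^y_p$ for $y\in\bar{\bm z}_{\rm c}$. $\widehat{\mathfrak g}^{\mathcal D}_{\mathbb C,\bm\ell}\subset S_{\bm\ell}$ is the image of $\widehat{\mathfrak g}^{\mathcal D}_{\mathbb C}$. **Classical fields.** $\mathscr T(S^1)$ is the algebra of trigonometric polynomials on $S^1=\mathbb R/2\pi\mathbb Z$, $e_n(\theta)=e^{in\theta}$. The following formal Fourier series lie in the natural completion of $\mathfrak g\otimes\mathscr T(S^1)\otimes\widehat{\mathfrak g}^{\mathcal D}_{\mathbb C,\bm\ell}$: $A^x_{[p]}=\sum_{n}I_a\otimes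 e_{-n}\otimes(I^a_n)^{(x)}_{[p]}$ for $x\in\bm z_{\rm c}\cup\bm z'_{\rm r}$; $A^y_{[p]}=\sum_nI_a\otimes e_n\otimes(I^a_n)^{(y)}_{[p]}$ for $y\in\bar{\bm z}_{\rm c}$; $A^0_{[p]}=\sum_nI_{(-p,\alpha)}\otimes e_{-n}\otimes(I^{(p,\alpha)}_n)^{(0)}_{[p]}$; $A^\infty_{[q+1]}=\sum_nI_{(q+1,\alpha)}\otimes e_{-n}\otimes(I^{(-q-1,\alpha)}_n)^{(\infty)}_{[q+1]}$. Fields with $[p]$, $p\ge n_x$, and fields at $0$ if $0\notin\bm z$, are zero; likewise the levels. **Twist function and Lax matrix.** $$\varphi(z)=\frac1T\sum_{k=0}^{T-1}\sum_{x\in\bm{\mathcal Z}'}\sum_{p\ge0}\frac{\omega^{-k}\ell^x_p}{(\omega^{-k}z-x)^{p+1}}+\sum_{p\ge0}\ell^0_pz^{-p-1}-\sum_{q\ge0}\ell^\infty_{q+1}z^q,$$ and $\mathscr L(z)$ is defined by $$\varphi(z)\mathscr L(z)=\frac1T\sum_{k=0}^{T-1}\sum_{x\in\bm{\mathcal Z}'}\sum_{p\ge0}\frac{\omega^{-k}\sigma^kA^x_{[p]}}{(\omega^{-k}z-x)^{p+1}}+\sum_{p\ge0}A^0_{[p]}z^{-p-1}-\sum_{q\ge0}A^\infty_{[q+1]}z^q,$$ $\sigma$ acting on the factor $\mathfrak g$. **Brackets.** For $A=\sum x\otimes f\otimes a$, $B=\sum y\otimes g\otimes b$ put $\{A_1,B_2\}=\sum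 x\otimes y\otimes f(\theta)g(\theta')\otimes\{a,b\}$, formal series with values in $\mathfrak g\otimes\mathfrak g$; indices $1,2$ label the two factors $\mathfrak g$, $M_{21}$ denotes $M$ with its two factors $\mathfrak g$ exchanged, and commutators are taken in the factor(s) in common. $\delta_{\theta\theta'}=\sum_{n\in\mathbb Z}e_n(\theta)e_{-n}(\theta')$, $\delta'_{\theta\theta'}=\sum_{n\in\mathbb Z}in\,e_n(\theta)e_{-n}(\theta')$. The identity is one of such formal series with coefficients rational in $z,z'$. *)

theory Defs
  imports Complex_Main "HOL-Library.Poly_Mapping" "HOL-Library.Product_Plus"
    "HOL-Library.Disjoint_Sets"
begin

alias single = Poly_Mapping.single
alias lookup = Poly_Mapping.lookup
alias keys = Poly_Mapping.keys

section \<open>The data of a dihedral affine Gaudin model\<close>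

datatype rpoint = Fin (cval: complex) | Infty

text \<open>
  The whole type \<open>'g\<close> is the underlying set of the Lie algebra. A basis is a finite set that indexes
  itself: the elements of \<open>bas\<close> are the \<open>I\<^sup>a\<close> and \<open>dual\<close> maps \<open>I\<^sup>a\<close> to \<open>I\<^sub>a\<close>; likewise \<open>gbas j\<close>
  consists of the \<open>I\<close> with upper index \<open>(j, \<alpha>)\<close>, and \<open>gdual j\<close> maps it to the \<open>I\<close> with lower
  index \<open>(-j, \<alpha>)\<close>. The grading index \<open>j\<close> is an integer read modulo \<open>T\<close>.
\<close>

record 'g gaudin =
  cyc :: nat  \<comment> \<open>\<open>T\<close>\<close>
  rt :: complex  \<comment> \<open>\<open>\<omega>\<close>\<close>
  sc :: "complex \<Rightarrow> 'g \<Rightarrow> 'g"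
  br :: "'g \<Rightarrow> 'g \<Rightarrow> 'g"
  frm :: "'g \<Rightarrow> 'g \<Rightarrow> complex"
  sig :: "'g \<Rightarrow> 'g"
  tau :: "'g \<Rightarrow> 'g"
  bas :: "'g set"
  dual :: "'g \<Rightarrow> 'g"
  gbas :: "int \<Rightarrow> 'g set"
  gdual :: "int \<Rightarrow> 'g \<Rightarrow> 'g"
  pts :: "rpoint set"
  mlt :: "rpoint \<Rightarrow> nat"  \<comment> \<open>\<open>n\<^sub>x\<close>\<close>
  lev :: "rpoint \<Rightarrow> nat \<Rightarrow> complex"

definition real_form :: "('g::ab_group_add) gaudin \<Rightarrow> 'g set" where
  "real_form D = {x. tau D x = x}"

definition eigenspace :: "('g::ab_group_add) gaudin \<Rightarrow> int \<Rightarrow> 'g set" where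
  "eigenspace D j = {x. sig D x = sc D (rt D powi j) x}"

definition real_eigenspace :: "('g::ab_group_add) gaudin \<Rightarrow> int \<Rightarrow> 'g set" where
  "real_eigenspace D j = eigenspace D j \<inter> real_form D"

definition real_basis :: "('g::ab_group_add) gaudin \<Rightarrow> 'g set \<Rightarrow> 'g set \<Rightarrow> bool" where
  "real_basis D B W \<longleftrightarrow> finite B \<and>
     \<not> module.dependent (\<lambda>r::real. sc D (of_real r)) B \<and>
     module.span (\<lambda>r::real. sc D (of_real r)) B = W"

locale gaudin_algebra =
  fixes D :: "('g::ab_group_add) gaudin"
  assumes T_pos: "cyc D \<ge> 1"
    and rt_root: "rt D ^ cyc D = 1"
    and rt_primitive: "\<And>k. 0 < k \<Longrightarrow> k < cyc D \<Longrightarrow> rt D ^ k \<noteq> 1"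
    and fin_dim: "\<exists>Bs. finite_dimensional_vector_space (sc D) Bs"
    and br_linear_right: "\<And>x. Vector_Spaces.linear (sc D) (sc D) (\<lambda>y. br D x y)"
    and br_linear_left: "\<And>y. Vector_Spaces.linear (sc D) (sc D) (\<lambda>x. br D x y)"
    and br_alternating: "\<And>x. br D x x = 0"
    and jacobi: "\<And>x y w. br D x (br D y w) + br D y (br D w x) + br D w (br D x y) = 0"
    and sig_linear: "Vector_Spaces.linear (sc D) (sc D) (sig D)"
    and sig_br: "\<And>x y. sig D (br D x y) = br D (sig D x) (sig D y)"
    and sig_order: "sig D ^^ cyc D = id"
    and tau_add: "\<And>x y. tau D (x + y) = tau D x + tau D y"
    and tau_antilinear: "\<And>c x. tau D (sc D c x) = sc D (cnj c) (tau D x)"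
    and tau_br: "\<And>x y. tau D (br D x y) = br D (tau D x) (tau D y)"
    and tau_involutive: "\<And>x. tau D (tau D x) = x"
    and tau_eigenspace: "\<And>j. tau D ` eigenspace D j \<subseteq> eigenspace D j"
    and frm_linear: "\<And>x. Vector_Spaces.linear (sc D) (*) (\<lambda>y. frm D x y)"
    and frm_sym: "\<And>x y. frm D x y = frm D y x"
    and frm_invariant: "\<And>x y w. frm D (br D x y) w = frm D x (br D y w)"
    and frm_nondegenerate: "\<And>x. (\<And>y. frm D x y = 0) \<Longrightarrow> x = 0"
    and frm_sig: "\<And>x y. frm D (sig D x) (sig D y) = frm D x y"
    and frm_real: "\<And>x y. x \<in> real_form D \<Longrightarrow> y \<in> real_form D \<Longrightarrow> frm D x y \<in> \<real>"
    and bas: "real_basis D (bas D) (real_form D)"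
    and dual_real: "\<And>a. a \<in> bas D \<Longrightarrow> dual D a \<in> real_form D"
    and dual: "\<And>a b. a \<in> bas D \<Longrightarrow> b \<in> bas D \<Longrightarrow> frm D (dual D a) b = of_bool (a = b)"
    and gbas: "\<And>j. real_basis D (gbas D j) (real_eigenspace D j)"
    and gbas_mod: "\<And>j. gbas D (j mod int (cyc D)) = gbas D j"
    and gdual_real: "\<And>j a. a \<in> gbas D j \<Longrightarrow> gdual D j a \<in> real_eigenspace D (- j)"
    and gdual: "\<And>j a b. a \<in> gbas D j \<Longrightarrow> b \<in> gbas D j \<Longrightarrow>
                  frm D (gdual D j a) b = of_bool (a = b)"

text \<open>The element \<open>s\<^sup>k t\<^sup>e\<close> of the dihedral group is the pair \<open>(k, e)\<close> with \<open>k < T\<close>.\<close>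

definition dihedral :: "'g gaudin \<Rightarrow> (nat \<times> bool) set" where
  "dihedral D = {..<cyc D} \<times> UNIV"

fun pact :: "'g gaudin \<Rightarrow> nat \<times> bool \<Rightarrow> rpoint \<Rightarrow> rpoint" where
  "pact D (k, e) (Fin w) = Fin (rt D ^ k * (if e then cnj w else w))"
| "pact D (k, e) Infty = Infty"

definition orbit :: "'g gaudin \<Rightarrow> rpoint \<Rightarrow> rpoint set" where
  "orbit D x = (\<lambda>g. pact D g x) ` dihedral D"

definition stab :: "'g gaudin \<Rightarrow> rpoint \<Rightarrow> (nat \<times> bool) set" where
  "stab D x = {g \<in> dihedral D. pact D g x = x}"

definition pts_f :: "'g gaudin \<Rightarrow> rpoint set" where
  "pts_f D = pts D \<inter> {Fin 0, Infty}"

text \<open>\<open>s\<^sup>k t\<close> is an involution, so the subgroup it generates is \<open>{1, s\<^sup>k t}\<close>.\<close>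

definition pts_rk :: "'g gaudin \<Rightarrow> nat \<Rightarrow> rpoint set" where
  "pts_rk D k = {x \<in> pts D - {Fin 0, Infty}. stab D x = {(0, False), (k, True)}}"

definition pts_r :: "'g gaudin \<Rightarrow> rpoint set" where
  "pts_r D = (\<Union>k<cyc D. pts_rk D k)"

definition pts_c :: "'g gaudin \<Rightarrow> rpoint set" where
  "pts_c D = {x \<in> pts D. stab D x = {(0, False)}}"

fun conj_pt :: "rpoint \<Rightarrow> rpoint" where
  "conj_pt (Fin w) = Fin (cnj w)"
| "conj_pt Infty = Infty"

definition pts_cbar :: "'g gaudin \<Rightarrow> rpoint set" where
  "pts_cbar D = conj_pt ` pts_c D"

definition pts_Z :: "'g gaudin \<Rightarrow> rpoint set" where
  "pts_Z D = pts_c D \<union> pts_cbar D \<union> pts_r D"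

definition exps :: "'g gaudin \<Rightarrow> rpoint \<Rightarrow> nat set" where
  "exps D x = (if x = Infty then {1..<mlt D x} else {..<mlt D x})"

locale gaudin_points =
  fixes D :: "('g::ab_group_add) gaudin"
  assumes pts_finite: "finite (pts D)"
    and infty_pts: "Infty \<in> pts D"
    and orbits_disjoint: "disjoint_family_on (orbit D) (pts D)"
    and mlt_pos: "\<And>x. x \<in> pts D \<Longrightarrow> mlt D x \<ge> 1"
    and mlt_big: "mlt D Infty \<ge> 2 \<or> card (pts D) \<ge> 2"
    and mlt_conj: "\<And>x. x \<in> pts_c D \<Longrightarrow> mlt D (conj_pt x) = mlt D x"

locale gaudin_levels =
  fixes D :: "('g::ab_group_add) gaudin"
  assumes lev_fixed: "\<And>x p. x \<in> pts_f D \<Longrightarrow> p \<in> exps D x \<Longrightarrow> \<not> cyc D dvd p \<Longrightarrow> lev D x p = 0"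
    and lev_top: "\<And>x. x \<in> pts_Z D \<union> pts_f D \<Longrightarrow> (x = Infty \<Longrightarrow> mlt D x \<ge> 2) \<Longrightarrow>
                    lev D x (mlt D x - 1) \<noteq> 0"
    and lev_vanish: "\<And>x p. x \<in> pts_Z D \<union> pts_f D \<Longrightarrow> p \<ge> mlt D x \<Longrightarrow> lev D x p = 0"
    and lev_conj: "\<And>x p. x \<in> pts_c D \<union> pts_cbar D \<Longrightarrow> cnj (lev D x p) = lev D (conj_pt x) p"
    and lev_r: "\<And>k x p. k < cyc D \<Longrightarrow> x \<in> pts_rk D k \<Longrightarrow>
                  cnj (lev D x p) = rt D powi (- (int k * int p)) * lev D x p"
    and lev_f: "\<And>x p. x \<in> pts_f D \<Longrightarrow> p \<in> exps D x \<Longrightarrow> lev D x p \<in> \<real>"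

locale dihedral_affine_gaudin =
  gaudin_algebra D + gaudin_points D + gaudin_levels D
  for D :: "('g::ab_group_add) gaudin"

section \<open>The affine algebra\<close>

text \<open>\<open>(f, c)\<close> stands for \<open>\<Sum>\<^sub>n f(n) \<otimes> u\<^sup>n + c K\<close>.\<close>

type_synonym 'g loop = "(int \<Rightarrow>\<^sub>0 'g) \<times> complex"

definition lmode :: "'g::ab_group_add \<Rightarrow> int \<Rightarrow> 'g loop" where
  "lmode x n = (single n x, 0)"

definition loopK :: "('g::ab_group_add) loop" where
  "loopK = (0, 1)"

definition loop_scale :: "('g::ab_group_add) gaudin \<Rightarrow> complex \<Rightarrow> 'g loop \<Rightarrow> 'g loop" where
  "loop_scale D c X = (Poly_Mapping.map (sc D c) (fst X), c * snd X)"

definition loop_br :: "('g::ab_group_add) gaudin \<Rightarrow> 'g loop \<Rightarrow> 'g loop \<Rightarrow> 'g loop" where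
  "loop_br D X Y =
     (\<Sum>m\<in>keys (fst X). \<Sum>n\<in>keys (fst Y).
        let x = lookup (fst X) m; y = lookup (fst Y) n in
          (single (m + n) (br D x y), of_int m * of_bool (m + n = 0) * frm D x y))"

definition loop_sig :: "('g::ab_group_add) gaudin \<Rightarrow> 'g loop \<Rightarrow> 'g loop" where
  "loop_sig D X = (Poly_Mapping.map (sig D) (fst X), snd X)"

definition loop_tau :: "('g::ab_group_add) gaudin \<Rightarrow> 'g loop \<Rightarrow> 'g loop" where
  "loop_tau D X =
     (\<Sum>n\<in>keys (fst X). single (- n) (tau D (lookup (fst X) n)), - cnj (snd X))"

section \<open>Takiff algebras and their complexified invariants\<close>

type_synonym 'g takiff = "nat \<Rightarrow>\<^sub>0 'g loop"

definition takiff :: "('g::ab_group_add) gaudin \<Rightarrow> rpoint \<Rightarrow> 'g takiff set" where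
  "takiff D x = {v. keys v \<subseteq> exps D x}"

definition takiff_br ::
  "('g::ab_group_add) gaudin \<Rightarrow> rpoint \<Rightarrow> 'g takiff \<Rightarrow> 'g takiff \<Rightarrow> 'g takiff" where
  "takiff_br D x v w =
     (\<Sum>p\<in>keys v. \<Sum>q\<in>keys w.
        if p + q < mlt D x then single (p + q) (loop_br D (lookup v p) (lookup w q)) else 0)"

definition s_hat :: "('g::ab_group_add) gaudin \<Rightarrow> rpoint \<Rightarrow> 'g takiff \<Rightarrow> 'g takiff" where
  "s_hat D x v =
     (\<Sum>p\<in>keys v. single p
        (loop_scale D (rt D powi (if x = Infty then int p else - int p))
          (loop_sig D (lookup v p))))"

definition t_hat :: "('g::ab_group_add) gaudin \<Rightarrow> 'g takiff \<Rightarrow> 'g takiff" where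
  "t_hat D v = Poly_Mapping.map (loop_tau D) v"

fun takiff_act ::
  "('g::ab_group_add) gaudin \<Rightarrow> rpoint \<Rightarrow> nat \<times> bool \<Rightarrow> 'g takiff \<Rightarrow> 'g takiff" where
  "takiff_act D x (k, e) v = (s_hat D x ^^ k) (if e then t_hat D v else v)"

type_synonym 'g gD = "rpoint \<Rightarrow>\<^sub>0 'g takiff"

definition gD :: "('g::ab_group_add) gaudin \<Rightarrow> 'g gD set" where
  "gD D = {v. keys v \<subseteq> pts D \<and>
     (\<forall>x\<in>pts D. lookup v x \<in> takiff D x \<and>
        (\<forall>g\<in>stab D x. takiff_act D x g (lookup v x) = lookup v x))}"

definition gD_scale :: "('g::ab_group_add) gaudin \<Rightarrow> real \<Rightarrow> 'g gD \<Rightarrow> 'g gD" where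
  "gD_scale D r v = Poly_Mapping.map (Poly_Mapping.map (loop_scale D (of_real r))) v"

definition gD_br :: "('g::ab_group_add) gaudin \<Rightarrow> 'g gD \<Rightarrow> 'g gD \<Rightarrow> 'g gD" where
  "gD_br D v w = (\<Sum>x\<in>pts D. single x (takiff_br D x (lookup v x) (lookup w x)))"

text \<open>In the complexification, \<open>(v, w)\<close> stands for \<open>v \<otimes> 1 + w \<otimes> \<i>\<close>.\<close>

type_synonym 'g gDC = "'g gD \<times> 'g gD"

definition gDC :: "('g::ab_group_add) gaudin \<Rightarrow> 'g gDC set" where
  "gDC D = gD D \<times> gD D"

definition gDC_scale :: "('g::ab_group_add) gaudin \<Rightarrow> complex \<Rightarrow> 'g gDC \<Rightarrow> 'g gDC" where
  "gDC_scale D c X =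
     (gD_scale D (Re c) (fst X) - gD_scale D (Im c) (snd X),
      gD_scale D (Re c) (snd X) + gD_scale D (Im c) (fst X))"

definition gDC_br :: "('g::ab_group_add) gaudin \<Rightarrow> 'g gDC \<Rightarrow> 'g gDC \<Rightarrow> 'g gDC" where
  "gDC_br D X Y =
     (gD_br D (fst X) (fst Y) - gD_br D (snd X) (snd Y),
      gD_br D (fst X) (snd Y) + gD_br D (snd X) (fst Y))"

text \<open>\<open>elt D x p X\<close> is \<open>X\<close> with superscript \<open>(x)\<close> and subscript \<open>[p]\<close>. The argument \<open>x\<close> of \<open>elt_cbar\<close>
  is the point of \<open>pts_c D\<close>, so that \<open>elt_cbar D x p X\<close> carries the superscript of the conjugate of \<open>x\<close>.
  The fixed points use \<open>\<chi> = \<tau>\<close> and only those \<open>X\<close> with \<open>\<sigma> X = \<omega>\<^sup>p X\<close> at \<open>0\<close> or \<open>\<sigma> X = \<omega>\<^sup>-\<^sup>p X\<close>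
  at infinity.\<close>

definition gmon :: "rpoint \<Rightarrow> nat \<Rightarrow> ('g::ab_group_add) loop \<Rightarrow> 'g gD" where
  "gmon x p X = single x (single p X)"

definition elt_c :: "('g::ab_group_add) gaudin \<Rightarrow> rpoint \<Rightarrow> nat \<Rightarrow> 'g loop \<Rightarrow> 'g gDC" where
  "elt_c D x p X =
     (gD_scale D (1/2) (gmon x p X), - gD_scale D (1/2) (gmon x p (loop_scale D \<i> X)))"

definition elt_cbar :: "('g::ab_group_add) gaudin \<Rightarrow> rpoint \<Rightarrow> nat \<Rightarrow> 'g loop \<Rightarrow> 'g gDC" where
  "elt_cbar D x p X =
     (gD_scale D (1/2) (gmon x p X), gD_scale D (1/2) (gmon x p (loop_scale D \<i> X)))"

definition elt_chi :: "('g::ab_group_add) gaudin \<Rightarrow> ('g loop \<Rightarrow> 'g loop) \<Rightarrow>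
    rpoint \<Rightarrow> nat \<Rightarrow> 'g loop \<Rightarrow> 'g gDC" where
  "elt_chi D \<chi> x p X =
     (gD_scale D (1/2) (gmon x p (X + \<chi> X)),
      - gD_scale D (1/2) (gmon x p (loop_scale D \<i> (X - \<chi> X))))"

definition chi_r :: "('g::ab_group_add) gaudin \<Rightarrow> nat \<Rightarrow> nat \<Rightarrow> 'g loop \<Rightarrow> 'g loop" where
  "chi_r D k p X =
     loop_scale D (rt D powi (- (int k * int p))) ((loop_sig D ^^ k) (loop_tau D X))"

definition elt :: "('g::ab_group_add) gaudin \<Rightarrow> rpoint \<Rightarrow> nat \<Rightarrow> 'g loop \<Rightarrow> 'g gDC" where
  "elt D x p X =
     (if x \<in> pts_c D then elt_c D x p X
      else if x \<in> pts_cbar D then elt_cbar D (conj_pt x) p X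
      else if x \<in> pts_f D then elt_chi D (loop_tau D) x p X
      else elt_chi D (chi_r D (THE k. k < cyc D \<and> x \<in> pts_rk D k) p) x p X)"

section \<open>The Poisson algebra at fixed levels\<close>

text \<open>
  The symmetric algebra of \<open>V = gDC D\<close> is the ring \<open>P = spolys D\<close> of complex polynomials with one
  indeterminate \<open>svar v\<close> for each \<open>v \<in> V\<close>, modulo the ideal \<open>sym_ideal D\<close> which makes \<open>svar\<close>
  linear. \<open>pbr\<close> is the biderivation of \<open>P\<close> with \<open>{svar v, svar w} = svar [v, w]\<close>; it descends to
  the Poisson bracket of the symmetric algebra. \<open>level_ideal D\<close> is the preimage in \<open>P\<close> of the
  Poisson ideal that fixes the levels, so that \<open>S\<^sub>\<ell> = P / level_ideal D\<close> with elements
  \<open>lev_class D f\<close>, and the bracket of the classes of \<open>f\<close> and \<open>g\<close> is the class of \<open>pbr D f g\<close>.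
\<close>

type_synonym 'g spoly = "('g gDC \<Rightarrow>\<^sub>0 nat) \<Rightarrow>\<^sub>0 complex"

definition spolys :: "('g::ab_group_add) gaudin \<Rightarrow> 'g spoly set" where
  "spolys D = {f. \<forall>m\<in>keys f. keys m \<subseteq> gDC D}"

definition scst :: "complex \<Rightarrow> ('g::ab_group_add) spoly" where
  "scst c = single 0 c"

definition svar :: "('g::ab_group_add) gDC \<Rightarrow> 'g spoly" where
  "svar v = single (single v 1) 1"

definition pdiff :: "('g::ab_group_add) gDC \<Rightarrow> 'g spoly \<Rightarrow> 'g spoly" where
  "pdiff v f = (\<Sum>m\<in>keys f. single (m - single v 1) (of_nat (lookup m v) * lookup f m))"

definition indets :: "('g::ab_group_add) spoly \<Rightarrow> 'g gDC set" where
  "indets f = (\<Union>m\<in>keys f. keys m)"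

definition pbr :: "('g::ab_group_add) gaudin \<Rightarrow> 'g spoly \<Rightarrow> 'g spoly \<Rightarrow> 'g spoly" where
  "pbr D f g =
     (\<Sum>v\<in>indets f. \<Sum>w\<in>indets g. pdiff v f * pdiff w g * svar (gDC_br D v w))"

inductive_set sym_ideal :: "('g::ab_group_add) gaudin \<Rightarrow> 'g spoly set"
  for D :: "'g gaudin" where
  sym_plus: "v \<in> gDC D \<Longrightarrow> w \<in> gDC D \<Longrightarrow> svar (v + w) - svar v - svar w \<in> sym_ideal D"
| sym_scale: "v \<in> gDC D \<Longrightarrow> svar (gDC_scale D c v) - scst c * svar v \<in> sym_ideal D"
| add: "f \<in> sym_ideal D \<Longrightarrow> g \<in> sym_ideal D \<Longrightarrow> f + g \<in> sym_ideal D"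
| mult: "h \<in> spolys D \<Longrightarrow> f \<in> sym_ideal D \<Longrightarrow> h * f \<in> sym_ideal D"

text \<open>For \<open>x\<close> fixed, the element for \<open>X = K\<close> exists only if \<open>T\<close> divides \<open>p\<close>, because \<open>\<sigma> K = K\<close>.\<close>

inductive_set level_ideal :: "('g::ab_group_add) gaudin \<Rightarrow> 'g spoly set"
  for D :: "'g gaudin" where
  sym: "f \<in> sym_ideal D \<Longrightarrow> f \<in> level_ideal D"
| level: "x \<in> pts_c D \<union> pts_r D \<Longrightarrow> p \<in> exps D x \<Longrightarrow>
    svar (elt D x p loopK) - scst (\<i> * lev D x p) \<in> level_ideal D"
| level_fixed: "x \<in> pts_f D \<Longrightarrow> p \<in> exps D x \<Longrightarrow> cyc D dvd p \<Longrightarrow>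
    svar (elt D x p loopK) - scst (\<i> * lev D x p) \<in> level_ideal D"
| level_bar: "y \<in> pts_cbar D \<Longrightarrow> p \<in> exps D y \<Longrightarrow>
    svar (elt D y p loopK) + scst (\<i> * lev D y p) \<in> level_ideal D"
| add: "f \<in> level_ideal D \<Longrightarrow> g \<in> level_ideal D \<Longrightarrow> f + g \<in> level_ideal D"
| mult: "h \<in> spolys D \<Longrightarrow> f \<in> level_ideal D \<Longrightarrow> h * f \<in> level_ideal D"
| bracket: "h \<in> spolys D \<Longrightarrow> f \<in> level_ideal D \<Longrightarrow> pbr D h f \<in> level_ideal D"

definition lev_class :: "('g::ab_group_add) gaudin \<Rightarrow> 'g spoly \<Rightarrow> 'g spoly set" where
  "lev_class D f = {g \<in> spolys D. g - f \<in> level_ideal D}"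

section \<open>Tensors and formal Fourier series\<close>

text \<open>
  \<open>\<gg> \<otimes> P\<close> and \<open>\<gg> \<otimes> \<gg> \<otimes> P\<close> are the free \<open>P\<close>-modules with bases \<open>I\<^sup>a\<close> and \<open>I\<^sup>a \<otimes> I\<^sup>b\<close>. Elements of
  \<open>\<gg> \<otimes> \<gg>\<close> are regarded as elements of \<open>\<gg> \<otimes> \<gg> \<otimes> P\<close> with constant coefficients.
\<close>

type_synonym 'g gP = "'g \<Rightarrow>\<^sub>0 'g spoly"
type_synonym 'g ggP = "'g \<times> 'g \<Rightarrow>\<^sub>0 'g spoly"

definition coord :: "('g::ab_group_add) gaudin \<Rightarrow> 'g \<Rightarrow> 'g \<Rightarrow> complex" where
  "coord D x a = module.representation (sc D) (bas D) x a"

definition tens :: "('g::ab_group_add) gaudin \<Rightarrow> 'g \<Rightarrow> 'g spoly \<Rightarrow> 'g gP" where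
  "tens D x f = (\<Sum>a\<in>bas D. single a (scst (coord D x a) * f))"

definition tens2 :: "('g::ab_group_add) gaudin \<Rightarrow> 'g \<Rightarrow> 'g \<Rightarrow> 'g spoly \<Rightarrow> 'g ggP" where
  "tens2 D x y f =
     (\<Sum>a\<in>bas D. \<Sum>b\<in>bas D. single (a, b) (scst (coord D x a * coord D y b) * f))"

definition smul :: "complex \<Rightarrow> ('i \<Rightarrow>\<^sub>0 ('g::ab_group_add) spoly) \<Rightarrow> ('i \<Rightarrow>\<^sub>0 'g spoly)" where
  "smul c F = Poly_Mapping.map (\<lambda>f. scst c * f) F"

definition flip :: "('g::ab_group_add) ggP \<Rightarrow> 'g ggP" where
  "flip M = Poly_Mapping.map_key prod.swap M"

definition sig_tens :: "('g::ab_group_add) gaudin \<Rightarrow> 'g gP \<Rightarrow> 'g gP" where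
  "sig_tens D F = (\<Sum>a\<in>keys F. tens D (sig D a) (lookup F a))"

text \<open>The commutators of \<open>M\<^sub>1\<^sub>2\<close> with \<open>F\<^sub>1\<close> and with \<open>F\<^sub>2\<close>.\<close>

definition comm_fst :: "('g::ab_group_add) gaudin \<Rightarrow> 'g ggP \<Rightarrow> 'g gP \<Rightarrow> 'g ggP" where
  "comm_fst D M F =
     (\<Sum>(a, b)\<in>keys M. \<Sum>c\<in>keys F. tens2 D (br D a c) b (lookup M (a, b) * lookup F c))"

definition comm_snd :: "('g::ab_group_add) gaudin \<Rightarrow> 'g ggP \<Rightarrow> 'g gP \<Rightarrow> 'g ggP" where
  "comm_snd D M F =
     (\<Sum>(a, b)\<in>keys M. \<Sum>c\<in>keys F. tens2 D a (br D b c) (lookup M (a, b) * lookup F c))"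

text \<open>
  A formal Fourier series in \<open>\<theta>\<close> is the function that maps \<open>m\<close> to the coefficient of \<open>e\<^sub>m(\<theta>)\<close>; a
  series in \<open>\<theta>\<close> and \<open>\<theta>'\<close> maps \<open>m\<close> and \<open>n\<close> to the coefficient of \<open>e\<^sub>m(\<theta>) e\<^sub>n(\<theta>')\<close>.
\<close>

definition pb_series :: "('g::ab_group_add) gaudin \<Rightarrow>
    (int \<Rightarrow> 'g gP) \<Rightarrow> (int \<Rightarrow> 'g gP) \<Rightarrow> int \<Rightarrow> int \<Rightarrow> 'g ggP" where
  "pb_series D A B m n =
     (\<Sum>a\<in>keys (A m). \<Sum>b\<in>keys (B n).
        single (a, b) (pbr D (lookup (A m) a) (lookup (B n) b)))"

definition delta :: "int \<Rightarrow> int \<Rightarrow> complex" where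
  "delta m n = of_bool (n = - m)"

definition delta' :: "int \<Rightarrow> int \<Rightarrow> complex" where
  "delta' m n = \<i> * of_int m * of_bool (n = - m)"

text \<open>The products \<open>F(\<theta>) G(\<theta>, \<theta>')\<close> and \<open>F(\<theta>') G(\<theta>, \<theta>')\<close>, for \<open>G\<close> such as \<open>delta\<close> for which each
  coefficient is a finite sum.\<close>

definition mul_theta :: "(int \<Rightarrow> ('g::ab_group_add) ggP) \<Rightarrow> (int \<Rightarrow> int \<Rightarrow> complex) \<Rightarrow>
    int \<Rightarrow> int \<Rightarrow> 'g ggP" where
  "mul_theta F G m n = (\<Sum>i\<in>{i. G (m - i) n \<noteq> 0}. smul (G (m - i) n) (F i))"

definition mul_theta' :: "(int \<Rightarrow> ('g::ab_group_add) ggP) \<Rightarrow> (int \<Rightarrow> int \<Rightarrow> complex) \<Rightarrow>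
    int \<Rightarrow> int \<Rightarrow> 'g ggP" where
  "mul_theta' F G m n = (\<Sum>i\<in>{i. G m (n - i) \<noteq> 0}. smul (G m (n - i)) (F i))"

text \<open>The quotient map from \<open>P\<close> to \<open>S\<^sub>\<ell>\<close> is applied to each coefficient in \<open>\<gg> \<otimes> \<gg> \<otimes> P\<close>.\<close>

definition to_levels :: "('g::ab_group_add) gaudin \<Rightarrow> (int \<Rightarrow> int \<Rightarrow> 'g ggP) \<Rightarrow>
    int \<Rightarrow> int \<Rightarrow> 'g \<times> 'g \<Rightarrow> 'g spoly set" where
  "to_levels D F m n ab = lev_class D (lookup (F m n) ab)"

section \<open>Classical fields, twist function, Lax matrix and R-matrix\<close>

text \<open>The coefficient of \<open>e\<^sub>m\<close> in a field comes from the summand \<open>n = - m\<close>, but from \<open>n = m\<close> at the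
  conjugate points.\<close>

definition field_pt :: "('g::ab_group_add) gaudin \<Rightarrow> rpoint \<Rightarrow> nat \<Rightarrow> int \<Rightarrow> 'g gP" where
  "field_pt D x p m =
     (if x \<in> pts_c D \<union> pts_r D
      then (\<Sum>a\<in>bas D. tens D (dual D a) (svar (elt D x p (lmode a (- m)))))
      else (\<Sum>a\<in>bas D. tens D (dual D a) (svar (elt D x p (lmode a m)))))"

definition field_zero :: "('g::ab_group_add) gaudin \<Rightarrow> nat \<Rightarrow> int \<Rightarrow> 'g gP" where
  "field_zero D p m =
     (\<Sum>a\<in>gbas D (int p).
        tens D (gdual D (int p) a) (svar (elt D (Fin 0) p (lmode a (- m)))))"

definition field_infty :: "('g::ab_group_add) gaudin \<Rightarrow> nat \<Rightarrow> int \<Rightarrow> 'g gP" where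
  "field_infty D p m =
     (\<Sum>a\<in>gbas D (- int p).
        tens D (gdual D (- int p) a) (svar (elt D Infty p (lmode a (- m)))))"

definition twist :: "('g::ab_group_add) gaudin \<Rightarrow> complex \<Rightarrow> complex" where
  "twist D z =
     1 / of_nat (cyc D) *
       (\<Sum>k<cyc D. \<Sum>x\<in>pts_Z D. \<Sum>p<mlt D x.
          rt D powi (- int k) * lev D x p / (rt D powi (- int k) * z - cval x) ^ (p + 1))
     + (if Fin 0 \<in> pts D then \<Sum>p<mlt D (Fin 0). lev D (Fin 0) p / z ^ (p + 1) else 0)
     - (\<Sum>q<mlt D Infty - 1. lev D Infty (q + 1) * z ^ q)"

definition twist_lax :: "('g::ab_group_add) gaudin \<Rightarrow> complex \<Rightarrow> int \<Rightarrow> 'g gP" where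
  "twist_lax D z m =
     smul (1 / of_nat (cyc D))
       (\<Sum>k<cyc D. \<Sum>x\<in>pts_Z D. \<Sum>p<mlt D x.
          smul (rt D powi (- int k) / (rt D powi (- int k) * z - cval x) ^ (p + 1))
            ((sig_tens D ^^ k) (field_pt D x p m)))
     + (if Fin 0 \<in> pts D
        then \<Sum>p<mlt D (Fin 0). smul (1 / z ^ (p + 1)) (field_zero D p m) else 0)
     - (\<Sum>q<mlt D Infty - 1. smul (z ^ q) (field_infty D (q + 1) m))"

definition lax :: "('g::ab_group_add) gaudin \<Rightarrow> complex \<Rightarrow> int \<Rightarrow> 'g gP" where
  "lax D z m = smul (inverse (twist D z)) (twist_lax D z m)"

text \<open>The points that are zeros of none of the denominators in \<open>twist\<close>, \<open>twist_lax\<close> and \<open>lax\<close>; identities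
  between rational functions of the spectral parameters are stated at such points.\<close>

definition regular :: "('g::ab_group_add) gaudin \<Rightarrow> complex \<Rightarrow> bool" where
  "regular D z \<longleftrightarrow>
     (\<forall>k<cyc D. \<forall>x\<in>pts_Z D. rt D powi (- int k) * z \<noteq> cval x) \<and>
     (Fin 0 \<in> pts D \<longrightarrow> z \<noteq> 0) \<and> twist D z \<noteq> 0"

definition casimir :: "('g::ab_group_add) gaudin \<Rightarrow> int \<Rightarrow> 'g ggP" where
  "casimir D j = (\<Sum>a\<in>gbas D j. tens2 D (gdual D j a) a 1)"

definition rmat0 :: "('g::ab_group_add) gaudin \<Rightarrow> complex \<Rightarrow> complex \<Rightarrow> 'g ggP" where
  "rmat0 D z z' =
     smul (1 / (z' ^ cyc D - z ^ cyc D))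
       (\<Sum>k<cyc D. smul (z ^ k * z' ^ (cyc D - 1 - k)) (casimir D (- int k)))"

definition rmat :: "('g::ab_group_add) gaudin \<Rightarrow> complex \<Rightarrow> complex \<Rightarrow> 'g ggP" where
  "rmat D z z' = smul (inverse (twist D z')) (rmat0 D z z')"

end

theory Submission
  imports Defs "HOL-Computational_Algebra.Formal_Power_Series"
begin

text \<open>
  Pair both sides with \<open>X \<otimes> Y\<close>, where \<open>X\<close> and \<open>Y\<close> are eigenvectors of \<open>\<sigma>\<close> with eigenvalues \<open>\<omega>\<^sup>i\<close> and
  \<open>\<omega>\<^sup>j\<close>. The pairing of \<open>X\<close> with \<open>\<phi>(z) L(z)\<close> is \<open>\<Sum> h\<^sub>x\<^sub>,\<^sub>p\<^sub>,\<^sub>i(z) E\<^sub>x\<^sub>,\<^sub>p(X)\<close> over all points \<open>x\<close>, where the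
  linear maps \<open>E\<^sub>x\<^sub>,\<^sub>p\<close> satisfy \<open>[E\<^sub>x\<^sub>,\<^sub>p(X), E\<^sub>y\<^sub>,\<^sub>q(Y)] = \<delta>\<^sub>x\<^sub>y E\<^sub>x\<^sub>,\<^sub>p\<^sub>+\<^sub>q([X, Y])\<close> and send \<open>K\<close> to
  \<open>\<i> \<ell>\<^sup>x\<^sub>p\<close>. The \<open>h\<^sub>x\<^sub>,\<^sub>p\<^sub>,\<^sub>i(z)\<close> are the Taylor coefficients at \<open>w = x\<close> of
  \<open>w\<^sup>i z\<^sup>T\<^sup>-\<^sup>1\<^sup>-\<^sup>i / (z\<^sup>T - w\<^sup>T)\<close>. Both the \<open>\<delta>\<close> part and the \<open>\<delta>'\<close> part of the theorem then follow from
  one partial fraction identity for the products of these kernels, read off coefficientwise.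
\<close>



text \<open>Pairing with eigenvectors loses nothing: coordinates in \<open>bas\<close> are pairings
  with dual basis vectors, and averaging over the powers of \<sigma> splits these into eigenvectors.
  The obstacle is uniformity. At a fixed point a generator exists only for X of one degree, and one
  for K only at orders divisible by T. But there the coefficient h vanishes whenever the degree of X
  is wrong, and a nonzero value of the form on X and Y forces T to divide p + q; so one sum over all
  points and orders makes sense. A second obstacle is that \<open>svar\<close> is linear only modulo
  the level ideal, and only on invariant elements. Each bracket is therefore expanded exactly, as an
  identity of polynomials, and congruences serve only to recollect the outcome. The truncation p + q
  < n_x of the Takiff algebras does no harm, since it keeps complete Cauchy coefficients of order r
  = p + q. Finally, \<phi>(z) is the sum of the h in degree 0 times the levels, which is why the
  level terms obey the same identity as the fields.\<close>

text \<open>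
  \<open>H\<close> and \<open>G\<close> are the kernels \<open>w\<^sup>i z\<^sup>T\<^sup>-\<^sup>1\<^sup>-\<^sup>i / (z\<^sup>T - w\<^sup>T)\<close> in the homogeneous coordinate \<open>w = b / c\<close>, so
  that expansions at finite points (\<open>c = 1\<close>) and at infinity (\<open>b = 1\<close>) are treated alike.
\<close>

lemma kernel_identity:
  fixes b c Z1 Z2 H1 H2 G1 G2 R1 R2 :: "'a::idom"
  assumes "i < T" "j < T"
    and H1: "(Z1 ^ T * c ^ T - b ^ T) * H1 = b ^ i * c ^ (T - i) * Z1 ^ (T - 1 - i)"
    and H2: "(Z2 ^ T * c ^ T - b ^ T) * H2 = b ^ j * c ^ (T - j) * Z2 ^ (T - 1 - j)"
    and l: "l = (i + j) mod T"
    and G1: "(Z1 ^ T * c ^ T - b ^ T) * G1 = b ^ l * c ^ (T - l) * Z1 ^ (T - 1 - l)"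
    and G2: "(Z2 ^ T * c ^ T - b ^ T) * G2 = b ^ l * c ^ (T - l) * Z2 ^ (T - 1 - l)"
    and R1: "(Z2 ^ T - Z1 ^ T) * R1 = Z1 ^ j * Z2 ^ (T - 1 - j)"
    and R2: "(Z1 ^ T - Z2 ^ T) * R2 = Z2 ^ i * Z1 ^ (T - 1 - i)"
    and nz: "Z1 ^ T * c ^ T - b ^ T \<noteq> 0" "Z2 ^ T * c ^ T - b ^ T \<noteq> 0" "Z2 ^ T \<noteq> Z1 ^ T"
  shows "H1 * H2 = R1 * G1 + R2 * G2"
proof -
  define A where "A = Z1 ^ T * c ^ T - b ^ T"
  define B where "B = Z2 ^ T * c ^ T - b ^ T"
  define E where "E = Z2 ^ T - Z1 ^ T"
  have h: "A * H1 = b ^ i * c ^ (T - i) * Z1 ^ (T - 1 - i)" "B * H2 = b ^ j * c ^ (T - j) * Z2 ^ (T - 1 - j)"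
    "A * G1 = b ^ l * c ^ (T - l) * Z1 ^ (T - 1 - l)" "B * G2 = b ^ l * c ^ (T - l) * Z2 ^ (T - 1 - l)"
    "E * R1 = Z1 ^ j * Z2 ^ (T - 1 - j)"
    using H1 H2 G1 G2 R1 by (simp_all only: A_def B_def E_def)
  have "- E * R2 = Z2 ^ i * Z1 ^ (T - 1 - i)"
    unfolding R2[symmetric] by (simp add: E_def)
  note h = h this
  have "A * B * E * (H1 * H2) = E * (A * H1) * (B * H2)" by (simp add: algebra_simps)
  also have "\<dots> = E * (b ^ (i + j) * c ^ (T - i + (T - j))) * (Z1 ^ (T - 1 - i) * Z2 ^ (T - 1 - j))"
    unfolding h power_add by (simp only: mult_ac)
  also have "\<dots> = B * (Z1 ^ j * Z2 ^ (T - 1 - j)) * (b ^ l * c ^ (T - l) * Z1 ^ (T - 1 - l))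
      - A * (Z2 ^ i * Z1 ^ (T - 1 - i)) * (b ^ l * c ^ (T - l) * Z2 ^ (T - 1 - l))"
  \<comment> \<open>Whether the reduction of i + j modulo T carries decides which cancellation
    occurs. Without a carry the powers of Z1 and Z2 match and B - A = E * c^T is left; a carry
    supplies an extra factor Z1^T or Z2^T, and B * Z1^T - A * Z2^T = E * b^T is left.\<close>
  proof (cases "i + j < T")
    case True
    have e: "j + (T - 1 - l) = T - 1 - i" "i + (T - 1 - l) = T - 1 - j"
        "T - i + (T - j) = T + (T - l)" "l = i + j"
      using True l assms(1,2) by auto
    have "B * (Z1 ^ j * Z2 ^ (T - 1 - j)) * (b ^ l * c ^ (T - l) * Z1 ^ (T - 1 - l))
      - A * (Z2 ^ i * Z1 ^ (T - 1 - i)) * (b ^ l * c ^ (T - l) * Z2 ^ (T - 1 - l))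
      = B * (Z1 ^ (j + (T - 1 - l)) * Z2 ^ (T - 1 - j)) * (b ^ l * c ^ (T - l))
      - A * (Z2 ^ (i + (T - 1 - l)) * Z1 ^ (T - 1 - i)) * (b ^ l * c ^ (T - l))"
      unfolding power_add by (simp add: algebra_simps)
    also have "\<dots> = (B - A) * (b ^ l * c ^ (T - l)) * (Z1 ^ (T - 1 - i) * Z2 ^ (T - 1 - j))"
      unfolding e(1,2) by (simp add: algebra_simps)
    also have "B - A = E * c ^ T" unfolding A_def B_def E_def by (simp add: algebra_simps)
    also have "E * c ^ T * (b ^ l * c ^ (T - l)) = E * (b ^ (i + j) * c ^ (T - i + (T - j)))"
      unfolding e(3) power_add[of c T] e(4)[symmetric] by (simp add: algebra_simps)
    finally show ?thesis by simp
  next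
    case False
    have e: "j + (T - 1 - l) = T + (T - 1 - i)" "i + (T - 1 - l) = T + (T - 1 - j)"
        "T - i + (T - j) = T - l" "i + j = T + l"
      using False l assms(1,2) by (auto simp: mod_if)
    have "B * (Z1 ^ j * Z2 ^ (T - 1 - j)) * (b ^ l * c ^ (T - l) * Z1 ^ (T - 1 - l))
      - A * (Z2 ^ i * Z1 ^ (T - 1 - i)) * (b ^ l * c ^ (T - l) * Z2 ^ (T - 1 - l))
      = B * (Z1 ^ (j + (T - 1 - l)) * Z2 ^ (T - 1 - j)) * (b ^ l * c ^ (T - l))
      - A * (Z2 ^ (i + (T - 1 - l)) * Z1 ^ (T - 1 - i)) * (b ^ l * c ^ (T - l))"
      unfolding power_add by (simp add: algebra_simps)
    also have "\<dots> = (B * Z1 ^ T - A * Z2 ^ T) * (b ^ l * c ^ (T - l)) * (Z1 ^ (T - 1 - i) * Z2 ^ (T - 1 - j))"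
      unfolding e(1,2) power_add by (simp add: algebra_simps)
    also have "B * Z1 ^ T - A * Z2 ^ T = E * b ^ T" unfolding A_def B_def E_def by (simp add: algebra_simps)
    also have "E * b ^ T * (b ^ l * c ^ (T - l)) = E * (b ^ (i + j) * c ^ (T - i + (T - j)))"
      unfolding e(3,4) power_add by (simp add: algebra_simps)
    finally show ?thesis by simp
  qed
  also have "\<dots> = B * (E * R1) * (A * G1) - A * (- E * R2) * (B * G2)"
    unfolding h ..
  also have "\<dots> = A * B * E * (R1 * G1 + R2 * G2)" by (simp add: algebra_simps)
  finally have "A * B * E * (H1 * H2) = A * B * E * (R1 * G1 + R2 * G2)" .
  moreover have "A * B * E \<noteq> 0" using nz unfolding A_def B_def E_def by simp
  ultimately show ?thesis using mult_left_cancel by blast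
qed

section \<open>Powers of a primitive root of unity\<close>

lemma primitive_root_eq_1_iff:
  fixes w :: complex
  assumes T: "T \<ge> 1" and wT: "w ^ T = 1" and prim: "\<And>k. 0 < k \<Longrightarrow> k < T \<Longrightarrow> w ^ k \<noteq> 1"
  shows "w powi i = 1 \<longleftrightarrow> int T dvd i"
proof -
  have w0: "w \<noteq> 0" using wT T by (auto simp: power_0_left)
  have "w powi i = w powi (int T * (i div int T) + i mod int T)" by simp
  also have "\<dots> = (w powi int T) powi (i div int T) * w powi (i mod int T)"
    unfolding power_int_mult[symmetric] using w0 by (subst power_int_add) auto
  also have "w powi int T = 1" using wT by simp
  finally have *: "w powi i = w powi (i mod int T)" by simp
  define k where "k = nat (i mod int T)"
  have k: "i mod int T = int k" "k < T" using T by (auto simp: k_def nat_less_iff)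
  have "w powi i = w ^ k" using * k by simp
  moreover have "int T dvd i \<longleftrightarrow> k = 0" using k by (auto simp: dvd_eq_mod_eq_0)
  ultimately show ?thesis using prim[of k] k by (cases "k = 0") auto
qed

text \<open>Orthogonality of characters: a geometric sum whose ratio \<open>w powi i\<close> is
  either 1 or a nontrivial T-th root of unity.\<close>

lemma primitive_root_sum:
  fixes w :: complex
  assumes T: "T \<ge> 1" and wT: "w ^ T = 1" and prim: "\<And>k. 0 < k \<Longrightarrow> k < T \<Longrightarrow> w ^ k \<noteq> 1"
  shows "(\<Sum>k<T. w powi (int k * i)) = (if int T dvd i then of_nat T else 0)"
proof -
  have e: "(\<Sum>k<T. w powi (int k * i)) = (\<Sum>k<T. (w powi i) ^ k)"
    by (rule sum.cong) (auto simp: power_int_mult mult.commute simp flip: power_int_of_nat)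
  have w1: "(w powi i) ^ T = 1"
    by (metis mult.commute power_int_1_left power_int_mult power_int_of_nat wT)
  show ?thesis
  proof (cases "int T dvd i")
    case True
    then have "w powi i = 1" using primitive_root_eq_1_iff[OF assms] by auto
    then show ?thesis using True e by simp
  next
    case False
    then have "w powi i \<noteq> 1" using primitive_root_eq_1_iff[OF assms] by auto
    then show ?thesis using False e w1 by (simp add: geometric_sum)
  qed
qed

text \<open>
  The coefficient of the generator at the point \<open>x\<close> and order \<open>p\<close> in the component of degree \<open>i\<close> of
  \<open>\<phi>(z) L(z)\<close>; the order \<open>p = 0\<close> does not occur at infinity.
\<close>

definition mode :: "nat \<Rightarrow> complex \<Rightarrow> rpoint \<Rightarrow> nat \<Rightarrow> int \<Rightarrow> complex \<Rightarrow> complex" where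
  "mode T w x p i z =
     (if x = Infty then if 0 < p \<and> int T dvd i + int p then - (z ^ (p - 1)) else 0
      else 1 / of_nat T * (\<Sum>k<T. w powi (- int k * (i + 1)) / (w powi (- int k) * z - cval x) ^ (p + 1)))"

text \<open>The value of the standard R-matrix on \<open>X \<otimes> Y\<close> is \<open>rcoef T j z z'\<close> times \<open>\<langle>X, Y\<rangle>\<close> if \<open>\<sigma> Y = \<omega>\<^sup>j Y\<close>.\<close>

definition rcoef :: "nat \<Rightarrow> int \<Rightarrow> complex \<Rightarrow> complex \<Rightarrow> complex" where
  "rcoef T j z z' = (let k = nat (j mod int T) in z ^ k * z' ^ (T - 1 - k) / (z' ^ T - z ^ T))"

section \<open>Generating series of the mode coefficients\<close>

context
  fixes T :: nat and w :: complex
  assumes T: "T \<ge> 1" and wT: "w ^ T = 1" and prim: "\<And>k. 0 < k \<Longrightarrow> k < T \<Longrightarrow> w ^ k \<noteq> 1"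
begin

lemma w0: "w \<noteq> 0" using wT T by (auto simp: power_0_left)

lemma powi_T: "(w powi (- int k)) ^ T = 1"
  by (metis mult.commute power_int_1_left power_int_mult power_int_of_nat wT)

text \<open>The k-th summand of \<open>mode\<close> is a weighted coefficient of the series 1 / (c k
  - b), where \<open>c k\<close> is the rotated point z. All \<open>c k\<close> have the same T-th
  power, so the factor z^T - b^T cancels each of these denominators and leaves a homogeneous
  polynomial in \<open>c k\<close> and b; the average over k keeps only its power b^i0.\<close>

lemma mode_fps:
  fixes a z :: complex and i :: int
  assumes ne: "\<And>k. k < T \<Longrightarrow> w powi (- int k) * z \<noteq> a"
  defines "H \<equiv> Abs_fps (\<lambda>p. mode T w (Fin a) p i z)"
  defines "b \<equiv> fps_const a + fps_X"
  defines "i0 \<equiv> nat (i mod int T)"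
  shows "(fps_const z ^ T - b ^ T) * H = b ^ i0 * fps_const z ^ (T - 1 - i0)"
proof -
  define c where "c k = w powi (- int k) * z" for k
  define g where "g k = Abs_fps (\<lambda>p. 1 / (c k - a) ^ (p + 1))" for k
  have i0: "i0 < T" using T by (auto simp: i0_def nat_less_iff)
  have g: "(fps_const (c k) - b) * g k = 1" if "k < T" for k
  proof -
    define d where "d = c k - a"
    have ck: "d \<noteq> 0" unfolding d_def using ne[OF that] by (simp add: c_def)
    have "fps_const (c k) - b = fps_const (c k - a) - fps_X"
      unfolding b_def by (simp add: fps_eq_iff)
    moreover have "(fps_const (c k - a) - fps_X) * g k = 1"
    proof (rule fps_ext)
      fix n show "fps_nth ((fps_const (c k - a) - fps_X) * g k) n = fps_nth 1 n"
        using ck by (cases n) (auto simp: left_diff_distrib g_def d_def[symmetric] field_simps)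
    qed
    ultimately show ?thesis by simp
  qed
  have Hs: "H = fps_const (1 / of_nat T) * (\<Sum>k<T. fps_const (w powi (- int k * (i + 1))) * g k)"
    by (rule fps_ext) (simp add: H_def mode_def g_def c_def fps_sum_nth)
  have pw: "w powi (- int k * int m) = (w powi (- int k)) ^ m" for k m
    by (simp only: power_int_mult power_int_of_nat)
  have zt: "fps_const z ^ T - b ^ T = (fps_const (c k) - b) * (\<Sum>n<T. fps_const (c k) ^ (T - 1 - n) * b ^ n)" for k
  proof -
    have e: "fps_const z ^ T = fps_const (c k) ^ T"
      by (simp add: fps_const_power c_def power_mult_distrib powi_T)
    have "b ^ T - fps_const (c k) ^ T = (b - fps_const (c k)) * (\<Sum>n<T. fps_const (c k) ^ (T - Suc n) * b ^ n)"
      by (rule power_diff_sumr2)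
    then have "fps_const (c k) ^ T - b ^ T = (fps_const (c k) - b) * (\<Sum>n<T. fps_const (c k) ^ (T - Suc n) * b ^ n)"
      by (simp only: minus_diff_eq[of "fps_const (c k)" b, symmetric] minus_diff_eq[of "fps_const (c k) ^ T" "b ^ T", symmetric] minus_mult_left[symmetric] neg_equal_iff_equal)
    then show ?thesis unfolding e by simp
  qed
  have "(fps_const z ^ T - b ^ T) * H = fps_const (1 / of_nat T) *
      (\<Sum>k<T. fps_const (w powi (- int k * (i + 1))) * ((fps_const z ^ T - b ^ T) * g k))"
    unfolding Hs by (simp only: sum_distrib_left mult_ac)
  also have "\<dots> = fps_const (1 / of_nat T) *
      (\<Sum>k<T. fps_const (w powi (- int k * (i + 1))) * (\<Sum>n<T. fps_const (c k) ^ (T - 1 - n) * b ^ n))"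
  proof -
    have "(fps_const z ^ T - b ^ T) * g k = (\<Sum>n<T. fps_const (c k) ^ (T - 1 - n) * b ^ n)" if "k < T" for k
    proof -
      have "(fps_const z ^ T - b ^ T) * g k = ((fps_const (c k) - b) * g k) * (\<Sum>n<T. fps_const (c k) ^ (T - 1 - n) * b ^ n)"
        unfolding zt[of k] by (simp only: mult_ac)
      then show ?thesis by (simp only: g[OF that] mult_1_left)
    qed
    then show ?thesis by simp
  qed
  also have "\<dots> = fps_const (1 / of_nat T) *
      (\<Sum>n<T. b ^ n * fps_const z ^ (T - 1 - n) * fps_const (\<Sum>k<T. w powi (int k * (int n - i))))"
  proof -
    \<comment> \<open>The exponents -k (i + 1) and -k (T - 1 - n) add up to k (n - i) - k T, and the
      multiple of T drops out.\<close>
    have e: "w powi (- int k * (i + 1)) * c k ^ (T - 1 - n) = z ^ (T - 1 - n) * w powi (int k * (int n - i))"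
      if "n < T" for k n
    proof -
      have "w powi (- int k * (i + 1)) * c k ^ (T - 1 - n)
        = w powi (- int k * (i + 1)) * w powi (- int k * int (T - 1 - n)) * z ^ (T - 1 - n)"
        by (simp only: c_def power_mult_distrib pw mult_ac)
      also have "w powi (- int k * (i + 1)) * w powi (- int k * int (T - 1 - n))
        = w powi (int k * (int n - i) + (- int k) * int T)"
        using w0 that by (subst power_int_add[symmetric]) (auto simp: algebra_simps of_nat_diff)
      also have "\<dots> = w powi (int k * (int n - i)) * (w powi (- int k)) ^ T"
        using w0 by (simp add: power_int_add pw del: mult_minus_left)
      also have "\<dots> = w powi (int k * (int n - i))" using powi_T by simp
      finally show ?thesis by simp
    qed
    have *: "fps_const (w powi (- int k * (i + 1))) * (fps_const (c k) ^ (T - 1 - n) * b ^ n)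
       = b ^ n * fps_const z ^ (T - 1 - n) * fps_const (w powi (int k * (int n - i)))" if "n < T" for k n
    proof -
      have "fps_const (w powi (- int k * (i + 1))) * (fps_const (c k) ^ (T - 1 - n) * b ^ n)
        = fps_const (w powi (- int k * (i + 1)) * c k ^ (T - 1 - n)) * b ^ n"
        by (simp only: fps_const_mult[symmetric] fps_const_power[symmetric] mult_ac)
      also have "\<dots> = b ^ n * fps_const z ^ (T - 1 - n) * fps_const (w powi (int k * (int n - i)))"
        unfolding e[OF that] by (simp only: fps_const_mult[symmetric] fps_const_power[symmetric] mult_ac)
      finally show ?thesis .
    qed
    have "fps_const (\<Sum>k<T. f k) = (\<Sum>k<T. fps_const (f k))" for f :: "nat \<Rightarrow> complex"
      by (induction T) (auto simp flip: fps_const_add)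
    note fc = this
    have "(\<Sum>k<T. fps_const (w powi (- int k * (i + 1))) * (\<Sum>n<T. fps_const (c k) ^ (T - 1 - n) * b ^ n))
      = (\<Sum>k<T. \<Sum>n<T. b ^ n * fps_const z ^ (T - 1 - n) * fps_const (w powi (int k * (int n - i))))"
      by (simp only: sum_distrib_left) (intro sum.cong refl *, simp)
    also have "\<dots> = (\<Sum>n<T. \<Sum>k<T. b ^ n * fps_const z ^ (T - 1 - n) * fps_const (w powi (int k * (int n - i))))"
      by (rule sum.swap)
    also have "\<dots> = (\<Sum>n<T. b ^ n * fps_const z ^ (T - 1 - n) * fps_const (\<Sum>k<T. w powi (int k * (int n - i))))"
      by (simp only: fc sum_distrib_left)
    finally show ?thesis by (simp only:)
  qed
  also have "\<dots> = fps_const (1 / of_nat T) *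
      (\<Sum>n<T. if n = i0 then b ^ n * fps_const z ^ (T - 1 - n) * fps_const (of_nat T) else 0)"
  proof -
    have "int T dvd int n - i \<longleftrightarrow> n = i0" if "n < T" for n
    proof -
      have "int T dvd int n - i \<longleftrightarrow> int n mod int T = i mod int T"
        using mod_eq_dvd_iff by metis
      also have "\<dots> \<longleftrightarrow> int n = i mod int T" using that by simp
      also have "\<dots> \<longleftrightarrow> n = i0" using T by (auto simp: i0_def)
      finally show ?thesis .
    qed
    then show ?thesis
      by (intro arg_cong2[where f="(*)"] sum.cong refl) (auto simp: primitive_root_sum[OF T wT prim])
  qed
  also have "\<dots> = b ^ i0 * fps_const z ^ (T - 1 - i0)"
    using i0 T by (simp add: mult.left_commute)
  finally show ?thesis .
qed

text \<open>In the coordinate X at infinity the kernel is X^(T - i0) z^(T - 1 - i0) / (z^T X^T - 1).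
  Multiplication by the denominator telescopes along the orders congruent to -i modulo T, and only
  the first of them, T - i0, survives.\<close>

lemma mode_Infty_fps:
  fixes z :: complex and i :: int
  defines "H \<equiv> Abs_fps (\<lambda>p. mode T w Infty p i z)"
  defines "i0 \<equiv> nat (i mod int T)"
  shows "(fps_const z ^ T * fps_X ^ T - 1) * H = fps_X ^ (T - i0) * fps_const z ^ (T - 1 - i0)"
proof (rule fps_ext)
  fix n
  have i0: "i0 < T" "int i0 = i mod int T" using T by (auto simp: i0_def nat_less_iff)
  have d: "int T dvd i + int m \<longleftrightarrow> T dvd i0 + m" for m
  proof -
    have "int T dvd i + int m \<longleftrightarrow> int T dvd i mod int T + int m"
      by (metis dvd_eq_mod_eq_0 mod_add_left_eq)
    then show ?thesis by (metis i0(2) int_dvd_int_iff of_nat_add)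
  qed
  have mode: "mode T w Infty p i z = (if 0 < p \<and> T dvd i0 + p then - (z ^ (p - 1)) else 0)" for p
    using d by (simp add: mode_def)
  have "fps_nth ((fps_const z ^ T * fps_X ^ T - 1) * H) n
     = (if n < T then 0 else z ^ T * fps_nth H (n - T)) - fps_nth H n"
    by (simp add: left_diff_distrib mult.assoc fps_X_power_mult_nth fps_const_power)
  also have "\<dots> = (if n = T - i0 then z ^ (T - 1 - i0) else 0)"
  proof (cases "n < T")
    case True
    have "T dvd i0 + n \<longleftrightarrow> i0 + n = 0 \<or> i0 + n = T"
    proof
      assume "T dvd i0 + n"
      then obtain q where q: "i0 + n = T * q" by (auto simp: dvd_def)
      have "T * q < T * 2" using q True i0(1) by linarith
      then have "q = 0 \<or> q = 1" using T by auto
      then show "i0 + n = 0 \<or> i0 + n = T" using q by auto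
    next
      assume "i0 + n = 0 \<or> i0 + n = T"
      then show "T dvd i0 + n" by (metis dvd_0_right dvd_refl)
    qed
    then show ?thesis using True i0 by (auto simp: H_def mode)
  next
    case False
    show ?thesis
    \<comment> \<open>At n = T the shifted coefficient has order 0, which \<open>mode\<close> sets
      to 0. For i0 = 0 the orders therefore start at T, in agreement with T - i0.\<close>
    proof (cases "n = T")
      case True
      have "T dvd i0 \<longleftrightarrow> i0 = 0" using i0(1) by (auto dest: dvd_imp_le)
      then show ?thesis using True T i0(1) by (auto simp: H_def mode dvd_add_left_iff)
    next
      case F: False
      with False have n: "n > T" by auto
      then have "T dvd i0 + (n - T) \<longleftrightarrow> T dvd i0 + n"
        by (metis Nat.add_diff_assoc dvd_minus_self le_add2 le_trans less_imp_le not_less)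
      moreover have "z ^ T * z ^ (n - T - 1) = z ^ (n - 1)" using n by (simp flip: power_add)
      ultimately show ?thesis using n by (auto simp: H_def mode)
    qed
  qed
  also have "\<dots> = fps_nth (fps_X ^ (T - i0) * fps_const z ^ (T - 1 - i0)) n"
    by (simp add: fps_const_power fps_X_power_nth)
  finally show "fps_nth ((fps_const z ^ T * fps_X ^ T - 1) * H) n
    = fps_nth (fps_X ^ (T - i0) * fps_const z ^ (T - 1 - i0)) n" .
qed


text \<open>The left side is a coefficient of a product of two generating series, so
  \<open>kernel_identity\<close> is applied in the ring of formal power series, with z, z' and the
  values of \<open>rcoef\<close> as constant series.\<close>

lemma mode_product:
  fixes z z' :: complex
  assumes ne: "\<And>a k. x = Fin a \<Longrightarrow> k < T \<Longrightarrow> w powi (- int k) * z \<noteq> a"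
    "\<And>a k. x = Fin a \<Longrightarrow> k < T \<Longrightarrow> w powi (- int k) * z' \<noteq> a"
    and zz: "z ^ T \<noteq> z' ^ T"
  shows "(\<Sum>p\<le>r. mode T w x p i z * mode T w x (r - p) j z') =
    rcoef T j z z' * mode T w x r (i + j) z + rcoef T i z' z * mode T w x r (i + j) z'"
proof -
  define H where "H i z = Abs_fps (\<lambda>p. mode T w x p i z)" for i z
  define red where "red i = nat (i mod int T)" for i
  have red: "red i < T" for i using T by (auto simp: red_def nat_less_iff)
  have red_add: "red (i + j) = (red i + red j) mod T"
    using T by (simp add: red_def nat_add_distrib[symmetric] nat_mod_as_int mod_add_eq)
  \<comment> \<open>The homogeneous coordinate around x: b = a + X and c = 1 at a finite point a,
    but b = 1 and c = X at infinity.\<close>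
  obtain b c :: "complex fps" where
    bc: "\<And>i. (fps_const z ^ T * c ^ T - b ^ T) * H i z = b ^ red i * c ^ (T - red i) * fps_const z ^ (T - 1 - red i)"
    "\<And>i. (fps_const z' ^ T * c ^ T - b ^ T) * H i z' = b ^ red i * c ^ (T - red i) * fps_const z' ^ (T - 1 - red i)"
    "fps_const z ^ T * c ^ T - b ^ T \<noteq> 0" "fps_const z' ^ T * c ^ T - b ^ T \<noteq> 0"
  proof (cases x)
    case (Fin a)
    \<comment> \<open>If the difference vanished, (a + X)^T would be constant, whereas its
      derivative T (a + X)^(T - 1) is nonzero.\<close>
    have nz: "fps_const y ^ T * 1 ^ T - (fps_const a + fps_X) ^ T \<noteq> 0" for y
    proof -
      have "(fps_const a + fps_X) ^ T - fps_const y ^ T \<noteq> 0"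
      proof
        assume "(fps_const a + fps_X) ^ T - fps_const y ^ T = 0"
        then have "fps_deriv ((fps_const a + fps_X) ^ T - fps_const (y ^ T)) = 0" by (simp add: fps_const_power)
        then have "of_nat T * (fps_const a + fps_X) ^ (T - 1) = (0::complex fps)"
          by (simp add: fps_deriv_power)
        moreover have "(of_nat T :: complex fps) \<noteq> 0" using T by simp
        ultimately have "fps_const a + fps_X = 0" using T
          by (metis mult_eq_0_iff power_not_zero)
        then have "fps_nth (fps_const a + fps_X) 1 = fps_nth 0 1" by metis
        then show False by simp
      qed
      then show ?thesis by simp
    qed
    show ?thesis
      by (rule that[of 1 "fps_const a + fps_X"])
         (use nz mode_fps[OF ne(1)[OF Fin]] mode_fps[OF ne(2)[OF Fin]] in
            \<open>simp_all add: H_def Fin red_def\<close>)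
  next
    case Infty
    have nz: "fps_const y ^ T * fps_X ^ T - 1 ^ T \<noteq> 0" for y :: complex
    proof
      assume "fps_const y ^ T * fps_X ^ T - 1 ^ T = 0"
      then have "fps_nth (fps_const y ^ T * fps_X ^ T - 1 ^ T) 0 = fps_nth 0 0" by metis
      then show False using T by (auto simp: power_0_left)
    qed
    show ?thesis
      by (rule that[of fps_X 1])
         (use nz mode_Infty_fps in \<open>simp_all add: H_def Infty red_def\<close>)
  qed
  have R: "(fps_const y' ^ T - fps_const y ^ T) * fps_const (rcoef T j y y')
      = fps_const y ^ red j * fps_const y' ^ (T - 1 - red j)" if "y ^ T \<noteq> y' ^ T" for y y' j
    using that by (simp add: rcoef_def Let_def red_def fps_const_power)
  have "H i z * H j z' = fps_const (rcoef T j z z') * H (i + j) z + fps_const (rcoef T i z' z) * H (i + j) z'"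
    by (rule kernel_identity[where ?Z1.0 = "fps_const z" and ?Z2.0 = "fps_const z'" and T = T,
        OF red red bc(1) bc(2) red_add bc(1,2) R[OF zz] R[OF zz[symmetric]] bc(3,4)])
       (use zz in \<open>auto simp: fps_const_power fps_eq_iff\<close>)
  then have "fps_nth (H i z * H j z') r = fps_nth (fps_const (rcoef T j z z') * H (i + j) z
      + fps_const (rcoef T i z' z) * H (i + j) z') r" by simp
  then show ?thesis unfolding fps_add_nth fps_mult_left_const_nth
    by (simp add: fps_mult_nth H_def atLeast0AtMost)
qed

end


text \<open>At the origin the rotated poles coincide, so averaging over k turns into a filter on the
  degree. What passes the filter is the coefficient with which the field at 0 enters
  \<open>twist_lax\<close>.\<close>

lemma mode_zero:
  assumes T: "T \<ge> 1" and wT: "w ^ T = 1" and prim: "\<And>k. 0 < k \<Longrightarrow> k < T \<Longrightarrow> w ^ k \<noteq> 1"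
  shows "mode T w (Fin 0) p i z = (if int T dvd int p - i then 1 / z ^ (p + 1) else 0)"
proof -
  have w0: "w \<noteq> 0" using wT T by (auto simp: power_0_left)
  have "w powi (- int k * (i + 1)) / (w powi (- int k) * z - 0) ^ (p + 1)
     = w powi (int k * (int p - i)) / z ^ (p + 1)" for k
  proof -
    have "w powi (int k * (int p - i)) * (w powi (- int k)) ^ (p + 1) =
       w powi (int k * (int p - i)) * w powi (- int k * int (p + 1))"
      by (simp only: power_int_mult power_int_of_nat)
    also have "\<dots> = w powi (- int k * (i + 1))" using w0
      by (subst power_int_add[symmetric]) (auto simp: algebra_simps)
    finally have "w powi (- int k * (i + 1)) = w powi (int k * (int p - i)) * (w powi (- int k)) ^ (p + 1)" ..
    then show ?thesis using w0 by (simp add: power_mult_distrib divide_simps)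
  qed
  then have "mode T w (Fin 0) p i z = 1 / of_nat T * ((\<Sum>k<T. w powi (int k * (int p - i))) / z ^ (p + 1))"
    by (simp add: mode_def sum_divide_distrib)
  then show ?thesis using T by (simp add: primitive_root_sum[OF assms])
qed

text \<open>Needed to replace i + j by 0: the level term of a bracket carries coefficients of degree
  i + j, the twist function those of degree 0.\<close>

lemma mode_cong:
  assumes T: "T \<ge> 1" and wT: "w ^ T = 1" and prim: "\<And>k. 0 < k \<Longrightarrow> k < T \<Longrightarrow> w ^ k \<noteq> 1"
    and ij: "int T dvd i - j"
  shows "mode T w x p i z = mode T w x p j z"
proof -
  have w0: "w \<noteq> 0" using wT T by (auto simp: power_0_left)
  have "w powi (- int k * (i + 1)) = w powi (- int k * (j + 1))" for k
  proof -
    have "w powi (- int k * (i + 1)) = w powi (- int k * (j + 1)) * w powi (- int k * (i - j))"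
      using w0 by (subst power_int_add[symmetric]) (auto simp: algebra_simps)
    also have "w powi (- int k * (i - j)) = 1"
      using ij by (subst primitive_root_eq_1_iff[OF T wT prim]) auto
    finally show ?thesis by simp
  qed
  moreover have "int T dvd i + int p \<longleftrightarrow> int T dvd j + int p"
    using ij by (metis diff_add_cancel dvd_add_right_iff add.assoc)
  ultimately show ?thesis by (simp only: mode_def)
qed

section \<open>Polynomials\<close>

lemma lookup_map_zero: "f 0 = 0 \<Longrightarrow> lookup (Poly_Mapping.map f p) k = f (lookup p k)"
  by (auto simp: Poly_Mapping.map.rep_eq when_def)

lemma single_sum: "single k (sum f A) = (\<Sum>x\<in>A. single k (f x))"
  by (induction A rule: infinite_finite_induct) (auto simp: single_add)

lemma scst_0 [simp]: "scst 0 = 0" and scst_1 [simp]: "scst 1 = 1"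
  by (auto simp: scst_def)

lemma scst_add: "scst (c + d) = scst c + scst d" and scst_mult: "scst (c * d) = scst c * scst d"
  and scst_minus: "scst (- c) = - scst c"
  by (auto simp: scst_def single_add mult_single single_uminus)

lemma scst_sum: "scst (sum f A) = (\<Sum>x\<in>A. scst (f x))"
  by (simp add: scst_def single_sum)

lemma lookup_scst_mult: "lookup (scst c * f) m = c * lookup f m"
  unfolding scst_def mult_map_scale_conv_mult[symmetric] by (simp add: lookup_map_zero)

lemma keys_scst_mult: "keys (scst c * f) \<subseteq> keys f"
  by (auto simp: in_keys_iff lookup_scst_mult)

lemma pdiff_superset:
  assumes "finite A" "keys f \<subseteq> A"
  shows "pdiff v f = (\<Sum>m\<in>A. single (m - single v 1) (of_nat (lookup m v) * lookup f m))"
  unfolding pdiff_def using assms by (intro sum.mono_neutral_left) (auto simp: in_keys_iff)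

lemma pdiff_add: "pdiff v (f + g) = pdiff v f + pdiff v g"
proof -
  let ?A = "keys f \<union> keys g"
  have A: "finite ?A" by simp
  have "keys (f + g) \<subseteq> ?A" by (rule Poly_Mapping.keys_add)
  then show ?thesis
    by (simp add: pdiff_superset[of ?A] lookup_add distrib_left single_add sum.distrib)
qed

lemma pdiff_scst_mult: "pdiff v (scst c * f) = scst c * pdiff v f"
  unfolding pdiff_superset[OF finite_keys keys_scst_mult]
  by (auto simp: pdiff_def sum_distrib_left lookup_scst_mult intro!: sum.cong)
    (simp add: scst_def mult_single mult_ac)

lemma pdiff_svar: "pdiff v (svar w) = (if v = w then 1 else 0)"
  by (auto simp: pdiff_def svar_def lookup_single)

lemma pdiff_notin: "v \<notin> indets f \<Longrightarrow> pdiff v f = 0"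
  by (auto simp: pdiff_def indets_def in_keys_iff intro!: sum.neutral)

lemma finite_indets: "finite (indets f)"
  by (simp add: indets_def)

text \<open>The summation ranges of \<open>pbr\<close> depend on its arguments; over a common larger
  range additivity and homogeneity can be read off termwise.\<close>

lemma pbr_superset:
  assumes "finite A" "indets f \<subseteq> A" "finite B" "indets g \<subseteq> B"
  shows "pbr D f g = (\<Sum>v\<in>A. \<Sum>w\<in>B. pdiff v f * pdiff w g * svar (gDC_br D v w))"
proof -
  have "pbr D f g = (\<Sum>v\<in>indets f. \<Sum>w\<in>B. pdiff v f * pdiff w g * svar (gDC_br D v w))"
    unfolding pbr_def using assms
    by (intro sum.cong refl sum.mono_neutral_left) (auto simp: pdiff_notin)
  also have "\<dots> = (\<Sum>v\<in>A. \<Sum>w\<in>B. pdiff v f * pdiff w g * svar (gDC_br D v w))"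
    using assms by (intro sum.mono_neutral_left) (auto simp: pdiff_notin)
  finally show ?thesis .
qed

lemma indets_add: "indets (f + g) \<subseteq> indets f \<union> indets g"
  using Poly_Mapping.keys_add[of f g] by (auto simp: indets_def)

lemma indets_scst_mult: "indets (scst c * f) \<subseteq> indets f"
  using keys_scst_mult[of c f] by (auto simp: indets_def)

lemma pbr_add_left: "pbr D (f + f') g = pbr D f g + pbr D f' g"
proof -
  let ?A = "indets f \<union> indets f'" and ?B = "indets g"
  have "pbr D h g = (\<Sum>v\<in>?A. \<Sum>w\<in>?B. pdiff v h * pdiff w g * svar (gDC_br D v w))"
    if "indets h \<subseteq> ?A" for h
    by (rule pbr_superset) (use that in \<open>auto simp: finite_indets\<close>)
  then show ?thesis
    by (simp add: indets_add pdiff_add algebra_simps sum.distrib)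
qed

lemma pbr_add_right: "pbr D f (g + g') = pbr D f g + pbr D f g'"
proof -
  let ?A = "indets f" and ?B = "indets g \<union> indets g'"
  have "pbr D f h = (\<Sum>v\<in>?A. \<Sum>w\<in>?B. pdiff v f * pdiff w h * svar (gDC_br D v w))"
    if "indets h \<subseteq> ?B" for h
    by (rule pbr_superset) (use that in \<open>auto simp: finite_indets\<close>)
  then show ?thesis
    by (simp add: indets_add pdiff_add algebra_simps sum.distrib)
qed

lemma pbr_0_left [simp]: "pbr D 0 g = 0" and pbr_0_right [simp]: "pbr D f 0 = 0"
  by (auto simp: pbr_def indets_def)

lemma pbr_sum_left: "pbr D (sum f A) g = (\<Sum>x\<in>A. pbr D (f x) g)"
  by (induction A rule: infinite_finite_induct) (auto simp: pbr_add_left)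

lemma pbr_sum_right: "pbr D f (sum g A) = (\<Sum>x\<in>A. pbr D f (g x))"
  by (induction A rule: infinite_finite_induct) (auto simp: pbr_add_right)

lemma pbr_scst_left: "pbr D (scst c * f) g = scst c * pbr D f g"
  unfolding pbr_superset[OF finite_indets indets_scst_mult finite_indets order_refl]
  unfolding pbr_def pdiff_scst_mult sum_distrib_left by (simp only: mult_ac)

lemma pbr_scst_right: "pbr D f (scst c * g) = scst c * pbr D f g"
  unfolding pbr_superset[OF finite_indets order_refl finite_indets indets_scst_mult]
  unfolding pbr_def pdiff_scst_mult sum_distrib_left by (simp only: mult_ac)

lemma indets_svar: "indets (svar v) = {v}"
  by (simp add: indets_def svar_def)

lemma pbr_svar: "pbr D (svar v) (svar w) = svar (gDC_br D v w)"
  by (simp add: pbr_def indets_svar pdiff_svar)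

lemma scst_in_spolys [simp]: "scst c \<in> spolys D"
  by (simp add: spolys_def scst_def)

section \<open>Congruence modulo the level ideal\<close>

text \<open>Calculations stay with polynomial representatives and this congruence;
  \<open>lev_class_eq\<close> passes to the quotient only at the very end.\<close>

definition lev_eq :: "('g::ab_group_add) gaudin \<Rightarrow> 'g spoly \<Rightarrow> 'g spoly \<Rightarrow> bool" where
  "lev_eq D f g \<longleftrightarrow> f - g \<in> level_ideal D"

lemma zero_in_gD [simp]: "0 \<in> gD D"
proof -
  have s: "s_hat D x 0 = 0" for x by (simp add: s_hat_def)
  have t: "t_hat D 0 = 0" by (rule poly_mapping_eqI) (simp add: t_hat_def Poly_Mapping.map.rep_eq)
  have "takiff_act D x g 0 = 0" for x g
  proof (cases g)
    case (Pair k e)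
    have "(s_hat D x ^^ k) 0 = 0" by (induction k) (auto simp: s)
    then show ?thesis using Pair by (simp add: t)
  qed
  then show ?thesis by (auto simp: gD_def takiff_def)
qed

text \<open>No rule of the inductive definition yields 0 directly; it arises as the multiple by the
  constant 0 of a linearity relation.\<close>

lemma zero_in_level_ideal: "0 \<in> level_ideal D"
proof -
  have "(0::'a gDC) \<in> gDC D" by (simp add: gDC_def zero_prod_def)
  then have "svar (0 + 0) - svar 0 - svar 0 \<in> sym_ideal D" by (intro sym_ideal.sym_plus)
  from level_ideal.mult[OF scst_in_spolys level_ideal.sym[OF this], of 0] show ?thesis by simp
qed

text \<open>The additivity relation for 0 + 0 is the polynomial - \<open>svar 0\<close>.\<close>

lemma svar_0: "lev_eq D (svar 0) 0"
proof -
  have "(0::'a gDC) \<in> gDC D" by (simp add: gDC_def zero_prod_def)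
  then have "svar (0 + 0) - svar 0 - svar 0 \<in> sym_ideal D" by (intro sym_ideal.sym_plus)
  from level_ideal.mult[OF scst_in_spolys level_ideal.sym[OF this], of "-1"] show ?thesis
    by (simp add: lev_eq_def scst_minus)
qed

lemma lev_eq_refl [simp, intro]: "lev_eq D f f"
  by (simp add: lev_eq_def zero_in_level_ideal)

lemma lev_eq_scst: "lev_eq D f g \<Longrightarrow> lev_eq D (scst c * f) (scst c * g)"
  using level_ideal.mult[OF scst_in_spolys, of "f - g" D c]
  by (simp add: lev_eq_def right_diff_distrib)

lemma lev_eq_sym: "lev_eq D f g \<Longrightarrow> lev_eq D g f"
  using level_ideal.mult[OF scst_in_spolys, of "f - g" D "-1"] by (simp add: lev_eq_def scst_minus)

lemma lev_eq_add: "lev_eq D f g \<Longrightarrow> lev_eq D f' g' \<Longrightarrow> lev_eq D (f + f') (g + g')"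
  using level_ideal.add[of "f - g" D "f' - g'"] by (simp add: lev_eq_def algebra_simps)

lemma lev_eq_trans [trans]: "lev_eq D f g \<Longrightarrow> lev_eq D g h \<Longrightarrow> lev_eq D f h"
  using level_ideal.add[of "f - g" D "g - h"] by (simp add: lev_eq_def)

text \<open>Without these two rules, calculations fall back on substitution, whose unification blows up.\<close>

lemma eq_lev_eq_trans [trans]: "f = g \<Longrightarrow> lev_eq D g h \<Longrightarrow> lev_eq D f h"
  and lev_eq_eq_trans [trans]: "lev_eq D f g \<Longrightarrow> g = h \<Longrightarrow> lev_eq D f h"
  by simp_all

lemma lev_eq_sum: "(\<And>x. x \<in> A \<Longrightarrow> lev_eq D (f x) (g x)) \<Longrightarrow> lev_eq D (sum f A) (sum g A)"
  by (induction A rule: infinite_finite_induct) (auto intro: lev_eq_add)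

lemma lev_class_eq: "lev_eq D f g \<Longrightarrow> lev_class D f = lev_class D g"
proof -
  have *: "lev_class D f \<subseteq> lev_class D g" if "lev_eq D f g" for f g
    using level_ideal.add[of _ D "f - g"] that by (force simp: lev_class_def lev_eq_def)
  assume "lev_eq D f g"
  then show ?thesis using * lev_eq_sym by blast
qed

lemma lev_eq_svar_add:
  "v \<in> gDC D \<Longrightarrow> w \<in> gDC D \<Longrightarrow> lev_eq D (svar (v + w)) (svar v + svar w)"
  using level_ideal.sym[OF sym_ideal.sym_plus[of v D w]] by (simp add: lev_eq_def diff_diff_add)

lemma lev_eq_svar_scale:
  "v \<in> gDC D \<Longrightarrow> lev_eq D (svar (gDC_scale D c v)) (scst c * svar v)"
  using level_ideal.sym[OF sym_ideal.sym_scale[of v D c]] by (simp add: lev_eq_def)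


section \<open>The finite-dimensional algebra\<close>

sublocale gaudin_algebra \<subseteq> vs: vector_space "sc D"
  using fin_dim finite_dimensional_vector_space.axioms(1) by blast

context gaudin_algebra
begin

abbreviation T where "T \<equiv> cyc D"
abbreviation \<omega> where "\<omega> \<equiv> rt D"

lemma rt_nz [simp]: "\<omega> \<noteq> 0"
  using rt_root T_pos by (auto simp: power_0_left)

lemma rt_powi_eq_1: "\<omega> powi i = 1 \<longleftrightarrow> int T dvd i"
  by (rule primitive_root_eq_1_iff[OF T_pos rt_root rt_primitive])

lemma rt_powi_eq: "\<omega> powi i = \<omega> powi j \<longleftrightarrow> int T dvd i - j"
  using rt_powi_eq_1[of "i - j"] by (simp add: power_int_diff)

lemma cnj_rt: "cnj \<omega> = inverse \<omega>"
proof -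
  have "norm \<omega> ^ T = 1" by (metis norm_one norm_power rt_root)
  then have "norm \<omega> = 1" using T_pos by (metis norm_ge_zero power_eq_imp_eq_base power_one less_le_trans zero_less_one zero_le_one)
  then have "\<omega> * cnj \<omega> = 1" using complex_norm_square[of \<omega>] by simp
  then show ?thesis by (metis inverse_unique)
qed

lemmas sc_simps = vs.scale_right_distrib vs.scale_left_distrib vs.scale_right_diff_distrib
  vs.scale_left_diff_distrib vs.scale_scale

lemma br_add_right: "br D x (y + y') = br D x y + br D x y'"
  and br_sc_right: "br D x (sc D c y) = sc D c (br D x y)"
  and br_sum_right: "br D x (sum f A) = (\<Sum>i\<in>A. br D x (f i))"
  and br_0_right [simp]: "br D x 0 = 0"
  using Vector_Spaces.linear.axioms(3)[OF br_linear_right, of x]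
  by (simp_all add: module_hom.add module_hom.scale module_hom.sum module_hom.zero)

lemma br_add_left: "br D (x + x') y = br D x y + br D x' y"
  and br_sc_left: "br D (sc D c x) y = sc D c (br D x y)"
  and br_0_left [simp]: "br D 0 y = 0"
  using Vector_Spaces.linear.axioms(3)[OF br_linear_left, of y]
  by (simp_all add: module_hom.add[where f = "\<lambda>x. br D x y"] module_hom.scale[where f = "\<lambda>x. br D x y"]
     module_hom.zero[where f = "\<lambda>x. br D x y"])

lemma br_antisym: "br D x y = - br D y x"
proof -
  have "br D (x + y) (x + y) = br D x x + (br D x y + br D y x) + br D y y"
    by (simp only: br_add_left br_add_right add_ac)
  then show ?thesis by (simp add: br_alternating eq_neg_iff_add_eq_0)
qed

lemma sig_add: "sig D (x + y) = sig D x + sig D y"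
  and sig_sc: "sig D (sc D c x) = sc D c (sig D x)"
  and sig_sum: "sig D (sum f A) = (\<Sum>i\<in>A. sig D (f i))"
  and sig_0 [simp]: "sig D 0 = 0"
  using Vector_Spaces.linear.axioms(3)[OF sig_linear]
  by (simp_all add: module_hom.add module_hom.scale module_hom.sum module_hom.zero)

lemma frm_add_right: "frm D x (y + y') = frm D x y + frm D x y'"
  and frm_sc_right: "frm D x (sc D c y) = c * frm D x y"
  and frm_sum_right: "frm D x (sum f A) = (\<Sum>i\<in>A. frm D x (f i))"
  and frm_diff_right: "frm D x (y - y') = frm D x y - frm D x y'"
  and frm_0_right [simp]: "frm D x 0 = 0"
  using Vector_Spaces.linear.axioms(3)[OF frm_linear, of x]
  by (simp_all add: module_hom.add module_hom.scale module_hom.sum module_hom.zero module_hom.diff)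

lemma frm_add_left: "frm D (x + x') y = frm D x y + frm D x' y"
  and frm_sc_left: "frm D (sc D c x) y = c * frm D x y"
  and frm_sum_left: "frm D (sum f A) y = (\<Sum>i\<in>A. frm D (f i) y)"
  and frm_diff_left: "frm D (x - x') y = frm D x y - frm D x' y"
  and frm_0_left [simp]: "frm D 0 y = 0"
  by (simp_all add: frm_sym[of _ y] frm_add_right frm_sc_right frm_sum_right frm_diff_right)

lemma frm_ext: "(\<And>w. frm D x w = frm D y w) \<Longrightarrow> x = y"
  using frm_nondegenerate[of "x - y"] by (simp add: frm_diff_left)

lemma tau_0 [simp]: "tau D 0 = 0"
  using tau_add[of 0 0] by simp

lemma tau_minus: "tau D (- x) = - tau D x"
  using tau_add[of x "- x"] by (simp add: eq_neg_iff_add_eq_0 add.commute)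

lemma tau_diff: "tau D (x - y) = tau D x - tau D y"
  using tau_add[of x "- y"] by (simp add: tau_minus)

text \<open>The explicit formulas belong to the statement so that u and v can be seen to stay in any
  \<tau>-stable complex subspace containing x.\<close>

lemma real_imag_decomp:
  "\<exists>u v. tau D u = u \<and> tau D v = v \<and> x = u + sc D \<i> v \<and>
     u = sc D (1/2) (x + tau D x) \<and> v = sc D (- \<i>/2) (x - tau D x)"
proof (intro exI conjI)
  let ?u = "sc D (1/2) (x + tau D x)" and ?v = "sc D (- \<i>/2) (x - tau D x)"
  show "tau D ?u = ?u" by (simp add: tau_antilinear tau_add tau_involutive add.commute)
  show "tau D ?v = ?v"
    by (simp add: tau_antilinear tau_diff tau_involutive vs.scale_right_diff_distrib)
  have "?u + sc D \<i> ?v = sc D (1/2) (x + tau D x) + sc D (1/2) (x - tau D x)" by simp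
  also have "\<dots> = sc D (1/2) (x + x)" unfolding vs.scale_right_distrib[symmetric] by simp
  also have "\<dots> = sc D (1/2 + 1/2) x" by (simp only: vs.scale_right_distrib vs.scale_left_distrib)
  finally show "x = ?u + sc D \<i> ?v" by simp
qed auto

text \<open>The form is real on \<tau>-fixed vectors, and every vector is a complex combination of
  two of them.\<close>

lemma frm_tau: "frm D (tau D x) (tau D y) = cnj (frm D x y)"
proof -
  obtain u v where x: "tau D u = u" "tau D v = v" "x = u + sc D \<i> v" using real_imag_decomp by blast
  obtain u' v' where y: "tau D u' = u'" "tau D v' = v'" "y = u' + sc D \<i> v'" using real_imag_decomp by blast
  have r: "cnj (frm D a b) = frm D a b" if "tau D a = a" "tau D b = b" for a b
    using frm_real[of a b] that by (simp add: real_form_def Reals_cnj_iff)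
  show ?thesis
    by (simp add: x y tau_add tau_antilinear frm_add_left frm_add_right frm_diff_left frm_diff_right
        frm_sc_left frm_sc_right r algebra_simps)
qed

lemma real_vector_space: "vector_space (\<lambda>r::real. sc D (of_real r))"
  by unfold_locales (simp_all add: sc_simps)

text \<open>B spans only the \<tau>-fixed part of W, and only over the reals. The expansion holds on
  B by duality, hence on its real span, and reaches W through real and imaginary parts. Taking for W
  the whole space or an eigenspace serves \<open>bas\<close> and \<open>gbas\<close> at
  once.\<close>

lemma dual_basis_expansion:
  assumes "real_basis D B (W \<inter> real_form D)"
    and W: "\<And>x. x \<in> W \<Longrightarrow> tau D x \<in> W" "\<And>x y. x \<in> W \<Longrightarrow> y \<in> W \<Longrightarrow> x + y \<in> W"
      "\<And>c x. x \<in> W \<Longrightarrow> sc D c x \<in> W"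
    and du: "\<And>a b. a \<in> B \<Longrightarrow> b \<in> B \<Longrightarrow> frm D (du a) b = of_bool (a = b)"
    and x: "x \<in> W"
  shows "x = (\<Sum>b\<in>B. sc D (frm D (du b) x) b)"
proof -
  interpret r: vector_space "\<lambda>r::real. sc D (of_real r)" by (rule real_vector_space)
  have fB: "finite B" and span: "r.span B = W \<inter> real_form D"
    using assms(1) by (auto simp: real_basis_def)
  define P where "P x \<longleftrightarrow> x = (\<Sum>b\<in>B. sc D (frm D (du b) x) b)" for x
  have P_add: "P (x + y)" if "P x" "P y" for x y
  proof -
    have "x + y = (\<Sum>b\<in>B. sc D (frm D (du b) x) b) + (\<Sum>b\<in>B. sc D (frm D (du b) y) b)"
      using that unfolding P_def by metis
    then show ?thesis unfolding P_def frm_add_right vs.scale_left_distrib sum.distrib .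
  qed
  have P_sc: "P (sc D c x)" if "P x" for c x
  proof -
    have "sc D c x = sc D c (\<Sum>b\<in>B. sc D (frm D (du b) x) b)"
      using that unfolding P_def by metis
    then show ?thesis unfolding P_def frm_sc_right vs.scale_sum_right vs.scale_scale .
  qed
  have P_B: "P b" if "b \<in> B" for b
  proof -
    have "(\<Sum>a\<in>B. sc D (frm D (du a) b) a) = (\<Sum>a\<in>B. if a = b then b else 0)"
      by (rule sum.cong) (auto simp: du that)
    then show ?thesis using that fB by (simp add: P_def)
  qed
  have P_real: "P x" if "x \<in> r.span B" for x
    using that
  proof (induction rule: r.span_induct_alt)
    case base show ?case by (simp add: P_def)
  next
    case (step c a y) show ?case by (rule P_add[OF P_sc[OF P_B[OF step(1)]] step(2)])
  qed
  obtain u v where uv: "tau D u = u" "tau D v = v" "x = u + sc D \<i> v"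
     "u = sc D (1/2) (x + tau D x)" "v = sc D (- \<i>/2) (x - tau D x)" using real_imag_decomp by blast
  have "x - tau D x = x + sc D (-1) (tau D x)" by simp
  then have "u \<in> W" "v \<in> W" using uv(4,5) W x by (metis)+
  then have "P u" "P v" using uv(1,2) P_real by (auto simp: span real_form_def)
  then show ?thesis using P_add P_sc uv(3) unfolding P_def by blast
qed

lemma finite_bas [simp]: "finite (bas D)" using bas by (simp add: real_basis_def)

lemma expand_bas: "x = (\<Sum>b\<in>bas D. sc D (frm D (dual D b) x) b)"
  by (rule dual_basis_expansion[where W = UNIV]) (use bas dual in auto)

section \<open>Eigenspaces of \<sigma> and their dual bases\<close>

lemma eig_iff: "x \<in> eigenspace D j \<longleftrightarrow> sig D x = sc D (\<omega> powi j) x"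
  by (simp add: eigenspace_def)

lemma eig_add: "x \<in> eigenspace D j \<Longrightarrow> y \<in> eigenspace D j \<Longrightarrow> x + y \<in> eigenspace D j"
  by (simp add: eig_iff sig_add sc_simps)

lemma eig_sc: "x \<in> eigenspace D j \<Longrightarrow> sc D c x \<in> eigenspace D j"
  by (simp add: eig_iff sig_sc mult.commute)

lemma eig_0 [simp]: "0 \<in> eigenspace D j"
  by (simp add: eig_iff)

lemma eig_cong: "int T dvd i - j \<Longrightarrow> eigenspace D i = eigenspace D j"
  using rt_powi_eq[of i j] by (auto simp: eig_iff)

lemma eig_sum: "(\<And>i. i \<in> A \<Longrightarrow> f i \<in> eigenspace D j) \<Longrightarrow> sum f A \<in> eigenspace D j"
  by (induction A rule: infinite_finite_induct) (auto intro: eig_add)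

lemma eig_br: "x \<in> eigenspace D i \<Longrightarrow> y \<in> eigenspace D j \<Longrightarrow> br D x y \<in> eigenspace D (i + j)"
  by (simp add: eig_iff sig_br br_sc_left br_sc_right power_int_add)

lemma eig_tau: "x \<in> eigenspace D j \<Longrightarrow> tau D x \<in> eigenspace D j"
  using tau_eigenspace by blast

lemma expand_gbas:
  "x \<in> eigenspace D j \<Longrightarrow> x = (\<Sum>b\<in>gbas D j. sc D (frm D (gdual D j b) x) b)"
  by (rule dual_basis_expansion[where W = "eigenspace D j"])
     (use gbas[of j] gdual in \<open>auto simp: real_eigenspace_def intro: eig_tau eig_add eig_sc\<close>)

text \<open>Invariance under \<sigma> multiplies the value by \<omega>^(i + j), which differs from
  1.\<close>

lemma frm_eig_0:
  assumes "x \<in> eigenspace D i" "y \<in> eigenspace D j" "\<not> int T dvd i + j"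
  shows "frm D x y = 0"
proof -
  have "frm D x y = frm D (sc D (\<omega> powi i) x) (sc D (\<omega> powi j) y)"
    using frm_sig[of x y] assms by (simp add: eig_iff)
  also have "\<dots> = \<omega> powi (i + j) * frm D x y"
    by (simp add: frm_sc_left frm_sc_right power_int_add)
  finally show ?thesis using rt_powi_eq_1 assms(3) by (metis mult_cancel_right1)
qed

lemma gbas_eig: "a \<in> gbas D j \<Longrightarrow> a \<in> eigenspace D j"
proof -
  interpret r: vector_space "\<lambda>r::real. sc D (of_real r)" by (rule real_vector_space)
  assume "a \<in> gbas D j"
  then have "a \<in> real_eigenspace D j" using gbas[of j] r.span_base by (auto simp: real_basis_def)
  then show "a \<in> eigenspace D j" by (auto simp: real_eigenspace_def)
qed

lemma bas_real: "a \<in> bas D \<Longrightarrow> tau D a = a"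
proof -
  interpret r: vector_space "\<lambda>r::real. sc D (of_real r)" by (rule real_vector_space)
  assume "a \<in> bas D"
  then show "tau D a = a" using bas r.span_base by (auto simp: real_basis_def real_form_def)
qed

lemma gdual_eig: "a \<in> gbas D j \<Longrightarrow> gdual D j a \<in> eigenspace D (- j)"
  using gdual_real by (auto simp: real_eigenspace_def)

text \<open>The isotypic projection for the cyclic group generated by \<sigma>: an average of its
  powers against a character.\<close>

definition proj :: "int \<Rightarrow> 'g \<Rightarrow> 'g" where
  "proj i x = (\<Sum>k<T. sc D (1 / of_nat T * \<omega> powi (- int k * i)) ((sig D ^^ k) x))"

text \<open>Applying \<sigma> shifts the summation index by one, and the summands are
  T-periodic.\<close>

lemma proj_eig: "proj i x \<in> eigenspace D i"
proof -
  define f where "f k = sc D (1 / of_nat T * \<omega> powi (- int k * i)) ((sig D ^^ k) x)" for k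
  have f: "sig D (f k) = sc D (\<omega> powi i) (f (Suc k))" for k
  proof -
    have "\<omega> powi (- int k * i) = \<omega> powi i * \<omega> powi (- int (Suc k) * i)"
      by (subst power_int_add[symmetric]) (auto simp: algebra_simps)
    then show ?thesis by (simp add: f_def sig_sc mult_ac)
  qed
  have f0: "f T = f 0"
  proof -
    have "\<omega> powi (- int T * i) = 1" by (subst rt_powi_eq_1) simp
    then show ?thesis by (simp add: f_def sig_order)
  qed
  have "sig D (proj i x) = sc D (\<omega> powi i) (\<Sum>k<T. f (Suc k))"
    by (simp only: proj_def f_def[symmetric] sig_sum f vs.scale_sum_right)
  also have "(\<Sum>k<T. f (Suc k)) = (\<Sum>k<T. f k)"
  proof -
    have "f 0 + (\<Sum>k<T. f (Suc k)) = (\<Sum>k<T. f k) + f T"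
      by (metis sum.lessThan_Suc sum.lessThan_Suc_shift)
    then show ?thesis by (simp add: f0)
  qed
  finally show ?thesis by (simp add: eig_iff proj_def f_def)
qed

lemma sum_proj: "(\<Sum>i<T. proj (int i) x) = x"
proof -
  have "(\<Sum>i<T. proj (int i) x) = (\<Sum>k<T. \<Sum>i<T. sc D (1 / of_nat T * \<omega> powi (- int k * int i)) ((sig D ^^ k) x))"
    unfolding proj_def by (rule sum.swap)
  also have "\<dots> = (\<Sum>k<T. if k = 0 then x else 0)"
  proof (rule sum.cong[OF refl])
    fix k assume "k \<in> {..<T}"
    then have k: "int T dvd - int k \<longleftrightarrow> k = 0" by (auto dest: zdvd_imp_le)
    have "(\<Sum>i<T. sc D (1 / of_nat T * \<omega> powi (- int k * int i)) ((sig D ^^ k) x))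
      = sc D (1 / of_nat T * (\<Sum>i<T. \<omega> powi (int i * (- int k)))) ((sig D ^^ k) x)"
      by (simp only: vs.scale_sum_left sum_distrib_left mult.commute[of "- int k"])
    also have "\<dots> = (if k = 0 then x else 0)"
    proof -
      have "(\<Sum>i<T. \<omega> powi (int i * (- int k))) = (if k = 0 then of_nat T else 0)"
        using primitive_root_sum[OF T_pos rt_root rt_primitive, of "- int k"] unfolding k .
      then show ?thesis using T_pos by (cases "k = 0") auto
    qed
    finally show "(\<Sum>i<T. sc D (1 / of_nat T * \<omega> powi (- int k * int i)) ((sig D ^^ k) x)) =
      (if k = 0 then x else 0)" .
  qed
  also have "\<dots> = x" using T_pos by simp
  finally show ?thesis .
qed

text \<open>By nondegeneracy it is enough to pair with the homogeneous components of an arbitrary w.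
  Those of degree j are expanded in \<open>gbas\<close>; all others are orthogonal to both
  sides.\<close>

lemma expand_gdual:
  assumes y: "y \<in> eigenspace D (- j)"
  shows "(\<Sum>b\<in>gbas D j. sc D (frm D y b) (gdual D j b)) = y"
proof (rule frm_ext)
  fix w
  define S where "S = (\<Sum>b\<in>gbas D j. sc D (frm D y b) (gdual D j b))"
  have S: "S \<in> eigenspace D (- j)" unfolding S_def by (intro eig_sum eig_sc gdual_eig)
  have "frm D S (proj i w) = frm D y (proj i w)" for i
  proof (cases "int T dvd i - j")
    case True
    then have w: "proj i w \<in> eigenspace D j" using eig_cong proj_eig by blast
    have "frm D y (proj i w) = frm D y (\<Sum>b\<in>gbas D j. sc D (frm D (gdual D j b) (proj i w)) b)"
      using expand_gbas[OF w] by simp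
    then show ?thesis by (simp add: S_def frm_sum_right frm_sum_left frm_sc_right frm_sc_left mult.commute)
  next
    case False
    then have "\<not> int T dvd - j + i" by (simp add: algebra_simps)
    then show ?thesis using frm_eig_0 proj_eig S y by metis
  qed
  then have "(\<Sum>i<T. frm D S (proj (int i) w)) = (\<Sum>i<T. frm D y (proj (int i) w))" by simp
  then show "frm D S w = frm D y w" by (simp add: frm_sum_right[symmetric] sum_proj)
qed

text \<open>\<open>coord\<close> is a representation over the complex numbers, whereas
  \<open>bas\<close> is assumed independent only over the reals. Complex independence comes from the
  existence of the dual vectors.\<close>

lemma coord_eq:
  assumes a: "a \<in> bas D"
  shows "coord D x a = frm D (dual D a) x"
proof -
  have ind: "\<not> vs.dependent (bas D)"
  proof
    assume "vs.dependent (bas D)"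
    then obtain u where u: "\<exists>v\<in>bas D. u v \<noteq> 0" "(\<Sum>v\<in>bas D. sc D (u v) v) = 0"
      using vs.dependent_finite[OF finite_bas] by auto
    have "u v = 0" if v: "v \<in> bas D" for v
    proof -
      have "0 = frm D (dual D v) (\<Sum>w\<in>bas D. sc D (u w) w)" by (simp add: u(2))
      also have "\<dots> = (\<Sum>w\<in>bas D. if w = v then u v else 0)"
        unfolding frm_sum_right by (rule sum.cong) (auto simp: frm_sc_right dual v)
      also have "\<dots> = u v" using v by simp
      finally show ?thesis by simp
    qed
    then show False using u(1) by auto
  qed
  have "vs.representation (bas D) (\<Sum>b\<in>bas D. sc D (frm D (dual D b) x) b) a =
     (\<Sum>b\<in>bas D. frm D (dual D b) x * of_bool (a = b))"
  proof -
    have sp: "v \<in> bas D \<Longrightarrow> sc D c v \<in> vs.span (bas D)" for v c by (simp add: vs.span_base vs.span_scale)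
    have "vs.representation (bas D) (\<Sum>b\<in>bas D. sc D (frm D (dual D b) x) b) =
      (\<lambda>a. \<Sum>b\<in>bas D. vs.representation (bas D) (sc D (frm D (dual D b) x) b) a)"
      by (rule vs.representation_sum[OF ind sp])
    then show ?thesis
      by (auto intro!: sum.cong simp: of_bool_def vs.representation_scale[OF ind vs.span_base] vs.representation_basis[OF ind])
  qed
  also have "\<dots> = frm D (dual D a) x" using a by (simp add: of_bool_def if_distrib cong: if_cong)
  finally show ?thesis using expand_bas[of x] by (simp add: coord_def)
qed

end


section \<open>Loops\<close>

lemma loop_eqI:
  "(\<And>n. lookup (fst X) n = lookup (fst Y) n) \<Longrightarrow> snd X = snd Y \<Longrightarrow> X = (Y :: 'g::ab_group_add loop)"
  by (simp add: prod_eq_iff poly_mapping_eqI)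

context gaudin_algebra
begin

lemma loop_scale_nth [simp]: "lookup (fst (loop_scale D c X)) n = sc D c (lookup (fst X) n)"
  "snd (loop_scale D c X) = c * snd X"
  by (simp_all add: loop_scale_def lookup_map_zero)

lemma loop_vector_space: "vector_space (loop_scale D)"
  by unfold_locales (auto intro!: loop_eqI simp: lookup_add sc_simps algebra_simps)

sublocale lp: vector_space "loop_scale D" by (rule loop_vector_space)

lemma lmode_nth [simp]: "lookup (fst (lmode x m)) n = (if m = n then x else 0)"
  "snd (lmode x m) = 0"
  by (auto simp: lmode_def lookup_single when_def)

lemma loopK_nth [simp]: "lookup (fst loopK) n = 0" "snd loopK = 1"
  by (auto simp: loopK_def)

lemma lmode_add: "lmode (x + y) n = lmode x n + lmode y n"
  by (rule loop_eqI) (auto simp: lookup_add)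

lemma lmode_sc: "lmode (sc D c x) n = loop_scale D c (lmode x n)"
  by (rule loop_eqI) auto

lemma lmode_0 [simp]: "lmode 0 n = 0"
  by (rule loop_eqI) auto

lemma lmode_sum: "lmode (sum f A) n = (\<Sum>i\<in>A. lmode (f i) n)"
  by (induction A rule: infinite_finite_induct) (auto simp: lmode_add)

lemma loop_tau_nth [simp]: "lookup (fst (loop_tau D X)) n = tau D (lookup (fst X) (- n))"
  "snd (loop_tau D X) = - cnj (snd X)"
proof -
  have "lookup (fst (loop_tau D X)) n = (\<Sum>k\<in>keys (fst X). tau D (lookup (fst X) k) when - k = n)"
    by (simp add: loop_tau_def lookup_sum lookup_single)
  also have "\<dots> = (\<Sum>k\<in>keys (fst X). if k = - n then tau D (lookup (fst X) (- n)) else 0)"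
    by (rule sum.cong) (auto simp: when_def)
  also have "\<dots> = tau D (lookup (fst X) (- n))"
    by (auto simp: in_keys_iff)
  finally show "lookup (fst (loop_tau D X)) n = tau D (lookup (fst X) (- n))" .
qed (simp add: loop_tau_def)

lemma loop_tau_add: "loop_tau D (X + Y) = loop_tau D X + loop_tau D Y"
  by (rule loop_eqI) (auto simp: lookup_add tau_add)

lemma loop_tau_scale: "loop_tau D (loop_scale D c X) = loop_scale D (cnj c) (loop_tau D X)"
  by (rule loop_eqI) (auto simp: tau_antilinear)

lemma loop_tau_tau [simp]: "loop_tau D (loop_tau D X) = X"
  by (rule loop_eqI) (auto simp: tau_involutive)

lemma loop_tau_lmode: "loop_tau D (lmode x n) = lmode (tau D x) (- n)"
  by (rule loop_eqI) auto

lemma sig_pow_add: "(sig D ^^ k) (x + y) = (sig D ^^ k) x + (sig D ^^ k) y"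
  by (induction k arbitrary: x y) (auto simp: sig_add)

lemma sig_pow_sc: "(sig D ^^ k) (sc D c x) = sc D c ((sig D ^^ k) x)"
  by (induction k arbitrary: x) (auto simp: sig_sc)

lemma sig_pow_0 [simp]: "(sig D ^^ k) 0 = 0"
  by (induction k) auto

lemma sig_pow_br: "(sig D ^^ k) (br D x y) = br D ((sig D ^^ k) x) ((sig D ^^ k) y)"
  by (induction k arbitrary: x) (auto simp: sig_br)

lemma frm_sig_pow: "frm D ((sig D ^^ k) x) ((sig D ^^ k) y) = frm D x y"
  by (induction k) (auto simp: frm_sig)

lemma loop_sig_nth [simp]: "lookup (fst (loop_sig D X)) n = sig D (lookup (fst X) n)"
  "snd (loop_sig D X) = snd X"
  by (simp_all add: loop_sig_def lookup_map_zero)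

lemma loop_sig_pow_nth [simp]: "lookup (fst ((loop_sig D ^^ k) X)) n = (sig D ^^ k) (lookup (fst X) n)"
  "snd ((loop_sig D ^^ k) X) = snd X"
  by (induction k) auto

lemma chi_r_nth [simp]:
  "lookup (fst (chi_r D k p X)) n = sc D (\<omega> powi (- (int k * int p))) ((sig D ^^ k) (tau D (lookup (fst X) (- n))))"
  "snd (chi_r D k p X) = - (\<omega> powi (- (int k * int p)) * cnj (snd X))"
  by (simp_all add: chi_r_def)

lemma chi_r_add: "chi_r D k p (X + Y) = chi_r D k p X + chi_r D k p Y"
  by (rule loop_eqI) (auto simp: lookup_add tau_add sig_pow_add sc_simps algebra_simps)

lemma chi_r_scale: "chi_r D k p (loop_scale D c X) = loop_scale D (cnj c) (chi_r D k p X)"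
  by (rule loop_eqI) (auto simp: tau_antilinear sig_pow_sc mult_ac)

lemma cnj_rt_mult: "cnj \<omega> powi i * \<omega> powi i = 1" "\<omega> powi i * cnj \<omega> powi i = 1"
  by (simp_all add: cnj_rt power_int_inverse)

text \<open>The dihedral relation for the action on the Lie algebra. It encodes that \<tau>
  preserves eigenspaces: on degree i the two \<sigma> contribute \<omega>^i and its conjugate, whose
  product is 1.\<close>

lemma sig_tau_sig: "sig D (tau D (sig D x)) = tau D x"
proof -
  have *: "sig D (tau D (sig D (proj i x))) = tau D (proj i x)" for i
  proof -
    have "sig D (proj i x) = sc D (\<omega> powi i) (proj i x)" "sig D (tau D (proj i x)) = sc D (\<omega> powi i) (tau D (proj i x))"
      using proj_eig[of i x] eig_tau[OF proj_eig[of i x]] by (simp_all add: eig_iff)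
    then show ?thesis
      by (simp add: tau_antilinear sig_sc cnj_rt_mult)
  qed
  have tau_sum: "tau D (sum f A) = (\<Sum>i\<in>A. tau D (f i))" for f and A :: "nat set"
    by (induction A rule: infinite_finite_induct) (auto simp: tau_add)
  have "sig D (tau D (sig D (\<Sum>i<T. proj (int i) x))) = tau D (\<Sum>i<T. proj (int i) x)"
    by (simp add: sig_sum tau_sum *)
  then show ?thesis by (simp add: sum_proj)
qed

lemma sig_pow_tau_sig_pow: "(sig D ^^ k) (tau D ((sig D ^^ k) x)) = tau D x"
proof (induction k arbitrary: x)
  case (Suc k)
  have "(sig D ^^ Suc k) (tau D ((sig D ^^ Suc k) x)) = sig D ((sig D ^^ k) (tau D ((sig D ^^ k) (sig D x))))"
    by (simp add: funpow_swap1)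
  then show ?case by (simp add: Suc sig_tau_sig)
qed auto

text \<open>Being antilinear and involutive, the reflection fixes both entries X + \<chi> X and \<i>
  (X - \<chi> X) of a generator at a real point.\<close>

lemma chi_r_chi_r: "chi_r D k p (chi_r D k p X) = X"
proof (rule loop_eqI)
  fix n show "lookup (fst (chi_r D k p (chi_r D k p X))) n = lookup (fst X) n"
    by (simp add: tau_antilinear sig_pow_sc sig_pow_tau_sig_pow tau_involutive cnj_rt_mult)
next
  show "snd (chi_r D k p (chi_r D k p X)) = snd X" by (simp add: cnj_rt_mult flip: mult.assoc)
qed

section \<open>Bilinearity of the affine bracket\<close>

definition mode_br :: "int \<Rightarrow> int \<Rightarrow> 'g \<Rightarrow> 'g \<Rightarrow> 'g loop" where
  "mode_br m n x y = (single (m + n) (br D x y), of_int m * of_bool (m + n = 0) * frm D x y)"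

lemma mode_br_nth [simp]: "lookup (fst (mode_br m n x y)) k = (if m + n = k then br D x y else 0)"
  "snd (mode_br m n x y) = of_int m * of_bool (m + n = 0) * frm D x y"
  by (auto simp: mode_br_def lookup_single when_def)

lemma loop_br_superset:
  assumes "finite A" "keys (fst X) \<subseteq> A" "finite B" "keys (fst Y) \<subseteq> B"
  shows "loop_br D X Y = (\<Sum>m\<in>A. \<Sum>n\<in>B. mode_br m n (lookup (fst X) m) (lookup (fst Y) n))"
proof -
  have z: "mode_br m n 0 y = 0" "mode_br m n x 0 = 0" for m n x y
    by (auto simp: mode_br_def zero_prod_def)
  have "loop_br D X Y = (\<Sum>m\<in>keys (fst X). \<Sum>n\<in>B. mode_br m n (lookup (fst X) m) (lookup (fst Y) n))"
    unfolding loop_br_def Let_def mode_br_def[symmetric] using assms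
    by (intro sum.cong refl sum.mono_neutral_left) (auto simp: z in_keys_iff)
  also have "\<dots> = (\<Sum>m\<in>A. \<Sum>n\<in>B. mode_br m n (lookup (fst X) m) (lookup (fst Y) n))"
    using assms by (intro sum.mono_neutral_left) (auto simp: z in_keys_iff)
  finally show ?thesis .
qed

lemma mode_br_add: "mode_br m n (x + x') y = mode_br m n x y + mode_br m n x' y" "mode_br m n x (y + y') = mode_br m n x y + mode_br m n x y'"
  by (auto simp: mode_br_def br_add_left br_add_right single_add frm_add_left frm_add_right algebra_simps)

lemma mode_br_sc: "mode_br m n (sc D c x) y = loop_scale D c (mode_br m n x y)" "mode_br m n x (sc D c y) = loop_scale D c (mode_br m n x y)"
  by (auto intro!: loop_eqI simp: br_sc_left br_sc_right frm_sc_left frm_sc_right)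

lemma loop_br_add_left: "loop_br D (X + X') Y = loop_br D X Y + loop_br D X' Y"
proof -
  let ?A = "keys (fst X) \<union> keys (fst X')"
  have "loop_br D Z Y = (\<Sum>m\<in>?A. \<Sum>n\<in>keys (fst Y). mode_br m n (lookup (fst Z) m) (lookup (fst Y) n))"
    if "keys (fst Z) \<subseteq> ?A" for Z
    by (rule loop_br_superset) (use that in auto)
  then show ?thesis
    using Poly_Mapping.keys_add[of "fst X" "fst X'"] by (simp add: lookup_add mode_br_add sum.distrib)
qed

lemma loop_br_add_right: "loop_br D X (Y + Y') = loop_br D X Y + loop_br D X Y'"
proof -
  let ?A = "keys (fst Y) \<union> keys (fst Y')"
  have "loop_br D X Z = (\<Sum>m\<in>keys (fst X). \<Sum>n\<in>?A. mode_br m n (lookup (fst X) m) (lookup (fst Z) n))"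
    if "keys (fst Z) \<subseteq> ?A" for Z
    by (rule loop_br_superset) (use that in auto)
  then show ?thesis
    using Poly_Mapping.keys_add[of "fst Y" "fst Y'"] by (simp add: lookup_add mode_br_add sum.distrib)
qed

lemma keys_loop_scale: "keys (fst (loop_scale D c X)) \<subseteq> keys (fst X)"
  by (auto simp: in_keys_iff)

lemma loop_br_scale_left: "loop_br D (loop_scale D c X) Y = loop_scale D c (loop_br D X Y)"
proof -
  let ?A = "keys (fst X)" and ?B = "keys (fst Y)"
  have "loop_br D (loop_scale D c X) (Y) = (\<Sum>m\<in>?A. \<Sum>n\<in>?B. mode_br m n (lookup (fst (loop_scale D c X)) m) (lookup (fst (Y)) n))"
    by (rule loop_br_superset) (use keys_loop_scale in auto)
  moreover have "loop_br D X Y = (\<Sum>m\<in>?A. \<Sum>n\<in>?B. mode_br m n (lookup (fst X) m) (lookup (fst Y) n))"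
    by (rule loop_br_superset) auto
  ultimately show ?thesis by (simp add: mode_br_sc lp.scale_sum_right)
qed

lemma loop_br_scale_right: "loop_br D X (loop_scale D c Y) = loop_scale D c (loop_br D X Y)"
proof -
  let ?A = "keys (fst X)" and ?B = "keys (fst Y)"
  have "loop_br D (X) (loop_scale D c Y) = (\<Sum>m\<in>?A. \<Sum>n\<in>?B. mode_br m n (lookup (fst (X)) m) (lookup (fst (loop_scale D c Y)) n))"
    by (rule loop_br_superset) (use keys_loop_scale in auto)
  moreover have "loop_br D X Y = (\<Sum>m\<in>?A. \<Sum>n\<in>?B. mode_br m n (lookup (fst X) m) (lookup (fst Y) n))"
    by (rule loop_br_superset) auto
  ultimately show ?thesis by (simp add: mode_br_sc lp.scale_sum_right)
qed

lemma loop_br_minus_left: "loop_br D (- X) Y = - loop_br D X Y"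
  using loop_br_scale_left[of "-1" X Y] by simp

lemma loop_br_minus_right: "loop_br D X (- Y) = - loop_br D X Y"
  using loop_br_scale_right[of X "-1" Y] by simp

lemma loop_br_diff_left: "loop_br D (X - X') Y = loop_br D X Y - loop_br D X' Y"
  using loop_br_add_left[of X "- X'" Y] by (simp add: loop_br_minus_left)

lemma loop_br_diff_right: "loop_br D X (Y - Y') = loop_br D X Y - loop_br D X Y'"
  using loop_br_add_right[of X Y "- Y'"] by (simp add: loop_br_minus_right)

lemma loop_br_0 [simp]: "loop_br D 0 Y = 0" "loop_br D X 0 = 0"
  by (simp_all add: loop_br_def)

lemma loop_br_lmode: "loop_br D (lmode x m) (lmode y n) = mode_br m n x y"
  by (subst loop_br_superset[of "{m}" _ "{n}"]) (auto simp: in_keys_iff split: if_splits)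

lemma mode_br_lmode: "mode_br m n x y = lmode (br D x y) (m + n)
    + loop_scale D (of_int m * of_bool (m + n = 0) * frm D x y) loopK"
  by (rule loop_eqI) (auto simp: mode_br_def lookup_add lookup_single when_def)

text \<open>Reversing the modes flips the sign of the cocycle; the sign in \<tau> K = - K restores
  it, and \<open>frm_tau\<close> accounts for the conjugation.\<close>

lemma loop_tau_br_lmode:
  "loop_br D (loop_tau D (lmode x m)) (loop_tau D (lmode y n)) = loop_tau D (loop_br D (lmode x m) (lmode y n))"
  unfolding loop_tau_lmode loop_br_lmode
  by (rule loop_eqI) (auto simp: tau_br frm_tau)

lemma chi_r_lmode: "chi_r D k p (lmode x m) = lmode (sc D (\<omega> powi (- (int k * int p))) ((sig D ^^ k) (tau D x))) (- m)"
  by (rule loop_eqI) auto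

text \<open>The phase \<omega>^(-kp) is multiplicative in p, so reflections at orders p and q
  combine to the one at order p + q.\<close>

lemma chi_r_br_lmode:
  "loop_br D (chi_r D k p (lmode x m)) (chi_r D k q (lmode y n)) = chi_r D k (p + q) (loop_br D (lmode x m) (lmode y n))"
proof -
  define u v where "u = \<omega> powi (- (int k * int p))" and "v = \<omega> powi (- (int k * int q))"
  have "- (int k * int (p + q)) = - (int k * int p) + - (int k * int q)" by (simp add: algebra_simps)
  then have c: "\<omega> powi (- (int k * int (p + q))) = u * v"
    by (simp only: u_def v_def power_int_add[OF disjI1[OF rt_nz]])
  show ?thesis
    unfolding chi_r_lmode loop_br_lmode u_def[symmetric] v_def[symmetric]
    by (rule loop_eqI) (auto simp only: mode_br_nth chi_r_nth c, auto simp: tau_br frm_tau frm_sig_pow sig_pow_br br_sc_left br_sc_right frm_sc_left frm_sc_right mult_ac)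
qed

section \<open>The Takiff algebras\<close>

lemma gmon_add: "gmon x p (X + Y) = gmon x p X + gmon x p Y"
  by (simp add: gmon_def single_add)

lemma gmon_diff: "gmon x p (X - Y) = gmon x p X - gmon x p Y"
  by (simp add: gmon_def single_diff)

lemma gmon_0 [simp]: "gmon x p 0 = 0"
  by (simp add: gmon_def)

lemma gmon_minus: "gmon x p (- X) = - gmon x p X"
  by (simp add: gmon_def single_uminus)

lemma gD_scale_gmon: "gD_scale D r (gmon x p X) = gmon x p (loop_scale D (of_real r) X)"
  by (rule poly_mapping_eqI, rule poly_mapping_eqI)
    (simp add: gD_scale_def gmon_def lookup_map_zero lookup_single when_def poly_mapping_eqI)

lemma takiff_br_single:
  "takiff_br D x (single p X) (single q Y) = (if p + q < mlt D x then single (p + q) (loop_br D X Y) else 0)"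
  by (auto simp: takiff_br_def)

lemma gD_br_gmon:
  assumes "finite (pts D)" "x \<in> pts D"
  shows "gD_br D (gmon x p X) (gmon y q Y) =
    (if x = y \<and> p + q < mlt D x then gmon x (p + q) (loop_br D X Y) else 0)"
proof -
  have t0: "takiff_br D z 0 w = 0" "takiff_br D z w 0 = 0" for z w by (auto simp: takiff_br_def)
  have "gD_br D (gmon x p X) (gmon y q Y)
     = (\<Sum>z\<in>pts D. if z = x then single x (takiff_br D x (single p X) (if x = y then single q Y else 0)) else 0)"
    unfolding gD_br_def gmon_def
    by (rule sum.cong) (auto simp: lookup_single when_def t0)
  also have "\<dots> = single x (takiff_br D x (single p X) (if x = y then single q Y else 0))"
    using assms by simp
  finally show ?thesis by (simp add: takiff_br_single t0 gmon_def)
qed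

text \<open>A complex space V, complexified over the reals, is the sum of V and its conjugate; this
  is the element with components A in V and B in the conjugate.\<close>

definition complex_pair :: "rpoint \<Rightarrow> nat \<Rightarrow> 'g loop \<Rightarrow> 'g loop \<Rightarrow> 'g gDC" where
  "complex_pair x p A B = (gmon x p (loop_scale D (1/2) (A + B)), gmon x p (loop_scale D (- (\<i>/2)) (A - B)))"

text \<open>V and its conjugate are commuting ideals of the complexification: the mixed brackets Q
  and R cancel in both entries.\<close>

lemma complex_pair_br:
  assumes "finite (pts D)" "x \<in> pts D"
  shows "gDC_br D (complex_pair x p A B) (complex_pair y q A' B') =
    (if x = y \<and> p + q < mlt D x then complex_pair x (p + q) (loop_br D A A') (loop_br D B B') else 0)"
proof -
  have s: "loop_br D (loop_scale D c X) (loop_scale D d Y) = loop_scale D (c * d) (loop_br D X Y)" for c d X Y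
    by (simp add: loop_br_scale_left loop_br_scale_right)
  have g1: "loop_scale D (1/2 * (1/2)) U - loop_scale D (- (\<i>/2) * - (\<i>/2)) V = loop_scale D (1/4) (U + V)"
    and g2: "loop_scale D (1/2 * - (\<i>/2)) U + loop_scale D (- (\<i>/2) * (1/2)) V = loop_scale D (- (\<i>/4)) (U + V)" for U V
    by (simp_all add: lp.scale_right_distrib)
  have half: "loop_scale D (c + c) Z = loop_scale D c (Z + Z)" for c Z
    by (simp only: lp.scale_left_distrib lp.scale_right_distrib)
  define P Q R S where "P = loop_br D A A'" and "Q = loop_br D A B'" and "R = loop_br D B A'" and "S = loop_br D B B'"
  note PQRS = P_def[symmetric] Q_def[symmetric] R_def[symmetric] S_def[symmetric]
  have br: "loop_br D (A + B) (A' + B') = P + Q + R + S" "loop_br D (A - B) (A' - B') = P - Q - R + S"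
    "loop_br D (A + B) (A' - B') = P - Q + R - S" "loop_br D (A - B) (A' + B') = P + Q - R - S"
    by (simp_all only: loop_br_add_left loop_br_add_right loop_br_diff_left loop_br_diff_right PQRS) simp_all
  have "loop_br D (loop_scale D (1/2) (A + B)) (loop_scale D (1/2) (A' + B'))
      - loop_br D (loop_scale D (- (\<i>/2)) (A - B)) (loop_scale D (- (\<i>/2)) (A' - B'))
      = loop_scale D (1/4) ((P + Q + R + S) + (P - Q - R + S))"
    unfolding s br by (rule g1)
  also have "\<dots> = loop_scale D (1/4) ((P + S) + (P + S))" by (simp add: algebra_simps)
  also have "\<dots> = loop_scale D (1/2) (P + S)" unfolding half[symmetric] by simp
  finally have 1: "loop_br D (loop_scale D (1/2) (A + B)) (loop_scale D (1/2) (A' + B'))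
      - loop_br D (loop_scale D (- (\<i>/2)) (A - B)) (loop_scale D (- (\<i>/2)) (A' - B'))
      = loop_scale D (1/2) (P + S)" .
  have "loop_br D (loop_scale D (1/2) (A + B)) (loop_scale D (- (\<i>/2)) (A' - B'))
      + loop_br D (loop_scale D (- (\<i>/2)) (A - B)) (loop_scale D (1/2) (A' + B'))
      = loop_scale D (- (\<i>/4)) ((P - Q + R - S) + (P + Q - R - S))"
    unfolding s br by (rule g2)
  also have "\<dots> = loop_scale D (- (\<i>/4)) ((P - S) + (P - S))" by (simp add: algebra_simps)
  also have "\<dots> = loop_scale D (- (\<i>/2)) (P - S)" unfolding half[symmetric] by simp
  finally have 2: "loop_br D (loop_scale D (1/2) (A + B)) (loop_scale D (- (\<i>/2)) (A' - B'))
      + loop_br D (loop_scale D (- (\<i>/2)) (A - B)) (loop_scale D (1/2) (A' + B'))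
      = loop_scale D (- (\<i>/2)) (P - S)" .
  show ?thesis
  proof (cases "x = y \<and> p + q < mlt D x")
    case True
    show ?thesis
      unfolding gDC_br_def complex_pair_def fst_conv snd_conv gD_br_gmon[OF assms] if_P[OF True]
        gmon_diff[symmetric] gmon_add[symmetric] 1 2 PQRS ..
  next
    case False
    then show ?thesis by (auto simp: gDC_br_def complex_pair_def gD_br_gmon[OF assms] zero_prod_def)
  qed
qed

lemma complex_pair_add: "complex_pair x p (A + A') (B + B') = complex_pair x p A B + complex_pair x p A' B'"
  by (simp add: complex_pair_def gmon_add gmon_diff lp.scale_right_distrib lp.scale_right_diff_distrib gmon_minus algebra_simps)

text \<open>Scalars of the complexification act on the second component through their conjugates, so
  a map X to (X, \<chi> X) with antilinear \<chi> becomes complex linear.\<close>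

lemma complex_pair_scale: "complex_pair x p (loop_scale D c A) (loop_scale D (cnj c) B) = gDC_scale D c (complex_pair x p A B)"
proof -
  define a b :: complex where "a = of_real (Re c)" and "b = of_real (Im c)"
  have c: "c = a + b * \<i>" "cnj c = a - b * \<i>"
    by (auto simp: complex_eq_iff a_def b_def)
  have ii: "b * \<i> * \<i> = - b" "\<i> * (b * \<i>) = - b" by (simp_all add: mult.assoc mult.left_commute[of \<i> b])
  have 1: "loop_scale D (1/2) (loop_scale D c A + loop_scale D (cnj c) B)
     = loop_scale D a (loop_scale D (1/2) (A + B)) - loop_scale D b (loop_scale D (- (\<i>/2)) (A - B))"
    unfolding c(2) unfolding c(1) by (simp add: lp.scale_right_distrib lp.scale_right_diff_distrib lp.scale_left_distrib lp.scale_left_diff_distrib ii mult.commute[of \<i>])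
  have 2: "loop_scale D (- (\<i>/2)) (loop_scale D c A - loop_scale D (cnj c) B)
     = loop_scale D a (loop_scale D (- (\<i>/2)) (A - B)) + loop_scale D b (loop_scale D (1/2) (A + B))"
    unfolding c(2) unfolding c(1) by (simp add: lp.scale_right_distrib lp.scale_right_diff_distrib lp.scale_left_distrib lp.scale_left_diff_distrib ii mult.commute[of \<i>])
  show ?thesis
    unfolding complex_pair_def 1 2 gmon_diff gmon_add by (simp add: gDC_scale_def gD_scale_gmon a_def b_def)
qed

end


section \<open>Generators attached to the points\<close>

context dihedral_affine_gaudin
begin

lemma pact_0 [simp]: "pact D (0, False) x = x"
  by (cases x) auto

lemma id_in_dihedral: "(0, False) \<in> dihedral D"
  using T_pos by (auto simp: dihedral_def)

lemma conj_in_orbit: "conj_pt x \<in> orbit D x"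
proof -
  have "(0, True) \<in> dihedral D" using T_pos by (auto simp: dihedral_def)
  moreover have "pact D (0, True) x = conj_pt x" by (cases x) auto
  ultimately show ?thesis unfolding orbit_def by (intro image_eqI[of _ _ "(0, True)"]) simp_all
qed

lemma self_in_orbit: "x \<in> orbit D x"
  using id_in_dihedral unfolding orbit_def by (intro image_eqI[of _ _ "(0, False)"]) simp_all

lemma conj_conj [simp]: "conj_pt (conj_pt x) = x"
  by (cases x) auto

lemma stab_Fin0: "stab D (Fin 0) = dihedral D" and stab_Infty: "stab D Infty = dihedral D"
proof -
  have "pact D g (Fin 0) = Fin 0" "pact D g Infty = Infty" for g by (cases g; simp)+
  then show "stab D (Fin 0) = dihedral D" "stab D Infty = dihedral D" by (simp_all add: stab_def)
qed

lemma dihedral_ne: "dihedral D \<noteq> {(0, False)}"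
proof -
  have "(0, True) \<in> dihedral D" using T_pos by (auto simp: dihedral_def)
  then show ?thesis by auto
qed

lemma pts_c_notin: "Fin 0 \<notin> pts_c D" "Infty \<notin> pts_c D"
  using dihedral_ne by (auto simp: pts_c_def stab_Fin0 stab_Infty)

lemma pts_c_f: "x \<in> pts_c D \<Longrightarrow> x \<notin> pts_f D"
  using pts_c_notin by (auto simp: pts_f_def)

lemma pts_c_r: "x \<in> pts_c D \<Longrightarrow> x \<notin> pts_r D"
  by (auto simp: pts_c_def pts_r_def pts_rk_def)

lemma pts_r_f: "x \<in> pts_r D \<Longrightarrow> x \<notin> pts_f D"
  by (auto simp: pts_f_def pts_r_def pts_rk_def)

text \<open>The conjugate of a point with trivial stabiliser is another point of its orbit, and
  distinct elements of \<open>pts\<close> have disjoint orbits.\<close>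

lemma pts_cbar_notin: "x \<in> pts_cbar D \<Longrightarrow> x \<notin> pts D"
proof
  assume "x \<in> pts_cbar D" "x \<in> pts D"
  then obtain y where y: "y \<in> pts_c D" "x = conj_pt y" by (auto simp: pts_cbar_def)
  have "(0, True) \<in> dihedral D" using T_pos by (auto simp: dihedral_def)
  moreover have "pact D (0, True) y = conj_pt y" by (cases y) auto
  moreover have "(0, True) \<notin> stab D y" using y(1) by (auto simp: pts_c_def)
  ultimately have "x \<noteq> y" unfolding stab_def y(2) by auto
  moreover have "y \<in> pts D" using y(1) by (auto simp: pts_c_def)
  ultimately have "orbit D x \<inter> orbit D y = {}"
    using orbits_disjoint \<open>x \<in> pts D\<close> by (auto simp: disjoint_family_on_def)
  then show False using conj_in_orbit[of y] self_in_orbit[of x] y(2) by auto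
qed

lemma pts_cbarD: "x \<in> pts_cbar D \<Longrightarrow> conj_pt x \<in> pts_c D"
  by (auto simp: pts_cbar_def)

lemma pts_subset: "x \<in> pts_c D \<Longrightarrow> x \<in> pts D" "x \<in> pts_r D \<Longrightarrow> x \<in> pts D" "x \<in> pts_f D \<Longrightarrow> x \<in> pts D"
  by (auto simp: pts_c_def pts_r_def pts_rk_def pts_f_def)

lemma pts_cbar_other: "x \<in> pts_cbar D \<Longrightarrow> x \<notin> pts_c D" "x \<in> pts_cbar D \<Longrightarrow> x \<notin> pts_r D" "x \<in> pts_cbar D \<Longrightarrow> x \<notin> pts_f D"
  using pts_cbar_notin pts_subset by blast+

lemma finite_pts_Z: "finite (pts_Z D)"
proof -
  have "finite (pts_c D)" "finite (pts_r D)"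
    by (rule finite_subset[OF _ pts_finite], use pts_subset in blast)+
  then show ?thesis by (simp add: pts_Z_def pts_cbar_def)
qed

lemma pts_Z_f: "x \<in> pts_Z D \<Longrightarrow> x \<notin> pts_f D"
  using pts_c_f pts_r_f pts_cbar_other(3) by (auto simp: pts_Z_def)

lemma pts_Z_Fin: "x \<in> pts_Z D \<Longrightarrow> x \<noteq> Infty \<and> x \<noteq> Fin 0"
proof -
  assume x: "x \<in> pts_Z D"
  then consider "x \<in> pts_c D" | "conj_pt x \<in> pts_c D" | "x \<in> pts_r D"
    using pts_cbarD by (auto simp: pts_Z_def)
  then show ?thesis
    by cases (use pts_c_notin in \<open>auto simp: pts_r_def pts_rk_def\<close>)
qed

definition refl_index :: "rpoint \<Rightarrow> nat" where
  "refl_index x = (THE k. k < T \<and> x \<in> pts_rk D k)"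

lemma refl_index: "x \<in> pts_r D \<Longrightarrow> refl_index x < T" "x \<in> pts_r D \<Longrightarrow> x \<in> pts_rk D (refl_index x)"
proof -
  assume "x \<in> pts_r D"
  then obtain k where k: "k < T" "x \<in> pts_rk D k" by (auto simp: pts_r_def)
  have "\<exists>!k. k < T \<and> x \<in> pts_rk D k"
  proof (rule ex1I[of _ k])
    fix j assume "j < T \<and> x \<in> pts_rk D j"
    then have "{(0, False), (j, True)} = {(0::nat, False), (k, True)}" using k by (simp add: pts_rk_def)
    then show "j = k" by (simp add: doubleton_eq_iff)
  qed (use k in simp)
  from theI'[OF this] show "refl_index x < T" "x \<in> pts_rk D (refl_index x)" by (auto simp: refl_index_def)
qed

text \<open>The point at which the Takiff factor sits: a conjugate pair shares the factor of its
  member in \<open>pts_c\<close>.\<close>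

definition base_pt :: "rpoint \<Rightarrow> rpoint" where
  "base_pt x = (if x \<in> pts_cbar D then conj_pt x else x)"

text \<open>
  Every generator is the sum of a part that is linear in \<open>X\<close> and an antilinear one. At the conjugate
  points \<open>gen\<close> is \<open>elt\<close> precomposed with \<open>\<tau>\<close>: this makes it linear in \<open>X\<close> at all points, and it
  absorbs both the opposite sign of the level and the opposite modes in the fields there.
\<close>

definition holo :: "rpoint \<Rightarrow> 'g loop \<Rightarrow> 'g loop" where
  "holo x X = (if x \<in> pts_cbar D then 0 else X)"

definition anti :: "rpoint \<Rightarrow> nat \<Rightarrow> 'g loop \<Rightarrow> 'g loop" where
  "anti x p X = (if x \<in> pts_c D then 0
     else if x \<in> pts_cbar D \<union> pts_f D then loop_tau D X else chi_r D (refl_index x) p X)"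

definition gen :: "rpoint \<Rightarrow> nat \<Rightarrow> 'g loop \<Rightarrow> 'g gDC" where
  "gen x p X = complex_pair (base_pt x) p (holo x X) (anti x p X)"

definition all_pts :: "rpoint set" where
  "all_pts = pts_Z D \<union> pts_f D"

lemma finite_all_pts: "finite all_pts"
  using finite_pts_Z pts_finite by (simp add: all_pts_def pts_f_def)

lemma all_ptsE:
  assumes "x \<in> all_pts"
  obtains (c) "x \<in> pts_c D" | (cbar) "x \<in> pts_cbar D" | (r) "x \<in> pts_r D" | (f) "x \<in> pts_f D"
  using assms by (auto simp: all_pts_def pts_Z_def)

lemma base_pt_pts: "x \<in> all_pts \<Longrightarrow> base_pt x \<in> pts D"
  by (erule all_ptsE) (auto simp: base_pt_def pts_subset pts_cbar_other dest: pts_cbarD)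

lemma mlt_base_pt: "x \<in> all_pts \<Longrightarrow> mlt D (base_pt x) = mlt D x"
  using mlt_conj[of "conj_pt x"] by (auto simp: base_pt_def dest: pts_cbarD)

lemma exps_base_pt: "x \<in> all_pts \<Longrightarrow> exps D (base_pt x) = exps D x"
  using mlt_base_pt[of x] pts_c_notin(2) by (cases x) (auto simp: exps_def base_pt_def dest: pts_cbarD)

lemma elt_gen:
  assumes "x \<in> pts_c D \<union> pts_r D \<union> pts_f D"
  shows "elt D x p X = gen x p X"
proof -
  have nb: "x \<notin> pts_cbar D" using assms pts_cbar_other by blast
  have "x \<in> pts_c D \<or> x \<notin> pts_c D" by blast
  then show ?thesis using nb pts_c_f[of x] pts_c_r[of x] pts_r_f[of x]
    by (auto simp: elt_def gen_def complex_pair_def elt_c_def elt_chi_def gD_scale_gmon base_pt_def holo_def anti_def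
       refl_index_def gmon_minus)
qed

lemma elt_gen_cbar:
  assumes "x \<in> pts_cbar D"
  shows "elt D x p X = gen x p (loop_tau D X)"
  using assms pts_cbar_other(1)[OF assms]
  by (simp add: elt_def gen_def complex_pair_def elt_cbar_def gD_scale_gmon base_pt_def holo_def anti_def gmon_minus)

lemma anti_add: "anti x p (X + Y) = anti x p X + anti x p Y"
  by (simp add: anti_def loop_tau_add chi_r_add)

lemma anti_scale: "anti x p (loop_scale D c X) = loop_scale D (cnj c) (anti x p X)"
  by (simp add: anti_def loop_tau_scale chi_r_scale)

lemma gen_add: "gen x p (X + Y) = gen x p X + gen x p Y"
proof -
  have "holo x (X + Y) = holo x X + holo x Y" by (simp add: holo_def)
  then show ?thesis by (simp add: gen_def anti_add complex_pair_add)
qed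

lemma gen_scale: "gen x p (loop_scale D c X) = gDC_scale D c (gen x p X)"
proof -
  have "holo x (loop_scale D c X) = loop_scale D c (holo x X)" by (simp add: holo_def)
  then show ?thesis by (simp add: gen_def anti_scale complex_pair_scale)
qed

lemma gen_0 [simp]: "gen x p 0 = 0"
  using gen_add[of x p 0 0] by simp

lemma anti_br:
  "loop_br D (anti x p (lmode u m)) (anti x q (lmode v n)) = anti x (p + q) (loop_br D (lmode u m) (lmode v n))"
  by (simp add: anti_def loop_tau_br_lmode chi_r_br_lmode)

lemma gen_br:
  assumes x: "x \<in> all_pts" and y: "y \<in> all_pts"
  shows "gDC_br D (gen x p (lmode u m)) (gen y q (lmode v n)) =
    (if x = y \<and> p + q < mlt D x then gen x (p + q) (loop_br D (lmode u m) (lmode v n)) else 0)"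
proof (cases "x = y")
  case True
  have "loop_br D (holo x X) (holo x Y) = holo x (loop_br D X Y)" for X Y by (simp add: holo_def)
  then show ?thesis using True x
    by (simp add: gen_def complex_pair_br[OF pts_finite base_pt_pts] mlt_base_pt anti_br)
next
  case False
  \<comment> \<open>Distinct points share a Takiff factor only as a conjugate pair. One generator is
    then purely linear and the other purely antilinear in X, so both components of the bracket
    vanish.\<close>
  have "base_pt x = base_pt y \<Longrightarrow> (x \<in> pts_c D \<and> y \<in> pts_cbar D) \<or> (y \<in> pts_c D \<and> x \<in> pts_cbar D)"
    using False pts_cbarD conj_conj unfolding base_pt_def by (metis)
  moreover have "complex_pair z k 0 0 = 0" for z k by (simp add: complex_pair_def) (simp add: zero_prod_def)
  ultimately show ?thesis using False pts_cbar_other(1)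
    by (auto simp: gen_def complex_pair_br[OF pts_finite base_pt_pts[OF x]] holo_def anti_def)
qed

subsection \<open>Invariance under stabilisers\<close>

text \<open>The degree required at order p at a fixed point. The sign at infinity reflects that
  rotation acts inversely on the local coordinate there.\<close>

definition weight :: "rpoint \<Rightarrow> nat \<Rightarrow> int" where
  "weight x p = (if x = Infty then - int p else int p)"

text \<open>Exactly the invariance of X \<otimes> \<epsilon>^p under the rotation. Away from the
  fixed points the stabilisers contain no rotation, so nothing is imposed.\<close>

definition admissible :: "rpoint \<Rightarrow> nat \<Rightarrow> 'g loop \<Rightarrow> bool" where
  "admissible x p X \<longleftrightarrow> (x \<in> pts_f D \<longrightarrow> loop_sig D X = loop_scale D (\<omega> powi weight x p) X)"

lemma loop_sig_add: "loop_sig D (X + Y) = loop_sig D X + loop_sig D Y"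
  by (rule loop_eqI) (auto simp: lookup_add sig_add)

lemma loop_sig_scale: "loop_sig D (loop_scale D c X) = loop_scale D c (loop_sig D X)"
  by (rule loop_eqI) (auto simp: sig_sc)

lemma loop_sig_0 [simp]: "loop_sig D 0 = 0"
  by (rule loop_eqI) auto

lemma admissible_add: "admissible x p X \<Longrightarrow> admissible x p Y \<Longrightarrow> admissible x p (X + Y)"
  by (simp add: admissible_def loop_sig_add lp.scale_right_distrib)

lemma admissible_scale: "admissible x p X \<Longrightarrow> admissible x p (loop_scale D c X)"
  by (simp add: admissible_def loop_sig_scale mult.commute)

lemma admissible_0 [simp]: "admissible x p 0"
  by (simp add: admissible_def)

lemma admissible_sum: "(\<And>i. i \<in> A \<Longrightarrow> admissible x p (f i)) \<Longrightarrow> admissible x p (sum f A)"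
  by (induction A rule: infinite_finite_induct) (auto intro: admissible_add)

lemma admissible_lmode: "(x \<in> pts_f D \<Longrightarrow> u \<in> eigenspace D (weight x p)) \<Longrightarrow> admissible x p (lmode u m)"
  by (auto simp: admissible_def eig_iff intro!: loop_eqI)

lemma admissible_loopK: "(x \<in> pts_f D \<Longrightarrow> T dvd p) \<Longrightarrow> admissible x p loopK"
proof -
  assume a: "x \<in> pts_f D \<Longrightarrow> T dvd p"
  have "\<omega> powi weight x p = 1" if "x \<in> pts_f D"
    using a[OF that] by (subst rt_powi_eq_1) (auto simp: weight_def)
  then show ?thesis by (auto simp: admissible_def intro!: loop_eqI)
qed

definition rotate :: "rpoint \<Rightarrow> nat \<Rightarrow> 'g loop \<Rightarrow> 'g loop" where
  "rotate x p X = loop_scale D (\<omega> powi (- weight x p)) (loop_sig D X)"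

lemma loop_tau_0 [simp]: "loop_tau D 0 = 0"
  by (rule loop_eqI) auto

lemma s_hat_single: "s_hat D x (single p X) = single p (rotate x p X)"
  by (auto simp: s_hat_def rotate_def weight_def)

lemma takiff_act_single:
  "takiff_act D x (k, e) (single p X) = single p ((rotate x p ^^ k) (if e then loop_tau D X else X))"
proof -
  have "(s_hat D x ^^ k) (single p Z) = single p ((rotate x p ^^ k) Z)" for Z
    by (induction k) (auto simp: s_hat_single)
  moreover have "t_hat D (single p X) = single p (loop_tau D X)"
    by (simp add: t_hat_def when_def)
  ultimately show ?thesis by simp
qed

lemma gmon_in_gD:
  assumes x: "x \<in> pts D" and p: "p \<in> exps D x"
    and inv: "\<And>k e. (k, e) \<in> stab D x \<Longrightarrow> (rotate x p ^^ k) (if e then loop_tau D X else X) = X"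
  shows "gmon x p X \<in> gD D"
proof -
  have "(s_hat D y ^^ k) 0 = 0" for y k by (induction k) (auto simp: s_hat_def)
  moreover have "t_hat D 0 = 0" by (rule poly_mapping_eqI) (simp add: t_hat_def Poly_Mapping.map.rep_eq)
  ultimately have "takiff_act D y g 0 = 0" for y g
    by (cases g) auto
  then show ?thesis using x p inv
    by (auto simp: gD_def gmon_def takiff_def lookup_single when_def takiff_act_single simp del: takiff_act.simps)
qed

lemma rotate_pow: "(rotate x p ^^ k) X = loop_scale D ((\<omega> powi (- weight x p)) ^ k) ((loop_sig D ^^ k) X)"
  by (induction k) (auto simp: rotate_def loop_sig_scale mult_ac)

text \<open>This membership is what licenses the linearity relations for \<open>svar\<close>.
  Invariance is automatic for a trivial stabiliser and built into \<chi> for a reflection; at a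
  fixed point \<chi> = \<tau> gives only the reflection, and admissibility supplies the
  rotations.\<close>

lemma gen_in_gDC:
  assumes x: "x \<in> all_pts" and p: "p \<in> exps D x" and admissible: "admissible x p X"
  shows "gen x p X \<in> gDC D"
  using x
proof (cases rule: all_ptsE)
  case c
  then have "stab D (base_pt x) = {(0, False)}" using pts_cbar_other(1)[of x] by (auto simp: base_pt_def pts_c_def)
  then have "gmon (base_pt x) p Z \<in> gD D" for Z
    using x p by (intro gmon_in_gD base_pt_pts) (auto simp: exps_base_pt)
  then show ?thesis by (simp add: gen_def complex_pair_def gDC_def)
next
  case cbar
  then have "stab D (base_pt x) = {(0, False)}" using pts_cbarD[of x] by (auto simp: base_pt_def pts_c_def)
  then have "gmon (base_pt x) p Z \<in> gD D" for Z
    using x p by (intro gmon_in_gD base_pt_pts) (auto simp: exps_base_pt)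
  then show ?thesis by (simp add: gen_def complex_pair_def gDC_def)
next
  case r
  have nb: "x \<notin> pts_cbar D" "x \<notin> pts_c D" "x \<notin> pts_f D" "x \<noteq> Infty"
    using pts_cbar_other(2) pts_c_r pts_r_f r by (auto simp: pts_r_def pts_rk_def)
  have stab: "stab D x = {(0, False), (refl_index x, True)}" using refl_index(2)[OF r] by (auto simp: pts_rk_def)
  have chi: "(rotate x p ^^ refl_index x) (loop_tau D Z) = chi_r D (refl_index x) p Z" for Z
  proof -
    have "(\<omega> powi (- weight x p)) ^ refl_index x = \<omega> powi (- weight x p * int (refl_index x))"
      by (simp only: power_int_mult power_int_of_nat)
    also have "- weight x p * int (refl_index x) = - (int (refl_index x) * int p)" using nb by (simp add: weight_def)
    finally show ?thesis unfolding rotate_pow chi_r_def by simp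
  qed
  have in_gD: "gmon x p Z \<in> gD D" if "chi_r D (refl_index x) p Z = Z" for Z
    using x p base_pt_pts[OF x] nb that by (intro gmon_in_gD) (auto simp: stab base_pt_def chi)
  have minus: "chi_r D (refl_index x) p (- Z) = - chi_r D (refl_index x) p Z" for Z
    using chi_r_scale[of "refl_index x" p "-1" Z] by simp
  have diff: "chi_r D (refl_index x) p (Y - Z) = chi_r D (refl_index x) p Y - chi_r D (refl_index x) p Z" for Y Z
    using chi_r_add[of "refl_index x" p Y "-Z"] by (simp add: minus)
  show ?thesis using nb
    by (auto simp: gen_def complex_pair_def gDC_def base_pt_def holo_def anti_def chi_r_scale chi_r_add chi_r_chi_r add.commute
      minus diff lp.scale_right_diff_distrib intro!: in_gD)
next
  case f
  have nb: "x \<notin> pts_cbar D" "x \<notin> pts_c D" using f pts_cbar_other pts_c_f by auto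
  have sX: "loop_sig D X = loop_scale D (\<omega> powi weight x p) X" using admissible f by (simp add: admissible_def)
  \<comment> \<open>\<tau> preserves each eigenspace of \<sigma>, so the antilinear part has the
    same degree as X.\<close>
  have stX: "loop_sig D (loop_tau D X) = loop_scale D (\<omega> powi weight x p) (loop_tau D X)"
  proof (rule loop_eqI)
    fix n
    have "lookup (fst (loop_sig D X)) (- n) = lookup (fst (loop_scale D (\<omega> powi weight x p) X)) (- n)" by (simp only: sX)
    then have "lookup (fst X) (- n) \<in> eigenspace D (weight x p)" by (simp add: eig_iff)
    from eig_tau[OF this]
    show "lookup (fst (loop_sig D (loop_tau D X))) n = lookup (fst (loop_scale D (\<omega> powi weight x p) (loop_tau D X))) n"
      by (simp add: eig_iff)
  next
    have "snd (loop_sig D X) = snd (loop_scale D (\<omega> powi weight x p) X)" by (simp only: sX)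
    then show "snd (loop_sig D (loop_tau D X)) = snd (loop_scale D (\<omega> powi weight x p) (loop_tau D X))"
      by auto
  qed
  have in_gD: "gmon x p Z \<in> gD D" if "loop_sig D Z = loop_scale D (\<omega> powi weight x p) Z" "loop_tau D Z = Z" for Z
  proof (rule gmon_in_gD)
    have "rotate x p Z = Z" unfolding rotate_def that(1)
      by (simp flip: power_int_add)
    then have "(rotate x p ^^ k) Z = Z" for k by (induction k) auto
    then show "(rotate x p ^^ k) (if e then loop_tau D Z else Z) = Z" for k e by (simp add: that(2))
  qed (use x p base_pt_pts[OF x] nb in \<open>auto simp: base_pt_def\<close>)
  have minus: "loop_tau D (- Z) = - loop_tau D Z" for Z
    using loop_tau_scale[of "-1" Z] by simp
  have diff: "loop_tau D (Y - Z) = loop_tau D Y - loop_tau D Z" for Y Z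
    using loop_tau_add[of Y "-Z"] by (simp add: minus)
  have sminus: "loop_sig D (- Z) = - loop_sig D Z" for Z
    using loop_sig_scale[of "-1" Z] by simp
  have sdiff: "loop_sig D (Y - Z) = loop_sig D Y - loop_sig D Z" for Y Z
    using loop_sig_add[of Y "-Z"] by (simp add: sminus)
  show ?thesis using nb f
    by (auto simp: gen_def complex_pair_def gDC_def base_pt_def holo_def anti_def loop_tau_scale loop_tau_add add.commute
      minus diff sminus sdiff loop_sig_scale loop_sig_add sX stX lp.scale_right_diff_distrib lp.scale_right_distrib mult.commute intro!: in_gD)
qed

section \<open>Linearity and levels modulo the level ideal\<close>

lemma svar_gen_sum:
  assumes x: "x \<in> all_pts" and p: "p \<in> exps D x" and admissible: "\<And>a. a \<in> A \<Longrightarrow> admissible x p (f a)"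
  shows "lev_eq D (\<Sum>a\<in>A. scst (c a) * svar (gen x p (f a))) (svar (gen x p (\<Sum>a\<in>A. loop_scale D (c a) (f a))))"
  using admissible
proof (induction A rule: infinite_finite_induct)
  case (insert a A)
  have "lev_eq D (\<Sum>a\<in>insert a A. scst (c a) * svar (gen x p (f a)))
     (svar (gen x p (loop_scale D (c a) (f a))) + svar (gen x p (\<Sum>a\<in>A. loop_scale D (c a) (f a))))"
    using insert unfolding sum.insert[OF insert(1,2)] gen_scale
    by (intro lev_eq_add lev_eq_sym[OF lev_eq_svar_scale] gen_in_gDC x p) auto
  also have "lev_eq D \<dots> (svar (gen x p (\<Sum>a\<in>insert a A. loop_scale D (c a) (f a))))"
    unfolding sum.insert[OF insert(1,2)] gen_add using insert
    by (intro lev_eq_sym[OF lev_eq_svar_add] gen_in_gDC x p admissible_scale admissible_sum) auto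
  finally show ?case .
qed (auto intro: lev_eq_sym svar_0)

text \<open>At a conjugate point the defining relation has the opposite sign, but \<open>gen\<close>
  there is \<open>elt\<close> composed with \<tau>, and \<tau> K = - K cancels it.\<close>

lemma svar_gen_K:
  assumes x: "x \<in> all_pts" and p: "p \<in> exps D x" and f: "x \<in> pts_f D \<Longrightarrow> T dvd p"
  shows "lev_eq D (svar (gen x p loopK)) (scst (\<i> * lev D x p))"
  using x
proof (cases rule: all_ptsE)
  case c then show ?thesis using level_ideal.level[of x D p] p by (simp add: lev_eq_def elt_gen)
next
  case r then show ?thesis using level_ideal.level[of x D p] p by (simp add: lev_eq_def elt_gen)
next
  case f then show ?thesis using level_ideal.level_fixed[of x D p] p assms(3) by (simp add: lev_eq_def elt_gen)
next
  case cbar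
  have K: "loop_tau D loopK = loop_scale D (-1) loopK" by (rule loop_eqI) auto
  have g: "gen x p loopK \<in> gDC D"
    using gen_in_gDC[OF x p admissible_loopK] f by simp
  have "lev_eq D (svar (elt D x p loopK)) (scst (- \<i> * lev D x p))"
    using level_ideal.level_bar[of x D p] cbar p by (simp add: lev_eq_def scst_minus)
  then have 1: "lev_eq D (svar (gDC_scale D (-1) (gen x p loopK))) (scst (- \<i> * lev D x p))"
    by (simp add: elt_gen_cbar[OF cbar] K gen_scale del: lp.scale_minus_left)
  have "lev_eq D (scst (-1) * svar (gen x p loopK)) (scst (- \<i> * lev D x p))"
    by (rule lev_eq_trans[OF lev_eq_sym[OF lev_eq_svar_scale[OF g]] 1])
  from lev_eq_scst[OF this, of "-1"] show ?thesis by (simp add: scst_minus)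
qed

end


section \<open>Tensors\<close>

lemma lookup_smul [simp]: "lookup (smul c F) k = scst c * lookup F k"
  by (simp add: smul_def lookup_map_zero)

lemma lookup_flip: "lookup (flip M) (a, b) = lookup M (b, a)"
proof -
  have "inj (prod.swap :: 'a \<times> 'a \<Rightarrow> 'a \<times> 'a)" by simp
  then show ?thesis by (simp add: flip_def map_key.rep_eq)
qed

lemma lookup_pb_series: "lookup (pb_series D A B m n) (a, b) = pbr D (lookup (A m) a) (lookup (B n) b)"
proof -
  have "lookup (pb_series D A B m n) (a, b) = (\<Sum>a'\<in>keys (A m). \<Sum>b'\<in>keys (B n).
        if b' = b then if a' = a then pbr D (lookup (A m) a) (lookup (B n) b) else 0 else 0)"
    unfolding pb_series_def lookup_sum by (intro sum.cong refl) (auto simp: lookup_single when_def)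
  then show ?thesis by (cases "lookup (B n) b = 0") (auto simp: in_keys_iff)
qed

text \<open>The second index fixes the mode taken from \<open>delta\<close>, so a single term is
  left. The product with F at \<theta>' has the same coefficients.\<close>

lemma mul_theta_delta: "mul_theta F delta m n = F (m + n)"
proof -
  have "{i. delta (m - i) n \<noteq> 0} = {m + n}" by (auto simp: delta_def)
  then show ?thesis by (auto simp: mul_theta_def delta_def intro!: poly_mapping_eqI)
qed

lemma mul_theta'_delta: "mul_theta' F delta m n = F (m + n)"
proof -
  have "{i. delta m (n - i) \<noteq> 0} = {m + n}" by (auto simp: delta_def)
  then show ?thesis by (auto simp: mul_theta'_def delta_def intro!: poly_mapping_eqI)
qed

context gaudin_algebra
begin

lemma lookup_tens: "lookup (tens D x f) a = (if a \<in> bas D then scst (frm D (dual D a) x) * f else 0)"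
proof -
  have "lookup (tens D x f) a = (\<Sum>a'\<in>bas D. if a' = a then scst (coord D x a) * f else 0)"
    unfolding tens_def lookup_sum by (intro sum.cong refl) (auto simp: lookup_single when_def)
  then show ?thesis by (simp add: coord_eq)
qed

lemma lookup_tens2: "lookup (tens2 D x y f) (a, b) =
  (if a \<in> bas D \<and> b \<in> bas D then scst (frm D (dual D a) x * frm D (dual D b) y) * f else 0)"
proof -
  have "lookup (tens2 D x y f) (a, b) = (\<Sum>a'\<in>bas D. \<Sum>b'\<in>bas D.
     if b' = b then if a' = a then scst (coord D x a * coord D y b) * f else 0 else 0)"
    unfolding tens2_def lookup_sum by (intro sum.cong refl) (auto simp: lookup_single when_def)
  then show ?thesis by (cases "b \<in> bas D") (auto simp: coord_eq)
qed

text \<open>The type allows coefficients at any index; for tensors supported on \<open>bas\<close>,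
  sums over \<open>keys\<close> and over \<open>bas\<close> agree.\<close>

definition supp :: "('g gP) \<Rightarrow> bool" where "supp F \<longleftrightarrow> (\<forall>a. a \<notin> bas D \<longrightarrow> lookup F a = 0)"

definition supp2 :: "('g ggP) \<Rightarrow> bool" where
  "supp2 M \<longleftrightarrow> (\<forall>a b. \<not> (a \<in> bas D \<and> b \<in> bas D) \<longrightarrow> lookup M (a, b) = 0)"

lemma supp_intros [intro]: "supp (tens D x f)" "supp F \<Longrightarrow> supp (smul c F)"
  "supp F \<Longrightarrow> supp G \<Longrightarrow> supp (F + G)" "supp F \<Longrightarrow> supp G \<Longrightarrow> supp (F - G)" "supp 0"
  by (auto simp: supp_def lookup_tens lookup_add lookup_minus)

lemma supp_sum [intro]: "(\<And>i. i \<in> A \<Longrightarrow> supp (f i)) \<Longrightarrow> supp (sum f A)"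
  by (auto simp: supp_def lookup_sum)

lemma supp_sig_tens [intro]: "supp (sig_tens D F)"
  unfolding sig_tens_def by auto

lemma supp_sig_tens_pow [intro]: "supp F \<Longrightarrow> supp ((sig_tens D ^^ k) F)"
  by (induction k) auto

lemma supp2_intros [intro]: "supp2 (tens2 D x y f)" "supp2 F \<Longrightarrow> supp2 (smul c F)"
  "supp2 F \<Longrightarrow> supp2 G \<Longrightarrow> supp2 (F + G)" "supp2 F \<Longrightarrow> supp2 G \<Longrightarrow> supp2 (F - G)"
  "supp2 F \<Longrightarrow> supp2 (flip F)"
  by (auto simp: supp2_def lookup_tens2 lookup_add lookup_minus lookup_flip)

lemma supp2_sum [intro]: "(\<And>i. i \<in> A \<Longrightarrow> supp2 (f i)) \<Longrightarrow> supp2 (sum f A)"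
  by (auto simp: supp2_def lookup_sum)

lemma supp2_comm_fst [intro]: "supp2 (comm_fst D M F)"
  unfolding comm_fst_def case_prod_unfold by auto

lemma supp2_comm_snd [intro]: "supp2 (comm_snd D M F)"
  unfolding comm_snd_def case_prod_unfold by auto

lemma supp2_rmat [intro]: "supp2 (rmat D z z')"
  unfolding rmat_def rmat0_def casimir_def by (intro supp2_intros supp2_sum)

section \<open>Contraction of tensors with vectors\<close>

definition pairing :: "'g \<Rightarrow> 'g gP \<Rightarrow> 'g spoly" where
  "pairing X F = (\<Sum>b\<in>bas D. scst (frm D X b) * lookup F b)"

lemma pairing_add: "pairing X (F + G) = pairing X F + pairing X G"
  and pairing_diff: "pairing X (F - G) = pairing X F - pairing X G"
  and pairing_smul: "pairing X (smul c F) = scst c * pairing X F"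
  and pairing_0 [simp]: "pairing X 0 = 0"
  by (simp_all add: pairing_def lookup_add lookup_minus distrib_left right_diff_distrib sum.distrib sum_subtractf sum_distrib_left mult_ac)

lemma pairing_sum: "pairing X (sum f A) = (\<Sum>i\<in>A. pairing X (f i))"
  by (induction A rule: infinite_finite_induct) (auto simp: pairing_add)

lemma pairing_add_left: "pairing (X + Y) F = pairing X F + pairing Y F"
  and pairing_sc_left: "pairing (sc D c X) F = scst c * pairing X F"
  and pairing_0_left [simp]: "pairing 0 F = 0"
  by (simp_all add: pairing_def frm_add_left frm_sc_left scst_add scst_mult distrib_right distrib_left sum.distrib sum_distrib_left mult_ac)

lemma pairing_sum_left: "pairing (sum f A) F = (\<Sum>i\<in>A. pairing (f i) F)"
  by (induction A rule: infinite_finite_induct) (auto simp: pairing_add_left)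

lemma pairing_minus_left: "pairing (- X) F = - pairing X F"
  using pairing_add_left[of X "- X" F] by (simp add: eq_neg_iff_add_eq_0 add.commute)

lemma frm_expand: "(\<Sum>b\<in>bas D. frm D X b * frm D (dual D b) y) = frm D X y"
proof -
  have "frm D X y = frm D X (\<Sum>b\<in>bas D. sc D (frm D (dual D b) y) b)" using expand_bas[of y] by simp
  then show ?thesis by (simp add: frm_sum_right frm_sc_right mult.commute)
qed

lemma pairing_tens: "pairing X (tens D y f) = scst (frm D X y) * f"
proof -
  have "pairing X (tens D y f) = (\<Sum>b\<in>bas D. scst (frm D X b * frm D (dual D b) y) * f)"
    unfolding pairing_def by (intro sum.cong refl) (simp add: lookup_tens scst_mult mult_ac)
  also have "\<dots> = scst (\<Sum>b\<in>bas D. frm D X b * frm D (dual D b) y) * f"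
    by (simp add: scst_sum sum_distrib_right)
  finally show ?thesis by (simp add: frm_expand)
qed

lemma pairing_keys:
  assumes "supp F"
  shows "pairing X F = (\<Sum>b\<in>keys F. scst (frm D X b) * lookup F b)"
  unfolding pairing_def using assms
  by (intro sum.mono_neutral_right) (auto simp: supp_def in_keys_iff)

lemma pairing_sig_tens:
  assumes "supp F"
  shows "pairing (sig D X) (sig_tens D F) = pairing X F"
  unfolding sig_tens_def pairing_sum pairing_tens frm_sig pairing_keys[OF assms] ..

text \<open>Invariance of the form moves \<sigma>^k from the field onto X, where it is a scalar.
  Together with the factor \<omega>^(-k) of the Lax matrix this produces the exponent i + 1 in
  \<open>mode\<close>.\<close>

lemma pairing_sig_tens_pow:
  assumes F: "supp F" and X: "X \<in> eigenspace D i"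
  shows "pairing X ((sig_tens D ^^ k) F) = scst (\<omega> powi (- int k * i)) * pairing X F"
proof (induction k)
  case (Suc k)
  have "X = sc D (\<omega> powi (- i) * \<omega> powi i) X" by (simp flip: power_int_add)
  then have "X = sig D (sc D (\<omega> powi (- i)) X)" using X by (simp add: sig_sc eig_iff)
  then have "pairing X ((sig_tens D ^^ Suc k) F) = pairing (sig D (sc D (\<omega> powi (- i)) X)) (sig_tens D ((sig_tens D ^^ k) F))"
    by simp
  also have "\<dots> = scst (\<omega> powi (- i)) * (scst (\<omega> powi (- int k * i)) * pairing X F)"
    using F by (subst pairing_sig_tens) (auto simp: pairing_sc_left Suc)
  also have "\<dots> = scst (\<omega> powi (- i) * \<omega> powi (- int k * i)) * pairing X F" by (simp only: scst_mult mult.assoc)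
  also have "\<omega> powi (- i) * \<omega> powi (- int k * i) = \<omega> powi (- int (Suc k) * i)"
    by (subst power_int_add[symmetric]) (auto simp: algebra_simps)
  finally show ?case .
qed auto

definition pairing2 :: "'g \<Rightarrow> 'g \<Rightarrow> 'g ggP \<Rightarrow> 'g spoly" where
  "pairing2 X Y M = (\<Sum>a\<in>bas D. \<Sum>b\<in>bas D. scst (frm D X a) * (scst (frm D Y b) * lookup M (a, b)))"

lemma pairing2_add: "pairing2 X Y (F + G) = pairing2 X Y F + pairing2 X Y G"
  and pairing2_diff: "pairing2 X Y (F - G) = pairing2 X Y F - pairing2 X Y G"
  and pairing2_smul: "pairing2 X Y (smul c F) = scst c * pairing2 X Y F"
  and pairing2_0 [simp]: "pairing2 X Y 0 = 0"
  by (simp_all add: pairing2_def lookup_add lookup_minus distrib_left right_diff_distrib sum.distrib sum_subtractf sum_distrib_left mult_ac)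

lemma pairing2_sum: "pairing2 X Y (sum f A) = (\<Sum>i\<in>A. pairing2 X Y (f i))"
  by (induction A rule: infinite_finite_induct) (auto simp: pairing2_add)

lemma pairing2_sum_left: "pairing2 (sum f A) Y M = (\<Sum>i\<in>A. pairing2 (f i) Y M)"
  unfolding pairing2_def frm_sum_left scst_sum sum_distrib_right
  by (subst sum.swap, subst (2) sum.swap) (simp add: sum.swap[of _ A])

lemma pairing2_sum_right: "pairing2 X (sum f A) M = (\<Sum>i\<in>A. pairing2 X (f i) M)"
  unfolding pairing2_def frm_sum_left scst_sum sum_distrib_right sum_distrib_left
  by (simp add: sum.swap[of _ A])

lemma pairing2_flip: "pairing2 X Y (flip M) = pairing2 Y X M"
  unfolding pairing2_def lookup_flip by (subst sum.swap) (simp add: mult.left_commute)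

lemma pairing2_dual:
  assumes "a \<in> bas D" "b \<in> bas D"
  shows "pairing2 (dual D a) (dual D b) M = lookup M (a, b)"
proof -
  have "pairing2 (dual D a) (dual D b) M = (\<Sum>a'\<in>bas D. \<Sum>b'\<in>bas D. if b' = b then if a' = a then lookup M (a, b) else 0 else 0)"
    unfolding pairing2_def by (intro sum.cong refl) (auto simp: dual assms)
  then show ?thesis using assms by simp
qed

lemma pairing2_tens2: "pairing2 X Y (tens2 D u v f) = scst (frm D X u * frm D Y v) * f"
proof -
  have "pairing2 X Y (tens2 D u v f) = (\<Sum>a\<in>bas D. \<Sum>b\<in>bas D.
      scst (frm D X a * frm D (dual D a) u) * (scst (frm D Y b * frm D (dual D b) v) * f))"
    unfolding pairing2_def by (intro sum.cong refl) (simp add: lookup_tens2 scst_mult mult_ac)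
  also have "\<dots> = (\<Sum>a\<in>bas D. scst (frm D X a * frm D (dual D a) u)) * (\<Sum>b\<in>bas D. scst (frm D Y b * frm D (dual D b) v) * f)"
    by (rule sum_product[symmetric])
  also have "\<dots> = scst (\<Sum>a\<in>bas D. frm D X a * frm D (dual D a) u) * (scst (\<Sum>b\<in>bas D. frm D Y b * frm D (dual D b) v) * f)"
    by (simp only: scst_sum sum_distrib_right)
  finally show ?thesis by (simp add: frm_expand scst_mult mult.assoc)
qed

lemma pairing2_pb_series:
  "pairing2 X Y (pb_series D A B m n) = pbr D (pairing X (A m)) (pairing Y (B n))"
  by (simp only: pairing2_def pairing_def lookup_pb_series pbr_sum_left pbr_scst_left)
    (simp only: pbr_sum_right pbr_scst_right sum_distrib_left)

section \<open>Commutators with the Casimir and the R-matrix\<close>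

definition comm_pairing :: "'g \<Rightarrow> 'g \<Rightarrow> 'g ggP \<Rightarrow> 'g gP \<Rightarrow> 'g spoly" where
  "comm_pairing X Y M F = (\<Sum>a\<in>bas D. \<Sum>b\<in>bas D. scst (frm D Y b) * lookup M (a, b) * pairing (br D X a) F)"

lemma sum_keys2:
  assumes "supp2 M" and z: "\<And>a b. lookup M (a, b) = 0 \<Longrightarrow> f a b = 0"
  shows "(\<Sum>(a, b)\<in>keys M. f a b) = (\<Sum>a\<in>bas D. \<Sum>b\<in>bas D. f a b)"
proof -
  have "(\<Sum>(a, b)\<in>keys M. f a b) = (\<Sum>(a, b)\<in>bas D \<times> bas D. f a b)"
    using assms by (intro sum.mono_neutral_left) (auto simp: supp2_def in_keys_iff)
  then show ?thesis by (simp add: sum.cartesian_product)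
qed

text \<open>Invariance of the form moves the bracket from the tensor onto X, so the field is paired
  with [X, a].\<close>

lemma pairing2_comm_fst:
  assumes M: "supp2 M" and F: "supp F"
  shows "pairing2 X Y (comm_fst D M F) = comm_pairing X Y M F"
proof -
  have "pairing2 X Y (comm_fst D M F) = (\<Sum>(a, b)\<in>keys M. \<Sum>c\<in>keys F.
     scst (frm D X (br D a c) * frm D Y b) * (lookup M (a, b) * lookup F c))"
    by (simp add: comm_fst_def pairing2_sum pairing2_tens2 case_prod_unfold)
  also have "\<dots> = (\<Sum>(a, b)\<in>keys M. scst (frm D Y b) * lookup M (a, b) * pairing (br D X a) F)"
    unfolding pairing_keys[OF F] frm_invariant[symmetric] sum_distrib_left
    by (intro sum.cong refl) (auto simp: scst_mult mult_ac)
  also have "\<dots> = comm_pairing X Y M F"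
    unfolding comm_pairing_def by (rule sum_keys2[OF M]) auto
  finally show ?thesis .
qed

lemma pairing2_comm_snd_flip:
  assumes M: "supp2 M" and F: "supp F"
  shows "pairing2 X Y (comm_snd D (flip M) F) = comm_pairing Y X M F"
proof -
  have "pairing2 X Y (comm_snd D (flip M) F) = (\<Sum>(a, b)\<in>keys (flip M). \<Sum>c\<in>keys F.
     scst (frm D X a * frm D Y (br D b c)) * (lookup (flip M) (a, b) * lookup F c))"
    by (simp add: comm_snd_def pairing2_sum pairing2_tens2 case_prod_unfold)
  also have "\<dots> = (\<Sum>(a, b)\<in>keys (flip M). scst (frm D X a) * lookup (flip M) (a, b) * pairing (br D Y b) F)"
    unfolding pairing_keys[OF F] frm_invariant[symmetric] sum_distrib_left
    by (intro sum.cong refl) (auto simp: scst_mult mult_ac)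
  also have "\<dots> = (\<Sum>a\<in>bas D. \<Sum>b\<in>bas D. scst (frm D X a) * lookup (flip M) (a, b) * pairing (br D Y b) F)"
    by (rule sum_keys2) (use M in auto)
  also have "\<dots> = comm_pairing Y X M F"
    unfolding comm_pairing_def lookup_flip by (rule sum.swap)
  finally show ?thesis .
qed

lemma comm_pairing_sum: "comm_pairing X Y (sum f A) F = (\<Sum>i\<in>A. comm_pairing X Y (f i) F)"
  unfolding comm_pairing_def lookup_sum sum_distrib_right sum_distrib_left
  by (simp add: sum.swap[of _ A])

lemma comm_pairing_smul: "comm_pairing X Y (smul c M) F = scst c * comm_pairing X Y M F"
  by (simp add: comm_pairing_def sum_distrib_left mult_ac)

lemma comm_pairing_tens2: "comm_pairing X Y (tens2 D u v 1) F = scst (frm D Y v) * pairing (br D X u) F"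
proof -
  have "comm_pairing X Y (tens2 D u v 1) F = (\<Sum>a\<in>bas D. \<Sum>b\<in>bas D.
     scst (frm D Y b * frm D (dual D b) v) * (pairing (br D X (sc D (frm D (dual D a) u) a)) F))"
    unfolding comm_pairing_def by (intro sum.cong refl) (simp add: lookup_tens2 br_sc_right pairing_sc_left scst_mult mult_ac)
  also have "\<dots> = scst (\<Sum>b\<in>bas D. frm D Y b * frm D (dual D b) v) * pairing (br D X (\<Sum>a\<in>bas D. sc D (frm D (dual D a) u) a)) F"
    by (simp only: scst_sum br_sum_right pairing_sum_left sum_distrib_right sum_distrib_left)
  finally show ?thesis by (simp add: frm_expand expand_bas[symmetric])
qed

text \<open>Contracting the second factor of the Casimir tensor with Y projects Y to degree
  -k.\<close>

lemma casimir_pairing: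
  assumes Y: "Y \<in> eigenspace D j"
  shows "(\<Sum>g\<in>gbas D k. sc D (frm D Y g) (gdual D k g)) = (if int T dvd j + k then Y else 0)"
proof (cases "int T dvd j + k")
  case True
  then have "Y \<in> eigenspace D (- k)" using eig_cong[of j "- k"] Y by simp
  then show ?thesis using True expand_gdual by simp
next
  case False
  then have "frm D Y g = 0" if "g \<in> gbas D k" for g using frm_eig_0[OF Y gbas_eig[OF that]] by simp
  then show ?thesis using False by simp
qed

lemma comm_pairing_casimir:
  assumes Y: "Y \<in> eigenspace D j"
  shows "comm_pairing X Y (casimir D k) F = (if int T dvd j + k then pairing (br D X Y) F else 0)"
proof -
  have "comm_pairing X Y (casimir D k) F = pairing (br D X (\<Sum>g\<in>gbas D k. sc D (frm D Y g) (gdual D k g))) F"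
    by (simp add: casimir_def comm_pairing_sum comm_pairing_tens2 br_sum_right pairing_sum_left br_sc_right pairing_sc_left)
  then show ?thesis by (simp add: casimir_pairing[OF Y])
qed

lemma pairing2_casimir:
  assumes Y: "Y \<in> eigenspace D j"
  shows "pairing2 X Y (casimir D k) = (if int T dvd j + k then scst (frm D X Y) else 0)"
proof -
  have "pairing2 X Y (casimir D k) = scst (frm D X (\<Sum>g\<in>gbas D k. sc D (frm D Y g) (gdual D k g)))"
    by (simp add: casimir_def pairing2_sum pairing2_tens2 frm_sum_right frm_sc_right scst_sum mult.commute)
  then show ?thesis by (simp add: casimir_pairing[OF Y])
qed

text \<open>The Casimir with index -k sees only degree k, so a vector of degree j selects the single
  term k = j mod T. The factor c is free because it is a field in the commutators and a scalar in
  the \<delta>' term.\<close>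

lemma rmat0_sum:
  "(\<Sum>k<T. scst (z ^ k * z' ^ (T - 1 - k)) * (if int T dvd j + (- int k) then c else 0)) =
   scst ((z' ^ T - z ^ T) * rcoef T j z z') * c" if "z ^ T \<noteq> z' ^ T"
proof -
  define k0 where "k0 = nat (j mod int T)"
  have k0: "k0 < T" using T_pos by (auto simp: k0_def nat_less_iff)
  have "int T dvd j + (- int k) \<longleftrightarrow> k = k0" if "k < T" for k
  proof -
    have "int T dvd j - int k \<longleftrightarrow> j mod int T = int k mod int T" using mod_eq_dvd_iff by metis
    also have "\<dots> \<longleftrightarrow> k = k0" using that T_pos by (auto simp: k0_def)
    finally show ?thesis by simp
  qed
  then have "(\<Sum>k<T. scst (z ^ k * z' ^ (T - 1 - k)) * (if int T dvd j + (- int k) then c else 0))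
    = (\<Sum>k<T. if k = k0 then scst (z ^ k * z' ^ (T - 1 - k)) * c else 0)"
    by (intro sum.cong refl) auto
  also have "\<dots> = scst (z ^ k0 * z' ^ (T - 1 - k0)) * c" using k0 by simp
  also have "z ^ k0 * z' ^ (T - 1 - k0) = (z' ^ T - z ^ T) * rcoef T j z z'"
    using that by (simp add: rcoef_def k0_def Let_def)
  finally show ?thesis .
qed

lemma comm_pairing_rmat:
  assumes Y: "Y \<in> eigenspace D j" and z: "z ^ T \<noteq> z' ^ T"
  shows "comm_pairing X Y (rmat D z z') F = scst (inverse (twist D z') * rcoef T j z z') * pairing (br D X Y) F"
proof -
  have "comm_pairing X Y (rmat0 D z z') F = scst (1 / (z' ^ T - z ^ T)) *
    (\<Sum>k<T. scst (z ^ k * z' ^ (T - 1 - k)) * (if int T dvd j + (- int k) then pairing (br D X Y) F else 0))"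
    unfolding rmat0_def comm_pairing_smul comm_pairing_sum comm_pairing_casimir[OF Y] ..
  also have "\<dots> = scst (rcoef T j z z') * pairing (br D X Y) F"
    unfolding rmat0_sum[OF z] mult.assoc[symmetric] scst_mult[symmetric] using z by simp
  finally show ?thesis by (simp add: rmat_def comm_pairing_smul scst_mult mult.assoc)
qed

lemma pairing2_rmat:
  assumes Y: "Y \<in> eigenspace D j" and z: "z ^ T \<noteq> z' ^ T"
  shows "pairing2 X Y (rmat D z z') = scst (inverse (twist D z') * rcoef T j z z' * frm D X Y)"
proof -
  have "pairing2 X Y (rmat0 D z z') = scst (1 / (z' ^ T - z ^ T)) *
    (\<Sum>k<T. scst (z ^ k * z' ^ (T - 1 - k)) * (if int T dvd j + (- int k) then scst (frm D X Y) else 0))"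
    unfolding rmat0_def pairing2_smul pairing2_sum pairing2_casimir[OF Y] ..
  also have "\<dots> = scst (rcoef T j z z') * scst (frm D X Y)"
    unfolding rmat0_sum[OF z] mult.assoc[symmetric] scst_mult[symmetric] using z by simp
  finally show ?thesis by (simp add: rmat_def pairing2_smul scst_mult mult.assoc)
qed

end


section \<open>The fields and the Lax matrix\<close>

context dihedral_affine_gaudin
begin

definition field_basis :: "rpoint \<Rightarrow> nat \<Rightarrow> 'g set" where
  "field_basis x p = (if x \<in> pts_f D then gbas D (weight x p) else bas D)"

definition field_dual :: "rpoint \<Rightarrow> nat \<Rightarrow> 'g \<Rightarrow> 'g" where
  "field_dual x p = (if x \<in> pts_f D then gdual D (weight x p) else dual D)"

definition gen_field :: "rpoint \<Rightarrow> nat \<Rightarrow> int \<Rightarrow> 'g gP" where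
  "gen_field x p m = (\<Sum>b\<in>field_basis x p. tens D (field_dual x p b) (svar (gen x p (lmode b (- m)))))"

lemma field_pt_eq: "x \<in> pts_Z D \<Longrightarrow> field_pt D x p m = gen_field x p m"
proof -
  assume x: "x \<in> pts_Z D"
  then have f: "x \<notin> pts_f D" using pts_Z_f by blast
  show ?thesis
  proof (cases "x \<in> pts_c D \<union> pts_r D")
    case True
    then show ?thesis using f by (auto simp: field_pt_def gen_field_def field_basis_def field_dual_def elt_gen)
  next
    case False
    \<comment> \<open>Basis vectors are fixed by \<tau>, so \<tau> merely reverses the mode: mode m
      of \<open>elt\<close> is mode -m of \<open>gen\<close>.\<close>
    then have "x \<in> pts_cbar D" using x by (auto simp: pts_Z_def)
    then show ?thesis using f False
      by (auto simp: field_pt_def gen_field_def field_basis_def field_dual_def elt_gen_cbar loop_tau_lmode bas_real)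
  qed
qed

lemma field_zero_eq: "Fin 0 \<in> pts D \<Longrightarrow> field_zero D p m = gen_field (Fin 0) p m"
  by (simp add: field_zero_def gen_field_def field_basis_def field_dual_def elt_gen pts_f_def weight_def)

lemma field_infty_eq: "field_infty D p m = gen_field Infty p m"
  using infty_pts by (simp add: field_infty_def gen_field_def field_basis_def field_dual_def elt_gen pts_f_def weight_def)

lemma supp_gen_field [intro]: "supp (gen_field x p m)"
  unfolding gen_field_def by auto

lemma pairing_gen_field: "pairing X (gen_field x p m) = (\<Sum>b\<in>field_basis x p. scst (frm D X (field_dual x p b)) * svar (gen x p (lmode b (- m))))"
  by (simp add: gen_field_def pairing_sum pairing_tens)

definition homogeneous_at :: "rpoint \<Rightarrow> nat \<Rightarrow> 'g \<Rightarrow> bool" where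
  "homogeneous_at x p X \<longleftrightarrow> (x \<in> pts_f D \<longrightarrow> X \<in> eigenspace D (weight x p))"

text \<open>The \<gg>-part of a field at a fixed point has degree - \<open>weight\<close>, which is
  orthogonal to every other degree than \<open>weight\<close>.\<close>

lemma pairing_field_0:
  assumes "x \<in> pts_f D" "X \<in> eigenspace D i" "\<not> int T dvd i - weight x p"
  shows "pairing X (gen_field x p m) = 0"
proof -
  have "frm D X (field_dual x p b) = 0" if "b \<in> field_basis x p" for b
    using frm_eig_0[OF assms(2) gdual_eig, of b "weight x p"] that assms by (auto simp: field_dual_def field_basis_def)
  then show ?thesis by (simp add: pairing_gen_field)
qed

lemma field_basis_homogeneous_at: "b \<in> field_basis x p \<Longrightarrow> homogeneous_at x p b"
  by (auto simp: field_basis_def homogeneous_at_def gbas_eig)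

lemma homogeneous_at_admissible: "homogeneous_at x p X \<Longrightarrow> admissible x p (lmode X m)"
  by (rule admissible_lmode) (auto simp: homogeneous_at_def)

lemma expand_field_basis: "homogeneous_at x p X \<Longrightarrow> (\<Sum>b\<in>field_basis x p. sc D (frm D X (field_dual x p b)) b) = X"
  using expand_bas[of X] expand_gbas[of X "weight x p"]
  by (auto simp: field_basis_def field_dual_def homogeneous_at_def frm_sym[of X])

lemma lev_eq_gen_field:
  assumes x: "x \<in> all_pts" and p: "p \<in> exps D x" and X: "homogeneous_at x p X"
  shows "lev_eq D (pairing X (gen_field x p m)) (svar (gen x p (lmode X (- m))))"
proof -
  have "lev_eq D (pairing X (gen_field x p m)) (svar (gen x p (\<Sum>b\<in>field_basis x p. loop_scale D (frm D X (field_dual x p b)) (lmode b (- m)))))"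
    unfolding pairing_gen_field by (rule svar_gen_sum[OF x p]) (auto intro: homogeneous_at_admissible field_basis_homogeneous_at)
  also have "(\<Sum>b\<in>field_basis x p. loop_scale D (frm D X (field_dual x p b)) (lmode b (- m))) = lmode X (- m)"
    by (simp only: lmode_sc[symmetric] lmode_sum[symmetric] expand_field_basis[OF X])
  finally show ?thesis .
qed

lemma weight_add: "weight x (p + q) = weight x p + weight x q"
  by (simp add: weight_def)

lemma homogeneous_at_br: "homogeneous_at x p X \<Longrightarrow> homogeneous_at x q Y \<Longrightarrow> homogeneous_at x (p + q) (br D X Y)"
  by (auto simp: homogeneous_at_def weight_add intro: eig_br)

text \<open>Orthogonality of degrees ensures that a central term appears only at orders where K has
  a generator.\<close>

lemma homogeneous_at_K:
  assumes "homogeneous_at x p X" "homogeneous_at x q Y" "frm D X Y \<noteq> 0" "x \<in> pts_f D"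
  shows "T dvd p + q"
proof -
  have "int T dvd weight x (p + q)"
    using frm_eig_0[of X "weight x p" Y "weight x q"] assms by (auto simp: homogeneous_at_def weight_add)
  then have "int T dvd int (p + q)" by (simp add: weight_def split: if_splits del: of_nat_add)
  then show ?thesis by (simp only: int_dvd_int_iff)
qed

lemma admissible_mode_br:
  assumes "homogeneous_at x p X" "homogeneous_at x q Y"
  shows "admissible x (p + q) (mode_br m n X Y)"
proof -
  have "admissible x (p + q) (loop_scale D (of_int m * of_bool (m + n = 0) * frm D X Y) loopK)"
  proof (cases "frm D X Y = 0")
    case False
    then show ?thesis using homogeneous_at_K[OF assms] by (intro admissible_scale admissible_loopK) auto
  qed simp
  then show ?thesis unfolding mode_br_lmode using homogeneous_at_br[OF assms] by (intro admissible_add homogeneous_at_admissible) auto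
qed

lemma mode_br_sum_left: "mode_br m n (sum f A) y = (\<Sum>i\<in>A. mode_br m n (f i) y)"
  by (induction A rule: infinite_finite_induct) (auto simp: mode_br_add intro!: loop_eqI)

lemma mode_br_sum_right: "mode_br m n x (sum f A) = (\<Sum>i\<in>A. mode_br m n x (f i))"
  by (induction A rule: infinite_finite_induct) (auto simp: mode_br_add intro!: loop_eqI)

text \<open>The central coefficient for modes -m and -n is -m times the form; multiplied by the \<i>
  of the level relation it is the negative of this.\<close>

definition cocycle :: "int \<Rightarrow> int \<Rightarrow> 'g \<Rightarrow> 'g \<Rightarrow> complex" where
  "cocycle m n X Y = delta' m n * frm D X Y"

lemma exps_add: "p \<in> exps D x \<Longrightarrow> p + q < mlt D x \<Longrightarrow> p + q \<in> exps D x"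
  by (auto simp: exps_def split: if_splits)

lemma svar_gen_mode_br:
  assumes x: "x \<in> all_pts" and p: "p \<in> exps D x" and pq: "p + q < mlt D x"
    and X: "homogeneous_at x p X" and Y: "homogeneous_at x q Y"
  shows "lev_eq D (svar (gen x (p + q) (mode_br (- m) (- n) X Y)))
    (pairing (br D X Y) (gen_field x (p + q) (m + n)) - scst (cocycle m n X Y * lev D x (p + q)))"
proof -
  have e: "p + q \<in> exps D x" using exps_add[OF p pq] .
  define c where "c = of_int (- m) * of_bool (- m + - n = 0) * frm D X Y"
  have c: "c * \<i> = - cocycle m n X Y"
    by (auto simp: c_def cocycle_def delta'_def algebra_simps)
  have 1: "lev_eq D (svar (gen x (p + q) (lmode (br D X Y) (- (m + n))))) (pairing (br D X Y) (gen_field x (p + q) (m + n)))"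
    by (rule lev_eq_sym[OF lev_eq_gen_field[OF x e homogeneous_at_br[OF X Y]]])
  have ld: "mode_br (- m) (- n) X Y = lmode (br D X Y) (- (m + n)) + loop_scale D c loopK"
    unfolding mode_br_lmode c_def by simp
  \<comment> \<open>The generator for K is known to be invariant only if the central coefficient is
    nonzero, hence the case distinction.\<close>
  show ?thesis
  proof (cases "c = 0")
    case True
    then have "cocycle m n X Y = 0" using c by simp
    then show ?thesis using 1 True by (simp add: ld)
  next
    case False
    then have a: "x \<in> pts_f D \<Longrightarrow> T dvd p + q" using homogeneous_at_K[OF X Y] by (auto simp: c_def)
    have K: "lev_eq D (svar (gen x (p + q) (loop_scale D c loopK))) (scst c * scst (\<i> * lev D x (p + q)))"
      unfolding gen_scale
      by (rule lev_eq_trans[OF lev_eq_svar_scale lev_eq_scst[OF svar_gen_K]])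
         (use x e a in \<open>auto intro!: gen_in_gDC admissible_loopK\<close>)
    have "lev_eq D (svar (gen x (p + q) (mode_br (- m) (- n) X Y)))
       (svar (gen x (p + q) (lmode (br D X Y) (- (m + n)))) + svar (gen x (p + q) (loop_scale D c loopK)))"
      unfolding ld gen_add
      by (rule lev_eq_svar_add) (use x e a homogeneous_at_br[OF X Y] in \<open>auto intro!: gen_in_gDC admissible_scale admissible_loopK homogeneous_at_admissible\<close>)
    also have "lev_eq D \<dots> (pairing (br D X Y) (gen_field x (p + q) (m + n)) + scst c * scst (\<i> * lev D x (p + q)))"
      by (intro lev_eq_add 1 K)
    also have "scst c * scst (\<i> * lev D x (p + q)) = - scst (cocycle m n X Y * lev D x (p + q))"
      unfolding scst_mult[symmetric] mult.assoc[symmetric] c by (simp add: scst_minus)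
    finally show ?thesis by simp
  qed
qed

text \<open>Inside \<open>pbr\<close> the pairings are expanded into single generators by exact
  bilinearity. Only the resulting linear expression is simplified modulo the ideal, by resumming
  over the basis for Y and then over the one for X.\<close>

lemma pbr_gen_field:
  assumes x: "x \<in> all_pts" and y: "y \<in> all_pts" and p: "p \<in> exps D x" and q: "q \<in> exps D y"
    and X: "homogeneous_at x p X" and Y: "homogeneous_at y q Y"
  shows "lev_eq D (pbr D (pairing X (gen_field x p m)) (pairing Y (gen_field y q n)))
    (if x = y \<and> p + q < mlt D x
     then pairing (br D X Y) (gen_field x (p + q) (m + n)) - scst (cocycle m n X Y * lev D x (p + q)) else 0)"
proof -
  have e: "pbr D (pairing X (gen_field x p m)) (pairing Y (gen_field y q n)) =
    (\<Sum>b\<in>field_basis x p. scst (frm D X (field_dual x p b)) * (\<Sum>c\<in>field_basis y q. scst (frm D Y (field_dual y q c)) *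
      svar (if x = y \<and> p + q < mlt D x then gen x (p + q) (mode_br (- m) (- n) b c) else 0)))"
    by (simp only: pairing_gen_field pbr_sum_left pbr_scst_left)
      (simp only: pbr_sum_right pbr_scst_right pbr_svar gen_br[OF x y] loop_br_lmode)
  show ?thesis
  proof (cases "x = y \<and> p + q < mlt D x")
    case True
    then have xy: "y = x" and pq: "p + q < mlt D x" by auto
    note Y = Y[unfolded xy]
    have e': "p + q \<in> exps D x" using exps_add[OF p pq] .
    have "pbr D (pairing X (gen_field x p m)) (pairing Y (gen_field y q n)) = (\<Sum>b\<in>field_basis x p. scst (frm D X (field_dual x p b)) *
      (\<Sum>c\<in>field_basis x q. scst (frm D Y (field_dual x q c)) * svar (gen x (p + q) (mode_br (- m) (- n) b c))))"
      unfolding e if_P[OF True] unfolding xy ..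
    also have "lev_eq D \<dots> (\<Sum>b\<in>field_basis x p. scst (frm D X (field_dual x p b)) * svar (gen x (p + q) (mode_br (- m) (- n) b Y)))"
    proof (intro lev_eq_sum lev_eq_scst)
      fix b assume b: "b \<in> field_basis x p"
      have "lev_eq D (\<Sum>c\<in>field_basis x q. scst (frm D Y (field_dual x q c)) * svar (gen x (p + q) (mode_br (- m) (- n) b c)))
         (svar (gen x (p + q) (\<Sum>c\<in>field_basis x q. loop_scale D (frm D Y (field_dual x q c)) (mode_br (- m) (- n) b c))))"
        by (rule svar_gen_sum[OF x e']) (auto intro: admissible_mode_br field_basis_homogeneous_at b)
      then show "lev_eq D (\<Sum>c\<in>field_basis x q. scst (frm D Y (field_dual x q c)) * svar (gen x (p + q) (mode_br (- m) (- n) b c)))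
         (svar (gen x (p + q) (mode_br (- m) (- n) b Y)))"
        by (simp only: mode_br_sc(2)[symmetric] mode_br_sum_right[symmetric] expand_field_basis[OF Y])
    qed
    also have "lev_eq D \<dots> (svar (gen x (p + q) (\<Sum>b\<in>field_basis x p. loop_scale D (frm D X (field_dual x p b)) (mode_br (- m) (- n) b Y))))"
      by (rule svar_gen_sum[OF x e']) (auto intro: admissible_mode_br field_basis_homogeneous_at Y)
    also have "(\<Sum>b\<in>field_basis x p. loop_scale D (frm D X (field_dual x p b)) (mode_br (- m) (- n) b Y)) = mode_br (- m) (- n) X Y"
      by (simp only: mode_br_sc(1)[symmetric] mode_br_sum_left[symmetric] expand_field_basis[OF X])
    also have "lev_eq D (svar (gen x (p + q) (mode_br (- m) (- n) X Y)))
      (pairing (br D X Y) (gen_field x (p + q) (m + n)) - scst (cocycle m n X Y * lev D x (p + q)))"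
      by (rule svar_gen_mode_br[OF x p pq X Y])
    finally show ?thesis unfolding if_P[OF True] .
  next
    case False
    have "lev_eq D (pbr D (pairing X (gen_field x p m)) (pairing Y (gen_field y q n)))
      (\<Sum>b\<in>field_basis x p. scst (frm D X (field_dual x p b)) * (\<Sum>c\<in>field_basis y q. scst (frm D Y (field_dual y q c)) * 0))"
      unfolding e if_not_P[OF False] by (intro lev_eq_sum lev_eq_scst svar_0)
    then show ?thesis unfolding if_not_P[OF False] by simp
  qed
qed

section \<open>Mode expansion of the Lax matrix and the twist function\<close>

abbreviation md :: "rpoint \<Rightarrow> nat \<Rightarrow> int \<Rightarrow> complex \<Rightarrow> complex" where
  "md \<equiv> mode T \<omega>"

lemma md_zero: "md (Fin 0) p i z = (if int T dvd int p - i then 1 / z ^ (p + 1) else 0)"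
  by (rule mode_zero[OF T_pos rt_root rt_primitive])

lemma md_cong: "int T dvd i - j \<Longrightarrow> md x p i z = md x p j z"
  by (rule mode_cong[OF T_pos rt_root rt_primitive])

lemma pts_f_eq: "pts_f D = insert Infty (if Fin 0 \<in> pts D then {Fin 0} else {})"
  using infty_pts by (auto simp: pts_f_def)

lemma sum_all_pts:
  "(\<Sum>x\<in>all_pts. f x) = (\<Sum>x\<in>pts_Z D. f x) + (if Fin 0 \<in> pts D then f (Fin 0) else (0 :: 'x :: ab_group_add)) + f Infty"
proof -
  have "(\<Sum>x\<in>all_pts. f x) = (\<Sum>x\<in>pts_Z D. f x) + (\<Sum>x\<in>pts_f D. f x)"
  proof -
    have "pts_Z D \<inter> pts_f D = {}" using pts_Z_f by blast
    then show ?thesis unfolding all_pts_def by (intro sum.union_disjoint finite_pts_Z) (simp_all add: pts_f_eq)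
  qed
  then show ?thesis by (simp add: pts_f_eq)
qed

text \<open>The powers z^q at infinity belong to order p = q + 1; order 0 must contribute
  nothing.\<close>

lemma sum_Infty_shift:
  assumes "f 0 = (0 :: 'x :: comm_monoid_add)"
  shows "(\<Sum>p<mlt D Infty. f p) = (\<Sum>q<mlt D Infty - 1. f (Suc q))"
proof -
  have "mlt D Infty = Suc (mlt D Infty - 1)" using mlt_pos[OF infty_pts] by simp
  then have "(\<Sum>p<mlt D Infty. f p) = (\<Sum>p<Suc (mlt D Infty - 1). f p)" by simp
  then show ?thesis unfolding sum.lessThan_Suc_shift assms by simp
qed

lemma md_Z:
  assumes "x \<in> pts_Z D"
  shows "md x p i z = 1 / of_nat T * (\<Sum>k<T. \<omega> powi (- int k * (i + 1)) / (\<omega> powi (- int k) * z - cval x) ^ (p + 1))"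
  using pts_Z_Fin[OF assms] by (simp add: mode_def)

text \<open>At the fixed points the coefficients in \<open>twist_lax\<close> ignore the degree while
  \<open>md\<close> filters by it; they differ only where the pairing with the field
  vanishes.\<close>

lemma pairing_twist_lax:
  assumes X: "X \<in> eigenspace D i"
  shows "pairing X (twist_lax D z m) = (\<Sum>x\<in>all_pts. \<Sum>p<mlt D x. scst (md x p i z) * pairing X (gen_field x p m))"
proof -
  have c: "scst (1 / of_nat T) * (scst (\<omega> powi (- int k) / u) * (scst (\<omega> powi (- int k * i)) * f))
    = scst (1 / of_nat T * (\<omega> powi (- int k * (i + 1)) / u)) * f" for k u f
  proof -
    have "\<omega> powi (- int k * (i + 1)) = \<omega> powi (- int k) * \<omega> powi (- int k * i)"
      by (subst power_int_add[symmetric]) (auto simp: algebra_simps)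
    then have e: "1 / of_nat T * (\<omega> powi (- int k * (i + 1)) / u) = 1 / of_nat T * ((\<omega> powi (- int k) / u) * \<omega> powi (- int k * i))"
      by simp
    show ?thesis unfolding e scst_mult by (simp only: mult.assoc)
  qed
  have "pairing X (smul (1 / of_nat T) (\<Sum>k<T. \<Sum>x\<in>pts_Z D. \<Sum>p<mlt D x.
          smul (\<omega> powi (- int k) / (\<omega> powi (- int k) * z - cval x) ^ (p + 1)) ((sig_tens D ^^ k) (field_pt D x p m))))
    = (\<Sum>k<T. \<Sum>x\<in>pts_Z D. \<Sum>p<mlt D x. scst (1 / of_nat T * (\<omega> powi (- int k * (i + 1)) /
         (\<omega> powi (- int k) * z - cval x) ^ (p + 1))) * pairing X (gen_field x p m))"
    unfolding pairing_smul pairing_sum sum_distrib_left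
    by (intro sum.cong refl) (simp only: field_pt_eq pairing_smul pairing_sig_tens_pow[OF supp_gen_field X] c)
  also have "\<dots> = (\<Sum>x\<in>pts_Z D. \<Sum>p<mlt D x. \<Sum>k<T. scst (1 / of_nat T * (\<omega> powi (- int k * (i + 1)) /
         (\<omega> powi (- int k) * z - cval x) ^ (p + 1))) * pairing X (gen_field x p m))"
    by (subst sum.swap) (intro sum.cong refl sum.swap)
  also have "\<dots> = (\<Sum>x\<in>pts_Z D. \<Sum>p<mlt D x. scst (md x p i z) * pairing X (gen_field x p m))"
    by (intro sum.cong refl) (simp only: md_Z sum_distrib_left scst_sum sum_distrib_right)
  finally have Z: "pairing X (smul (1 / of_nat T) (\<Sum>k<T. \<Sum>x\<in>pts_Z D. \<Sum>p<mlt D x.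
          smul (\<omega> powi (- int k) / (\<omega> powi (- int k) * z - cval x) ^ (p + 1)) ((sig_tens D ^^ k) (field_pt D x p m))))
    = (\<Sum>x\<in>pts_Z D. \<Sum>p<mlt D x. scst (md x p i z) * pairing X (gen_field x p m))" .
  have O: "pairing X (if Fin 0 \<in> pts D then \<Sum>p<mlt D (Fin 0). smul (1 / z ^ (p + 1)) (field_zero D p m) else 0)
    = (if Fin 0 \<in> pts D then \<Sum>p<mlt D (Fin 0). scst (md (Fin 0) p i z) * pairing X (gen_field (Fin 0) p m) else 0)"
  proof (cases "Fin 0 \<in> pts D")
    case True
    have "scst (1 / z ^ (p + 1)) * pairing X (gen_field (Fin 0) p m) = scst (md (Fin 0) p i z) * pairing X (gen_field (Fin 0) p m)" for p
    proof (cases "int T dvd int p - i")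
      case False
      then have "\<not> int T dvd i - weight (Fin 0) p" by (simp add: weight_def dvd_diff_commute)
      then show ?thesis using pairing_field_0[OF _ X] True by (simp add: pts_f_eq)
    qed (simp add: md_zero)
    then show ?thesis using True by (simp add: pairing_sum pairing_smul field_zero_eq)
  qed simp
  have I: "pairing X (\<Sum>q<mlt D Infty - 1. smul (z ^ q) (field_infty D (q + 1) m)) =
    - (\<Sum>p<mlt D Infty. scst (md Infty p i z) * pairing X (gen_field Infty p m))"
  proof -
    have "scst (z ^ q) * pairing X (gen_field Infty (Suc q) m) = - (scst (md Infty (Suc q) i z) * pairing X (gen_field Infty (Suc q) m))" for q
    proof (cases "int T dvd i + int (Suc q)")
      case False
      moreover have "i - weight Infty (Suc q) = i + int (Suc q)" by (simp add: weight_def)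
      ultimately have "\<not> int T dvd i - weight Infty (Suc q)" by (simp only: not_False_eq_True)
      then show ?thesis using pairing_field_0[OF _ X, of Infty "Suc q"] by (simp add: pts_f_eq)
    qed (simp add: mode_def scst_minus)
    then show ?thesis
      by (subst sum_Infty_shift) (auto simp: pairing_sum pairing_smul field_infty_eq mode_def[of _ _ _ 0] sum_negf)
  qed
  show ?thesis
    unfolding twist_lax_def pairing_add pairing_diff Z O I sum_all_pts by simp
qed

text \<open>Degree 0 is the right one because \<sigma> fixes K: at the fixed points
  \<open>md\<close> then vanishes unless T divides p, and so do the levels.\<close>

lemma twist_eq: "twist D z = (\<Sum>x\<in>all_pts. \<Sum>p<mlt D x. md x p 0 z * lev D x p)"
proof -
  have "1 / of_nat T * (\<Sum>k<T. \<Sum>x\<in>pts_Z D. \<Sum>p<mlt D x.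
          \<omega> powi (- int k) * lev D x p / (\<omega> powi (- int k) * z - cval x) ^ (p + 1))
    = (\<Sum>k<T. \<Sum>x\<in>pts_Z D. \<Sum>p<mlt D x. 1 / of_nat T * (\<omega> powi (- int k * (0 + 1)) /
         (\<omega> powi (- int k) * z - cval x) ^ (p + 1)) * lev D x p)"
    unfolding sum_distrib_left by simp
  also have "\<dots> = (\<Sum>x\<in>pts_Z D. \<Sum>p<mlt D x. \<Sum>k<T. 1 / of_nat T * (\<omega> powi (- int k * (0 + 1)) /
         (\<omega> powi (- int k) * z - cval x) ^ (p + 1)) * lev D x p)"
    by (subst sum.swap) (intro sum.cong refl sum.swap)
  also have "\<dots> = (\<Sum>x\<in>pts_Z D. \<Sum>p<mlt D x. md x p 0 z * lev D x p)"
    by (intro sum.cong refl) (simp only: md_Z sum_distrib_left sum_distrib_right)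
  finally have Z: "1 / of_nat T * (\<Sum>k<T. \<Sum>x\<in>pts_Z D. \<Sum>p<mlt D x.
          \<omega> powi (- int k) * lev D x p / (\<omega> powi (- int k) * z - cval x) ^ (p + 1))
    = (\<Sum>x\<in>pts_Z D. \<Sum>p<mlt D x. md x p 0 z * lev D x p)" .
  have O: "(if Fin 0 \<in> pts D then \<Sum>p<mlt D (Fin 0). lev D (Fin 0) p / z ^ (p + 1) else 0)
    = (if Fin 0 \<in> pts D then \<Sum>p<mlt D (Fin 0). md (Fin 0) p 0 z * lev D (Fin 0) p else 0)"
  proof (cases "Fin 0 \<in> pts D")
    case True
    have "lev D (Fin 0) p / z ^ (p + 1) = md (Fin 0) p 0 z * lev D (Fin 0) p" if "p < mlt D (Fin 0)" for p
      using lev_fixed[of "Fin 0" p] True that by (auto simp: md_zero pts_f_eq exps_def)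
    then show ?thesis using True by simp
  qed simp
  have I: "(\<Sum>q<mlt D Infty - 1. lev D Infty (q + 1) * z ^ q) = - (\<Sum>p<mlt D Infty. md Infty p 0 z * lev D Infty p)"
  proof -
    have "lev D Infty (Suc q) * z ^ q = - (md Infty (Suc q) 0 z * lev D Infty (Suc q))" if "q < mlt D Infty - 1" for q
    proof -
      have "int T dvd 0 + int (Suc q) \<longleftrightarrow> T dvd Suc q" by (simp only: add_0_left int_dvd_int_iff)
      then show ?thesis
        using lev_fixed[of Infty "Suc q"] that by (auto simp: mode_def pts_f_eq exps_def)
    qed
    then show ?thesis
      by (subst sum_Infty_shift) (auto simp: mode_def[of _ _ _ 0] sum_negf)
  qed
  show ?thesis
    unfolding twist_def Z O I sum_all_pts by simp
qed

text \<open>Thus every term to which \<open>pbr_gen_field\<close> does not apply carries the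
  coefficient 0, including order 0 at infinity.\<close>

lemma md_homogeneous_at:
  assumes x: "x \<in> all_pts" and X: "X \<in> eigenspace D i" and p: "p < mlt D x" and h: "md x p i z \<noteq> 0"
  shows "homogeneous_at x p X" "p \<in> exps D x"
proof -
  have "int T dvd i - weight x p" if "x \<in> pts_f D"
  proof -
    have "x = Infty \<or> x = Fin 0" using that by (auto simp: pts_f_def)
    then show ?thesis using h by (auto simp: md_zero weight_def mode_def[of _ _ Infty] dvd_diff_commute split: if_splits)
  qed
  then show "homogeneous_at x p X" using X eig_cong by (auto simp: homogeneous_at_def)
  show "p \<in> exps D x" using h p by (auto simp: exps_def mode_def[of _ _ Infty] split: if_splits)
qed

section \<open>The Poisson bracket of the Lax matrix\<close>

lemma sum_triangle:
  fixes f :: "nat \<Rightarrow> nat \<Rightarrow> 'x :: comm_monoid_add"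
  shows "(\<Sum>p<n. \<Sum>q<n. if p + q < n then f p q else 0) = (\<Sum>r<n. \<Sum>p\<le>r. f p (r - p))"
proof -
  have "(\<Sum>p<n. \<Sum>q<n. if p + q < n then f p q else 0) = (\<Sum>(p, q)\<in>{..<n} \<times> {..<n}. if p + q < n then f p q else 0)"
    by (simp add: sum.cartesian_product)
  also have "\<dots> = (\<Sum>(p, q)\<in>{(p, q). p + q < n}. f p q)"
    by (intro sum.mono_neutral_cong_right) (auto split: if_splits)
  also have "\<dots> = (\<Sum>r<n. \<Sum>p\<le>r. f p (r - p))" by (rule sum.triangle_reindex)
  finally show ?thesis .
qed

lemma md_product_regular:
  assumes x: "x \<in> all_pts" and z: "regular D z" and z': "regular D z'" and zz: "z ^ T \<noteq> z' ^ T"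
  shows "(\<Sum>p\<le>r. md x p i z * md x (r - p) j z') =
    rcoef T j z z' * md x r (i + j) z + rcoef T i z' z * md x r (i + j) z'"
proof -
  have "\<omega> powi (- int k) * u \<noteq> a" if u: "regular D u" and xa: "x = Fin a" and k: "k < T" for u a k
  proof (cases "x \<in> pts_Z D")
    case True
    then have "\<omega> powi (- int k) * u \<noteq> cval x" using u k unfolding regular_def by blast
    then show ?thesis using xa by simp
  next
    case False
    then have "x \<in> pts_f D" using x by (auto simp: all_pts_def)
    then have "a = 0" "Fin 0 \<in> pts D" using xa by (auto simp: pts_f_def)
    then show ?thesis using u by (auto simp: regular_def)
  qed
  then show ?thesis using z z' zz by (intro mode_product[OF T_pos rt_root rt_primitive]) auto
qed

lemma pbr_twist_lax:
  assumes z: "regular D z" and z': "regular D z'" and zz: "z ^ T \<noteq> z' ^ T"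
    and X: "X \<in> eigenspace D i" and Y: "Y \<in> eigenspace D j"
  shows "lev_eq D (pbr D (pairing X (twist_lax D z m)) (pairing Y (twist_lax D z' n)))
    (scst (rcoef T j z z') * pairing (br D X Y) (twist_lax D z (m + n))
     + scst (rcoef T i z' z) * pairing (br D X Y) (twist_lax D z' (m + n))
     - scst (cocycle m n X Y * (rcoef T j z z' * twist D z + rcoef T i z' z * twist D z')))"
proof -
  define G where "G x r = pairing (br D X Y) (gen_field x r (m + n)) - scst (cocycle m n X Y * lev D x r)" for x r
  have XY: "br D X Y \<in> eigenspace D (i + j)" using X Y by (rule eig_br)
  have "pbr D (pairing X (twist_lax D z m)) (pairing Y (twist_lax D z' n))
    = (\<Sum>x\<in>all_pts. \<Sum>p<mlt D x. \<Sum>y\<in>all_pts. \<Sum>q<mlt D y.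
        scst (md x p i z * md y q j z') * pbr D (pairing X (gen_field x p m)) (pairing Y (gen_field y q n)))"
    unfolding pairing_twist_lax[OF X] pairing_twist_lax[OF Y]
    by (simp only: pbr_sum_left pbr_scst_left)
       (simp only: pbr_sum_right pbr_scst_right sum_distrib_left scst_mult mult.assoc)
  also have "lev_eq D \<dots> (\<Sum>x\<in>all_pts. \<Sum>p<mlt D x. \<Sum>y\<in>all_pts. \<Sum>q<mlt D y.
        scst (md x p i z * md y q j z') * (if x = y \<and> p + q < mlt D x then G x (p + q) else 0))"
  proof (intro lev_eq_sum)
    fix x p y q assume a: "x \<in> all_pts" "p \<in> {..<mlt D x}" "y \<in> all_pts" "q \<in> {..<mlt D y}"
    show "lev_eq D (scst (md x p i z * md y q j z') * pbr D (pairing X (gen_field x p m)) (pairing Y (gen_field y q n)))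
       (scst (md x p i z * md y q j z') * (if x = y \<and> p + q < mlt D x then G x (p + q) else 0))"
    proof (cases "md x p i z * md y q j z' = 0")
      case False
      then have "homogeneous_at x p X" "p \<in> exps D x" "homogeneous_at y q Y" "q \<in> exps D y"
        using md_homogeneous_at[OF a(1) X, of p z] md_homogeneous_at[OF a(3) Y, of q z'] a by auto
      then show ?thesis unfolding G_def by (intro lev_eq_scst pbr_gen_field a(1,3))
    next
      case True
      show ?thesis unfolding True scst_0 mult_zero_left by (rule lev_eq_refl)
    qed
  qed
  \<comment> \<open>Distinct points commute, and G depends on p and q only through p + q; grouping
    by r = p + q exposes the sums of \<open>md_product_regular\<close>.\<close>
  also have "(\<Sum>x\<in>all_pts. \<Sum>p<mlt D x. \<Sum>y\<in>all_pts. \<Sum>q<mlt D y.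
        scst (md x p i z * md y q j z') * (if x = y \<and> p + q < mlt D x then G x (p + q) else 0))
    = (\<Sum>x\<in>all_pts. \<Sum>r<mlt D x. scst (\<Sum>p\<le>r. md x p i z * md x (r - p) j z') * G x r)"
  proof (rule sum.cong[OF refl])
    fix x assume x: "x \<in> all_pts"
    have "(\<Sum>p<mlt D x. \<Sum>y\<in>all_pts. \<Sum>q<mlt D y.
        scst (md x p i z * md y q j z') * (if x = y \<and> p + q < mlt D x then G x (p + q) else 0))
      = (\<Sum>p<mlt D x. \<Sum>y\<in>all_pts. if y = x then \<Sum>q<mlt D x.
        if p + q < mlt D x then scst (md x p i z * md x q j z') * G x (p + q) else 0 else 0)"
      by (intro sum.cong refl) (auto intro!: sum.cong)
    also have "\<dots> = (\<Sum>p<mlt D x. \<Sum>q<mlt D x.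
        if p + q < mlt D x then scst (md x p i z * md x q j z') * G x (p + q) else 0)"
      using x finite_all_pts by simp
    also have "\<dots> = (\<Sum>r<mlt D x. \<Sum>p\<le>r. scst (md x p i z * md x (r - p) j z') * G x (p + (r - p)))"
      by (rule sum_triangle)
    also have "\<dots> = (\<Sum>r<mlt D x. scst (\<Sum>p\<le>r. md x p i z * md x (r - p) j z') * G x r)"
      by (auto simp: scst_sum sum_distrib_right intro!: sum.cong)
    finally show "(\<Sum>p<mlt D x. \<Sum>y\<in>all_pts. \<Sum>q<mlt D y.
        scst (md x p i z * md y q j z') * (if x = y \<and> p + q < mlt D x then G x (p + q) else 0))
      = (\<Sum>r<mlt D x. scst (\<Sum>p\<le>r. md x p i z * md x (r - p) j z') * G x r)" .
  qed
  also have "\<dots> = (\<Sum>x\<in>all_pts. \<Sum>r<mlt D x.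
     scst (rcoef T j z z') * (scst (md x r (i + j) z) * G x r) + scst (rcoef T i z' z) * (scst (md x r (i + j) z') * G x r))"
    by (intro sum.cong refl) (simp add: md_product_regular[OF _ z z' zz] scst_add scst_mult distrib_right mult.assoc)
  also have "\<dots> = scst (rcoef T j z z') * (\<Sum>x\<in>all_pts. \<Sum>r<mlt D x. scst (md x r (i + j) z) * G x r)
      + scst (rcoef T i z' z) * (\<Sum>x\<in>all_pts. \<Sum>r<mlt D x. scst (md x r (i + j) z') * G x r)"
    by (simp only: sum.distrib sum_distrib_left)
  also have S: "(\<Sum>x\<in>all_pts. \<Sum>r<mlt D x. scst (md x r (i + j) u) * G x r) =
     pairing (br D X Y) (twist_lax D u (m + n)) - scst (cocycle m n X Y * twist D u)" for u
  proof -
    \<comment> \<open>If the cocycle is nonzero, X and Y pair nontrivially, so i + j is 0 modulo T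
      and the coefficients are those of the twist function.\<close>
    have k: "cocycle m n X Y * (md x r (i + j) u * lev D x r) = cocycle m n X Y * (md x r 0 u * lev D x r)" for x r
    proof (cases "cocycle m n X Y = 0")
      case False
      then have "int T dvd (i + j) - 0" using frm_eig_0[OF X Y] by (auto simp: cocycle_def)
      from md_cong[OF this] show ?thesis by simp
    qed simp
    have "(\<Sum>x\<in>all_pts. \<Sum>r<mlt D x. scst (md x r (i + j) u) * G x r) =
      (\<Sum>x\<in>all_pts. \<Sum>r<mlt D x. scst (md x r (i + j) u) * pairing (br D X Y) (gen_field x r (m + n))) -
      scst (\<Sum>x\<in>all_pts. \<Sum>r<mlt D x. cocycle m n X Y * (md x r (i + j) u * lev D x r))"
      by (simp add: G_def right_diff_distrib sum_subtractf scst_sum scst_mult mult_ac)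
    also have "(\<Sum>x\<in>all_pts. \<Sum>r<mlt D x. cocycle m n X Y * (md x r (i + j) u * lev D x r)) = cocycle m n X Y * twist D u"
      unfolding k by (simp only: twist_eq sum_distrib_left)
    finally show ?thesis by (simp add: pairing_twist_lax[OF XY])
  qed
  finally show ?thesis unfolding S
    by (simp add: scst_add scst_mult algebra_simps)
qed

lemma supp_twist_lax [intro]: "supp (twist_lax D z m)"
  unfolding twist_lax_def field_zero_def field_infty_def field_pt_def
  by (auto intro!: supp_intros supp_sum supp_sig_tens_pow)

lemma supp_lax [intro]: "supp (lax D z m)"
  unfolding lax_def by auto

text \<open>Dividing by both twist functions explains the form of the R-matrix: in each field term
  one inverse completes a Lax matrix and the other goes into R, while in the \<delta>' term one
  inverse cancels against the twist function left by the levels. The minus sign of the second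
  commutator comes from [Y, X] = - [X, Y].\<close>

lemma pairing2_lax_bracket:
  assumes z: "regular D z" and z': "regular D z'" and zz: "z ^ T \<noteq> z' ^ T"
    and X: "X \<in> eigenspace D i" and Y: "Y \<in> eigenspace D j"
  shows "lev_eq D (pairing2 X Y (pb_series D (lax D z) (lax D z') m n))
    (pairing2 X Y (comm_fst D (rmat D z z') (lax D z (m + n)) - comm_snd D (flip (rmat D z' z)) (lax D z' (m + n))
      - smul (delta' m n) (rmat D z z' + flip (rmat D z' z))))"
proof -
  define a b R R' where "a = inverse (twist D z)" and "b = inverse (twist D z')" and
    "R = rcoef T j z z'" and "R' = rcoef T i z' z"
  have ab: "a * twist D z = 1" "b * twist D z' = 1" using z z' by (auto simp: a_def b_def regular_def)
  define P P' where "P = pairing (br D X Y) (twist_lax D z (m + n))" and "P' = pairing (br D X Y) (twist_lax D z' (m + n))"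
  have "pairing2 X Y (pb_series D (lax D z) (lax D z') m n) =
     scst (a * b) * pbr D (pairing X (twist_lax D z m)) (pairing Y (twist_lax D z' n))"
    by (simp add: pairing2_pb_series lax_def pairing_smul pbr_scst_left pbr_scst_right a_def b_def scst_mult mult.assoc)
  also have "lev_eq D \<dots> (scst (a * b) * (scst R * P + scst R' * P' - scst (cocycle m n X Y * (R * twist D z + R' * twist D z'))))"
    unfolding R_def R'_def P_def P'_def by (intro lev_eq_scst pbr_twist_lax[OF z z' zz X Y])
  also have "\<dots> = scst (a * b * R) * P + scst (a * b * R') * P' - scst (cocycle m n X Y * (b * R * (a * twist D z) + a * R' * (b * twist D z')))"
    by (simp add: right_diff_distrib distrib_left scst_add scst_mult mult_ac)
  also have "\<dots> = scst (a * b * R) * P + scst (a * b * R') * P' - scst (cocycle m n X Y * (b * R + a * R'))"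
    by (simp add: ab)
  also have "\<dots> = pairing2 X Y (comm_fst D (rmat D z z') (lax D z (m + n)) - comm_snd D (flip (rmat D z' z)) (lax D z' (m + n))
      - smul (delta' m n) (rmat D z z' + flip (rmat D z' z)))"
  proof -
    have 1: "pairing2 X Y (comm_fst D (rmat D z z') (lax D z (m + n))) = scst (a * b * R) * P"
      by (simp add: pairing2_comm_fst[OF supp2_rmat supp_lax] comm_pairing_rmat[OF Y zz])
        (simp add: lax_def pairing_smul a_def b_def R_def P_def scst_mult mult_ac)
    have 2: "pairing2 X Y (comm_snd D (flip (rmat D z' z)) (lax D z' (m + n))) = - (scst (a * b * R') * P')"
      by (simp add: pairing2_comm_snd_flip[OF supp2_rmat supp_lax] comm_pairing_rmat[OF X zz[symmetric]] br_antisym[of Y X] pairing_minus_left)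
        (simp add: lax_def pairing_smul a_def b_def R'_def P'_def scst_mult mult_ac)
    have 3: "pairing2 X Y (smul (delta' m n) (rmat D z z' + flip (rmat D z' z))) = scst (cocycle m n X Y * (b * R + a * R'))"
      by (simp add: pairing2_smul pairing2_add pairing2_flip pairing2_rmat[OF Y zz] pairing2_rmat[OF X zz[symmetric]] frm_sym[of Y X])
        (simp add: a_def b_def R_def R'_def cocycle_def distrib_left scst_add scst_mult mult_ac)
    show ?thesis unfolding pairing2_diff 1 2 3 by simp
  qed
  finally show ?thesis .
qed

text \<open>Dual basis vectors need not be homogeneous, so both are decomposed into eigenvectors
  before the bracket formula applies.\<close>

lemma lookup_pairing2:
  assumes "a \<in> bas D" "b \<in> bas D"
  shows "lookup M (a, b) = (\<Sum>i<T. \<Sum>j<T. pairing2 (proj (int i) (dual D a)) (proj (int j) (dual D b)) M)"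
  unfolding pairing2_sum_right[symmetric] sum_proj unfolding pairing2_sum_left[symmetric] sum_proj
  using pairing2_dual[OF assms] by simp

lemma lax_bracket:
  assumes z: "regular D z" and z': "regular D z'" and zz: "z ^ T \<noteq> z' ^ T"
  shows "lev_eq D (lookup (pb_series D (lax D z) (lax D z') m n) (a, b))
    (lookup (comm_fst D (rmat D z z') (lax D z (m + n)) - comm_snd D (flip (rmat D z' z)) (lax D z' (m + n))
      - smul (delta' m n) (rmat D z z' + flip (rmat D z' z))) (a, b))" (is "lev_eq D (lookup ?L _) (lookup ?R _)")
proof (cases "a \<in> bas D \<and> b \<in> bas D")
  case True
  then show ?thesis unfolding lookup_pairing2[OF conjunct1[OF True] conjunct2[OF True]]
    by (intro lev_eq_sum pairing2_lax_bracket[OF z z' zz proj_eig proj_eig])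
next
  \<comment> \<open>Off the basis indices both sides have zero coefficients by their
    supports.\<close>
  case False
  have "lookup ?L (a, b) = 0" using False supp_lax[of z m] supp_lax[of z' n]
    by (auto simp: lookup_pb_series supp_def)
  moreover have "supp2 ?R" by (intro supp2_intros supp2_comm_fst supp2_comm_snd supp2_rmat)
  ultimately show ?thesis using False by (auto simp: supp2_def)
qed

end

theorem corollary4p13:
  fixes D :: "('g::ab_group_add) gaudin" and z z' :: complex
  assumes "dihedral_affine_gaudin D"
    and "regular D z" and "regular D z'" and "z ^ cyc D \<noteq> z' ^ cyc D"
  shows "to_levels D (pb_series D (lax D z) (lax D z')) =
    to_levels D (\<lambda>m n.
        mul_theta (\<lambda>i. comm_fst D (rmat D z z') (lax D z i)) delta m n
      - mul_theta' (\<lambda>i. comm_snd D (flip (rmat D z' z)) (lax D z' i)) delta m n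
      - smul (delta' m n) (rmat D z z' + flip (rmat D z' z)))"
proof -
  interpret dihedral_affine_gaudin D by (rule assms)
  show ?thesis
    unfolding mul_theta_delta mul_theta'_delta
    using lev_class_eq[OF lax_bracket[OF assms(2-4)]] by (intro ext) (simp add: to_levels_def split_paired_all)
qed

end
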